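(* Let $T>0$. For $k=1,2$, let $\mathfrak{P}^{(k)}=\big(\beta^{(k)}_{ij}\big)_{1\le i,j\le 2}$ be a $2\times 2$ matrix-valued function on $\mathbb{R}^3$ with real-valued entries $\beta^{(k)}_{ij}\in C^\infty(\mathbb{R}^3)$, and let $\overrightarrow{U}^{(k)}=\begin{bmatrix} U^{(k)}_1 \\ U^{(k)}_2 \end{bmatrix}$ solve the initial value problem $$\begin{cases}\left(\Box I_{2\times 2}-\mathfrak{P}^{(k)}(x)\right)\overrightarrow{U}^{(k)}(t,x)=\delta(t,x)\begin{bmatrix}1\\1\end{bmatrix}, & (t,x)\in\mathbb{R}\times\mathbb{R}^3,\\ \overrightarrow{U}^{(k)}(t,x)=\overrightarrow{0}, & (t,x)\in(-\infty,0)\times\mathbb{R}^3.\end{cases}$$ Suppose that $\beta^{(1)}_{ij}(x)\ge\beta^{(2)}_{ij}(x)$ for every $x\in\mathbb{R}^3$ and all $1\le i,j\le 2$, and that $$\overrightarrow{U}^{(1)}(t,0)=\overrightarrow{U}^{(2)}(t,0)\quad\text{for each } t\in(0,T].$$ Then $\mathfrak{P}^{(1)}(x)=\mathfrak{P}^{(2)}(x)$ for every $x\in\mathbb{R}^3$ with $|x|\le \frac{T}{2}$.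
   Context: Here $\Box=\partial_t^2-\Delta_x$ is the wave operator on $\mathbb{R}\times\mathbb{R}^3$, $I_{2\times2}$ is the identity matrix, and $\delta(t,x)$ is the Dirac delta distribution on $\mathbb{R}\times\mathbb{R}^3$ concentrated at $(t,x)=(0,0)$. The initial value problem is understood in the sense of distributions. Its unique solution has the form $$\overrightarrow{U}^{(k)}(t,x)=\frac{\delta(t-|x|)}{4\pi|x|}\begin{bmatrix}1\\1\end{bmatrix}+\mathscr{H}(t-|x|)\,\overrightarrow{R}^{(k)}(t,x),$$ where $\mathscr{H}$ is the Heaviside function and $\overrightarrow{R}^{(k)}$ is a $C^1$ solution in the region $t>|x|$ (up to the cone $t=|x|$) of $(\Box I_{2\times2}-\mathfrak{P}^{(k)})\overrightarrow{R}^{(k)}=\overrightarrow{0}$ with $\overrightarrow{R}^{(k)}(|x|,x)=\frac{1}{8\pi}\int_0^1\mathfrak{P}^{(k)}(sx)\begin{bmatrix}1\\1\end{bmatrix}ds$. For $t>0$ the value $\overrightarrow{U}^{(k)}(t,0)$ at the spatial origin is understood as $\overrightarrow{R}^{(k)}(t,0)$. *)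

theory Defs
  imports "HOL-Analysis.Analysis"
begin

section \<open>Smooth functions and distributions\<close>

definition dir_deriv ::
  "'a::real_normed_vector \<Rightarrow> ('a \<Rightarrow> 'b::real_normed_vector) \<Rightarrow> 'a \<Rightarrow> 'b" where
  "dir_deriv v f x = frechet_derivative f (at x) v"

text \<open>Class C^k on the whole space, through iterated directional derivatives; in finite
  dimension this is the usual notion.\<close>

primrec Ck :: "nat \<Rightarrow> ('a::euclidean_space \<Rightarrow> 'b::real_normed_vector) \<Rightarrow> bool" where
  "Ck 0 f \<longleftrightarrow> continuous_on UNIV f"
| "Ck (Suc k) f \<longleftrightarrow> (\<forall>x. f differentiable (at x)) \<and> (\<forall>v. Ck k (dir_deriv v f))"

definition smooth_fun :: "('a::euclidean_space \<Rightarrow> 'b::real_normed_vector) \<Rightarrow> bool" where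
  "smooth_fun f \<longleftrightarrow> (\<forall>k. Ck k f)"

definition tsupp :: "('a::topological_space \<Rightarrow> real) \<Rightarrow> 'a set" where
  "tsupp \<phi> = closure {x. \<phi> x \<noteq> 0}"

definition test_function :: "('a::euclidean_space \<Rightarrow> real) \<Rightarrow> bool" where
  "test_function \<phi> \<longleftrightarrow> smooth_fun \<phi> \<and> compact (tsupp \<phi>)"

text \<open>A functional on functions; only its values at test functions are meaningful.\<close>

type_synonym 'a functional = "('a \<Rightarrow> real) \<Rightarrow> real"

text \<open>Continuity is expressed by the usual seminorm estimates on compact sets: the partial
  derivatives of order at most \<open>N\<close> are indexed by lists of basis vectors, so each of them may
  occur several times, which only affects the constant.\<close>

definition distribution :: "'a::euclidean_space functional \<Rightarrow> bool" where
  "distribution u \<longleftrightarrow>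
     (\<forall>\<phi> \<psi>. test_function \<phi> \<longrightarrow> test_function \<psi> \<longrightarrow> u (\<lambda>x. \<phi> x + \<psi> x) = u \<phi> + u \<psi>) \<and>
     (\<forall>c \<phi>. test_function \<phi> \<longrightarrow> u (\<lambda>x. c * \<phi> x) = c * u \<phi>) \<and>
     (\<forall>K. compact K \<longrightarrow> (\<exists>C N. \<forall>\<phi>. test_function \<phi> \<longrightarrow> tsupp \<phi> \<subseteq> K \<longrightarrow>
        \<bar>u \<phi>\<bar> \<le> C * (\<Sum>vs | set vs \<subseteq> Basis \<and> length vs \<le> N.
                     (SUP x. \<bar>foldr dir_deriv vs \<phi> x\<bar>))))"

definition dist_eq_on ::
  "'a::euclidean_space set \<Rightarrow> 'a functional \<Rightarrow> 'a functional \<Rightarrow> bool" where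
  "dist_eq_on S u v \<longleftrightarrow> (\<forall>\<phi>. test_function \<phi> \<longrightarrow> tsupp \<phi> \<subseteq> S \<longrightarrow> u \<phi> = v \<phi>)"

definition dist_deriv :: "'a::euclidean_space \<Rightarrow> 'a functional \<Rightarrow> 'a functional" where
  "dist_deriv v u = (\<lambda>\<phi>. - u (dir_deriv v \<phi>))"

definition dist_mult :: "('a \<Rightarrow> real) \<Rightarrow> 'a functional \<Rightarrow> 'a functional" where
  "dist_mult g u = (\<lambda>\<phi>. u (\<lambda>x. g x * \<phi> x))"

definition fun_dist :: "('a::euclidean_space \<Rightarrow> real) \<Rightarrow> 'a functional" where
  "fun_dist f = (\<lambda>\<phi>. LINT x|lborel. f x * \<phi> x)"

definition dirac :: "'a::real_vector functional" where
  "dirac = (\<lambda>\<phi>. \<phi> 0)"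

section \<open>The wave system on space-time\<close>

type_synonym spacetime = "real \<times> (real^3)"

definition dist_box :: "spacetime functional \<Rightarrow> spacetime functional" where
  "dist_box u = (\<lambda>\<phi>. dist_deriv (1, 0) (dist_deriv (1, 0) u) \<phi>
      - (\<Sum>i\<in>UNIV. dist_deriv (0, axis i 1) (dist_deriv (0, axis i 1) u) \<phi>))"

text \<open>The operator \<open>\<box> I - P(x)\<close> acting on vectors of distributions.\<close>

definition wave_system_op ::
  "(real^3 \<Rightarrow> real^2^2) \<Rightarrow> (spacetime functional)^2 \<Rightarrow> (spacetime functional)^2" where
  "wave_system_op P U = (\<chi> i. (\<lambda>\<phi>. dist_box (U $ i) \<phi>
      - (\<Sum>j\<in>UNIV. dist_mult (\<lambda>p. P (snd p) $ i $ j) (U $ j) \<phi>)))"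

definition solves_point_source_ivp ::
  "(real^3 \<Rightarrow> real^2^2) \<Rightarrow> (spacetime functional)^2 \<Rightarrow> bool" where
  "solves_point_source_ivp P U \<longleftrightarrow>
     (\<forall>i. distribution (U $ i)) \<and>
     (\<forall>i. dist_eq_on UNIV (wave_system_op P U $ i) dirac) \<and>
     (\<forall>i. dist_eq_on ({..<0} \<times> UNIV) (U $ i) (\<lambda>\<phi>. 0))"

section \<open>The regular part of the solution\<close>

definition heaviside :: "real \<Rightarrow> real" where
  "heaviside s = (if s > 0 then 1 else 0)"

text \<open>The distribution \<open>\<delta>(t - |x|) / (4 \<pi> |x|)\<close>. The integrand is \<open>0\<close> at \<open>x = 0\<close> by the
  convention for division by zero, which does not affect the integral.\<close>

definition spherical_wave :: "spacetime functional" where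
  "spherical_wave = (\<lambda>\<phi>. LINT x|lborel. \<phi> (norm x, x) / (4 * pi * norm x))"

definition light_cone_interior :: "spacetime set" where
  "light_cone_interior = {(t, x). t > norm x}"

definition closed_light_cone :: "spacetime set" where
  "closed_light_cone = {(t, x). t \<ge> norm x}"

text \<open>Since the closed cone is convex with nonempty interior, derivatives within it are unique,
  also at its boundary points.\<close>

definition C1_up_to_cone :: "(spacetime \<Rightarrow> real^2) \<Rightarrow> bool" where
  "C1_up_to_cone R \<longleftrightarrow>
     (\<exists>R' :: spacetime \<Rightarrow> spacetime \<Rightarrow>\<^sub>L (real^2). continuous_on closed_light_cone R' \<and>
        (\<forall>p\<in>closed_light_cone.
           (R has_derivative blinfun_apply (R' p)) (at p within closed_light_cone)))"

text \<open>\<open>R\<close> is the regular part of the solution \<open>U\<close>. Only the values of \<open>R\<close> on the closed cone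
  matter, and these are determined by \<open>U\<close>. As \<open>R\<close> is only of class C^1, its equation in the
  region \<open>t > |x|\<close> is meant in the sense of distributions there. For \<open>t > 0\<close>, the value of
  \<open>U\<close> at \<open>(t, 0)\<close> is \<open>R (t, 0)\<close>.\<close>

definition is_regular_part ::
  "(real^3 \<Rightarrow> real^2^2) \<Rightarrow> (spacetime functional)^2 \<Rightarrow> (spacetime \<Rightarrow> real^2) \<Rightarrow> bool" where
  "is_regular_part P U R \<longleftrightarrow>
     C1_up_to_cone R \<and>
     (\<forall>i. dist_eq_on UNIV (U $ i)
        (\<lambda>\<phi>. spherical_wave \<phi> + fun_dist (\<lambda>(t, x). heaviside (t - norm x) * R (t, x) $ i) \<phi>)) \<and>
     (\<forall>i. dist_eq_on light_cone_interior
        (wave_system_op P (\<chi> j. fun_dist (\<lambda>p. R p $ j)) $ i) (\<lambda>\<phi>. 0)) \<and>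
     (\<forall>x. R (norm x, x) =
        (1 / (8 * pi)) *\<^sub>R integral {0..1} (\<lambda>s. P (s *\<^sub>R x) *v vector [1, 1]))"

end

theory Submission
  imports Defs
begin

text \<open>
  Put \<open>w = R1 - R2\<close> and \<open>Q = P1 - P2\<close>. In the difference of the two problems the singular
  spherical waves cancel, so \<open>w\<close> restricted to the light cone satisfies, against every test
  function, \<open>\<box> w = P1 w + Q R2\<close> plus the surface source \<open>Q (1,1)\<close> on the cone \<open>t = |x|\<close>.
  Testing with regularised incoming spherical waves \<open>a (t + s) / s\<close>, where
  \<open>s = sqrt (\<delta>\<^sup>2 + |x - z|\<^sup>2)\<close> and \<open>\<delta> \<rightarrow> 0\<close>, replaces Kirchhoff's formula, and no solution of the
  adjoint problem is needed.

  Take the decreasing weight \<open>b u = exp (- n / (T - u))\<close>. Centring the test functions on the axis,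
  where \<open>w = 0\<close>, bounds \<open>\<integral> |Q| b (2|x|) / |x|\<^sup>2\<close> by \<open>\<integral> (|w| + |Q|) b (t + |x|) / |x|\<close> over the
  cone. Centring them at arbitrary points and integrating bounds the weighted integral of \<open>|w|\<close> by a
  small multiple of itself and of \<open>\<integral> |Q| b (2|x|) / |x|\<close>, the small factor tending to \<open>0\<close> as \<open>n\<close>
  grows. For large \<open>n\<close> everything is absorbed, so \<open>\<integral> |Q| b (2|x|) / |x|\<^sup>2 = 0\<close>; the sign of \<open>Q\<close> is
  what turns the surface term, which only sees the row sums of \<open>Q\<close>, into a norm.
\<close>

section \<open>Smooth functions\<close>

text \<open>The radius T/2 comes from the phase: an incoming wave centred on the axis depends on t +
  |x|, which equals 2|x| on the cone, so data on (0, T] reach exactly |x| < T/2. The axis estimate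
  cannot stand alone. It bounds Q by w off the axis, where the data say nothing, so w must in turn
  be bounded by Q. Averaging over all centres z produces the kernel 1/(|z| |x - z|) with the weight
  taken at t + |x - z| + |z|; the decay of the weight beats this kernel except where |z| + |x - z| =
  |x|, the segment from 0 to x, which is a null set. The analytic obstacle is that w, extended by
  zero, is merely bounded at bounded times, continuous inside the cone, and may jump across it.
  Hence the centre of the wave is smoothed and the limit is taken by dominated convergence in
  variables rescaled around the centre. Time scale and space scale are kept independent: on the axis
  the profile stays fixed, whereas recovering w at a point requires concentration in time as
  well.\<close>

lemma dir_deriv_eqI: "(f has_derivative f') (at x) \<Longrightarrow> dir_deriv v f x = f' v"
  using frechet_derivative_at by (metis dir_deriv_def)

lemma dir_deriv_has_derivative:
  "f differentiable (at x) \<Longrightarrow> (f has_derivative (\<lambda>v. dir_deriv v f x)) (at x)"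
  unfolding dir_deriv_def using frechet_derivative_works by (metis (no_types, lifting) ext)

lemma Ck_Suc_imp_Ck: "Ck (Suc k) f \<Longrightarrow> Ck k f"
proof (induction k arbitrary: f)
  case 0
  then show ?case
    by (auto simp: continuous_on_eq_continuous_at differentiable_imp_continuous_within)
next
  case (Suc k)
  then show ?case by (metis Ck.simps(2))
qed

lemma Ck_const: "Ck k (\<lambda>x. c)"
proof (induction k arbitrary: c)
  case (Suc k)
  have "dir_deriv v (\<lambda>x. c) = (\<lambda>x::'a. 0)" for v
    by (rule ext) (rule dir_deriv_eqI[OF has_derivative_const])
  then show ?case using Suc[of 0] by simp
qed simp

lemma Ck_bounded_linear:
  assumes "bounded_linear f"
  shows "Ck k f"
proof (cases k)
  case 0
  then show ?thesis using assms by (simp add: linear_continuous_on)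
next
  case (Suc m)
  have "dir_deriv v f = (\<lambda>x. f v)" for v
    by (rule ext) (rule dir_deriv_eqI[OF bounded_linear_imp_has_derivative[OF assms]])
  moreover have "f differentiable (at x)" for x
    using assms by (rule bounded_linear_imp_differentiable)
  ultimately show ?thesis using Suc by (simp add: Ck_const)
qed

lemma Ck_add:
  assumes "Ck k f" "Ck k g"
  shows "Ck k (\<lambda>x. f x + g x)"
  using assms
proof (induction k arbitrary: f g)
  case (Suc k)
  have "dir_deriv v (\<lambda>x. f x + g x) = (\<lambda>x. dir_deriv v f x + dir_deriv v g x)" for v
    using Suc.prems
    by (intro ext dir_deriv_eqI derivative_intros dir_deriv_has_derivative) auto
  then show ?case using Suc by auto
qed (auto intro: continuous_intros)

lemma Ck_mult:
  fixes f g :: "'a::euclidean_space \<Rightarrow> real"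
  assumes "Ck k f" "Ck k g"
  shows "Ck k (\<lambda>x. f x * g x)"
  using assms
proof (induction k arbitrary: f g)
  case (Suc k)
  have "dir_deriv v (\<lambda>x. f x * g x) = (\<lambda>x. f x * dir_deriv v g x + dir_deriv v f x * g x)" for v
    using Suc.prems
    by (intro ext dir_deriv_eqI has_derivative_mult dir_deriv_has_derivative) auto
  moreover have "Ck k (\<lambda>x. f x * dir_deriv v g x + dir_deriv v f x * g x)" for v
  proof (intro Ck_add Suc.IH)
    \<comment> \<open>The product rule keeps one factor undifferentiated, and its class has to be
      lowered from k + 1 to k.\<close>
    show "Ck k f" "Ck k g" using Suc.prems Ck_Suc_imp_Ck by blast+
    show "Ck k (dir_deriv v f)" "Ck k (dir_deriv v g)" using Suc.prems by simp_all
  qed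
  moreover have "(\<lambda>x. f x * g x) differentiable (at x)" for x
    using Suc.prems by simp
  ultimately show ?case by simp
qed (auto intro: continuous_intros)

text \<open>The tower \<open>D\<close> of successive derivatives and the free index \<open>j\<close>
  make the induction close: differentiating \<open>D j (S x)\<close> once moves to
  \<open>D (Suc j)\<close> and leaves a derivative of \<open>S\<close> as a factor. The set
  \<open>I\<close> admits outer functions that are smooth only on part of the line, such as powers
  on the positive axis.\<close>

lemma Ck_compose_derivs:
  fixes S :: "'a::euclidean_space \<Rightarrow> real" and D :: "nat \<Rightarrow> real \<Rightarrow> real"
  assumes D: "\<And>k x. x \<in> I \<Longrightarrow> (D k has_real_derivative D (Suc k) x) (at x)"
    and S: "\<And>x. S x \<in> I" and "Ck k S"
  shows "Ck k (\<lambda>x. D j (S x))"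
  using assms(3)
proof (induction k arbitrary: j)
  case 0
  have "isCont (D j) (S x)" for x using D S DERIV_isCont by blast
  moreover have "isCont S x" for x using 0 by (simp add: continuous_on_eq_continuous_at)
  ultimately have "isCont (\<lambda>x. D j (S x)) x" for x by (metis isCont_o2)
  then show ?case by (simp add: continuous_on_eq_continuous_at)
next
  case (Suc k)
  have d: "((\<lambda>x. D j (S x)) has_derivative (\<lambda>v. dir_deriv v S x * D (Suc j) (S x))) (at x)" for x
    using Suc.prems by (intro DERIV_compose_FDERIV D S dir_deriv_has_derivative) simp
  have "dir_deriv v (\<lambda>x. D j (S x)) = (\<lambda>x. dir_deriv v S x * D (Suc j) (S x))" for v
    by (rule ext) (rule dir_deriv_eqI[OF d])
  moreover have "Ck k (\<lambda>x. dir_deriv v S x * D (Suc j) (S x))" for v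
    using Suc.prems Suc.IH Ck_Suc_imp_Ck[OF Suc.prems] by (intro Ck_mult) simp_all
  moreover have "(\<lambda>x. D j (S x)) differentiable (at x)" for x
    using d differentiable_def by blast
  ultimately show ?case by simp
qed

lemma Ck_compose_linear:
  fixes L :: "'a::euclidean_space \<Rightarrow> 'b::euclidean_space"
  assumes "bounded_linear L" "Ck k f"
  shows "Ck k (\<lambda>x. f (L x))"
  using assms(2)
proof (induction k arbitrary: f)
  case 0
  then show ?case using assms(1)
    by (auto intro: continuous_on_compose2 linear_continuous_on)
next
  case (Suc k)
  have d: "((\<lambda>x. f (L x)) has_derivative (\<lambda>v. dir_deriv (L v) f (L x))) (at x)" for x
    using diff_chain_at[OF bounded_linear_imp_has_derivative[OF assms(1)]
        dir_deriv_has_derivative[of f "L x"]] Suc.prems by (simp add: o_def)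
  have "dir_deriv v (\<lambda>x. f (L x)) = (\<lambda>x. dir_deriv (L v) f (L x))" for v
    by (rule ext) (rule dir_deriv_eqI[OF d])
  moreover have "(\<lambda>x. f (L x)) differentiable (at x)" for x
    using d differentiable_def by blast
  ultimately show ?case using Suc by simp
qed

lemma smooth_fun_const: "smooth_fun (\<lambda>x. c)"
  by (simp add: smooth_fun_def Ck_const)

lemma smooth_fun_bounded_linear: "bounded_linear f \<Longrightarrow> smooth_fun f"
  by (simp add: smooth_fun_def Ck_bounded_linear)

lemma smooth_fun_add: "smooth_fun f \<Longrightarrow> smooth_fun g \<Longrightarrow> smooth_fun (\<lambda>x. f x + g x)"
  by (simp add: smooth_fun_def Ck_add)

lemma smooth_fun_mult:
  fixes f g :: "'a::euclidean_space \<Rightarrow> real"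
  shows "smooth_fun f \<Longrightarrow> smooth_fun g \<Longrightarrow> smooth_fun (\<lambda>x. f x * g x)"
  by (simp add: smooth_fun_def Ck_mult)

lemma smooth_fun_compose_linear:
  fixes L :: "'a::euclidean_space \<Rightarrow> 'b::euclidean_space"
  shows "bounded_linear L \<Longrightarrow> smooth_fun f \<Longrightarrow> smooth_fun (\<lambda>x. f (L x))"
  by (simp add: smooth_fun_def Ck_compose_linear)

lemma smooth_fun_dir_deriv: "smooth_fun f \<Longrightarrow> smooth_fun (dir_deriv v f)"
  unfolding smooth_fun_def by (metis Ck.simps(2))

lemma smooth_fun_differentiable: "smooth_fun f \<Longrightarrow> f differentiable (at x)"
  unfolding smooth_fun_def by (metis Ck.simps(2))

lemma smooth_fun_continuous: "smooth_fun f \<Longrightarrow> continuous_on S f"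
  unfolding smooth_fun_def by (metis Ck.simps(1) continuous_on_subset top_greatest)

lemma smooth_fun_real_deriv:
  fixes a :: "real \<Rightarrow> real"
  assumes "smooth_fun a"
  shows "(a has_real_derivative deriv a x) (at x)"
  using smooth_fun_differentiable[OF assms] by (simp add: DERIV_deriv_iff_real_differentiable)

lemma smooth_fun_deriv:
  fixes a :: "real \<Rightarrow> real"
  assumes "smooth_fun a"
  shows "smooth_fun (deriv a)"
proof -
  have "dir_deriv 1 a x = deriv a x" for x
    using dir_deriv_eqI[OF smooth_fun_real_deriv[OF assms, unfolded has_field_derivative_def]]
    by simp
  then have "dir_deriv 1 a = deriv a" by blast
  then show ?thesis using smooth_fun_dir_deriv[OF assms, of 1] by simp
qed

lemma smooth_fun_compose:
  fixes a :: "real \<Rightarrow> real" and S :: "'a::euclidean_space \<Rightarrow> real"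
  assumes "smooth_fun a" "smooth_fun S"
  shows "smooth_fun (\<lambda>x. a (S x))"
proof -
  have sm: "smooth_fun ((deriv ^^ k) a)" for k
    by (induction k) (use assms smooth_fun_deriv in auto)
  have "((deriv ^^ k) a has_real_derivative (deriv ^^ Suc k) a x) (at x)" for k x
    using smooth_fun_real_deriv[OF sm] by simp
  from Ck_compose_derivs[of UNIV "\<lambda>k. (deriv ^^ k) a" S _ 0, OF this]
  show ?thesis using assms(2) by (simp add: smooth_fun_def)
qed

lemma smooth_fun_powr:
  fixes S :: "'a::euclidean_space \<Rightarrow> real"
  assumes "smooth_fun S" "\<And>x. S x > 0"
  shows "smooth_fun (\<lambda>x. S x powr c)"
proof -
  \<comment> \<open>The k-th derivative of a power: a falling factorial times the shifted
    power.\<close>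
  define D where "D k x = (\<Prod>i<k. c - real i) * x powr (c - real k)" for k x
  have "(D k has_real_derivative D (Suc k) x) (at x)" if "x \<in> {0<..}" for k x
    using that unfolding D_def
    by (auto intro!: derivative_eq_intros simp: algebra_simps)
  from Ck_compose_derivs[of "{0<..}" D S _ 0, OF this] show ?thesis
    using assms by (simp add: smooth_fun_def D_def)
qed

lemma smooth_fun_inner_self: "smooth_fun (\<lambda>x::'a::euclidean_space. x \<bullet> x)"
proof -
  have sm: "smooth_fun (\<lambda>x::'a. x \<bullet> b)" for b
    by (rule smooth_fun_bounded_linear) (rule bounded_linear_inner_left)
  have "smooth_fun (\<lambda>x::'a. \<Sum>b\<in>B. (x \<bullet> b) * (x \<bullet> b))" if "finite B" for B
    using that by induction (auto intro!: smooth_fun_const smooth_fun_add smooth_fun_mult sm)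
  then show ?thesis by (subst euclidean_inner) auto
qed

text \<open>This class is closed under differentiation, because the derivative of p(1/z) exp(-1/z)
  is z^-2 (p - p')(1/z) exp(-1/z). Smoothness of exp(-1/z) across 0 thus reduces to one first
  derivative, computed for the whole class.\<close>

definition exp_inv_poly :: "real poly \<Rightarrow> real \<Rightarrow> real" where
  "exp_inv_poly p z = (if z > 0 then poly p (1 / z) * exp (- (1 / z)) else 0)"

lemma exp_inv_poly_tendsto_0: "(exp_inv_poly p \<longlongrightarrow> 0) (at 0)"
proof (subst filterlim_at_split, intro conjI)
  have "eventually (\<lambda>z. exp_inv_poly p z = 0) (at_left 0)"
    by (simp add: exp_inv_poly_def eventually_at_left_field) (metis lt_ex not_less_iff_gr_or_eq)
  then show "(exp_inv_poly p \<longlongrightarrow> 0) (at_left 0)"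
    by (rule tendsto_eventually)
  have "((\<lambda>u. \<Sum>i\<le>degree p. coeff p i * (u ^ i / exp u)) \<longlongrightarrow> (\<Sum>i\<le>degree p. coeff p i * 0)) at_top"
    by (intro tendsto_intros tendsto_power_div_exp_0)
  then have "((\<lambda>u. poly p u * exp (- u)) \<longlongrightarrow> 0) at_top"
    by (simp add: poly_altdef sum_distrib_right exp_minus divide_inverse mult.assoc)
  from filterlim_compose[OF this filterlim_inverse_at_top_right]
  have "((\<lambda>z. poly p (1 / z) * exp (- (1 / z))) \<longlongrightarrow> 0) (at_right 0)"
    by (simp add: inverse_eq_divide)
  moreover have "eventually (\<lambda>z. poly p (1 / z) * exp (- (1 / z)) = exp_inv_poly p z) (at_right 0)"
    by (simp add: exp_inv_poly_def eventually_at_right_field) (metis gt_ex)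
  ultimately show "(exp_inv_poly p \<longlongrightarrow> 0) (at_right 0)"
    by (rule Lim_transform_eventually)
qed

lemma exp_inv_poly_deriv:
  "(exp_inv_poly p has_real_derivative exp_inv_poly (monom 1 2 * (p - pderiv p)) z) (at z)"
proof -
  consider "z > 0" | "z < 0" | "z = 0" by linarith
  then show ?thesis
  proof cases
    case 1
    have "((\<lambda>z. poly p (1 / z) * exp (- (1 / z))) has_real_derivative
        exp_inv_poly (monom 1 2 * (p - pderiv p)) z) (at z)"
      using 1
      by (auto intro!: derivative_eq_intros DERIV_chain'[OF _ poly_DERIV]
          simp: exp_inv_poly_def poly_monom field_simps power2_eq_square)
    moreover have "open {0::real<..}" by simp
    ultimately show ?thesis
      by (rule has_field_derivative_transform_within_open) (use 1 in \<open>auto simp: exp_inv_poly_def\<close>)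
  next
    case 2
    have "((\<lambda>z. 0) has_real_derivative exp_inv_poly (monom 1 2 * (p - pderiv p)) z) (at z)"
      using 2 by (simp add: exp_inv_poly_def)
    moreover have "open {..<0::real}" by simp
    ultimately show ?thesis
      by (rule has_field_derivative_transform_within_open) (use 2 in \<open>auto simp: exp_inv_poly_def\<close>)
  next
    case 3
    \<comment> \<open>Dividing by h multiplies the polynomial by its variable, so the difference
      quotient at 0 stays in the class, whose limit at 0 is known.\<close>
    have "(\<lambda>h. exp_inv_poly p h / h) = exp_inv_poly (monom 1 1 * p)"
      by (auto simp: exp_inv_poly_def poly_monom)
    then have "((\<lambda>h. exp_inv_poly p h / h) \<longlongrightarrow> 0) (at 0)"
      using exp_inv_poly_tendsto_0 by simp
    then show ?thesis using 3 by (simp add: DERIV_def exp_inv_poly_def)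
  qed
qed

lemma smooth_exp_inv_poly: "smooth_fun (exp_inv_poly p)"
proof -
  have "Ck k (exp_inv_poly p)" for k
  proof (induction k arbitrary: p)
    case 0
    show ?case
      using DERIV_isCont[OF exp_inv_poly_deriv] by (simp add: continuous_on_eq_continuous_at)
  next
    case (Suc k)
    let ?q = "monom 1 2 * (p - pderiv p)"
    have d: "(exp_inv_poly p has_derivative (*) (exp_inv_poly ?q z)) (at z)" for z
      using exp_inv_poly_deriv by (simp add: has_field_derivative_def)
    have "dir_deriv v (exp_inv_poly p) = (\<lambda>z. exp_inv_poly ?q z * v)" for v
      by (rule ext) (rule dir_deriv_eqI[OF d])
    moreover have "exp_inv_poly p differentiable (at z)" for z
      using d differentiable_def by blast
    ultimately show ?case using Suc by (simp add: Ck_mult Ck_const)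
  qed
  then show ?thesis by (simp add: smooth_fun_def)
qed

section \<open>Cut-off functions built from exp(-1/z)\<close>

definition bump0 :: "real \<Rightarrow> real" where
  "bump0 z = (if z > 0 then exp (- (1 / z)) else 0)"

lemma smooth_bump0: "smooth_fun bump0"
proof -
  have "bump0 = exp_inv_poly 1" by (auto simp: bump0_def exp_inv_poly_def)
  then show ?thesis by (metis smooth_exp_inv_poly)
qed

lemma bump0_simps:
  "z \<le> 0 \<Longrightarrow> bump0 z = 0" "z > 0 \<Longrightarrow> bump0 z > 0" "bump0 z \<ge> 0" "bump0 z \<le> 1"
  by (auto simp: bump0_def)

lemma bump0_mono: "x \<le> y \<Longrightarrow> bump0 x \<le> bump0 y"
  by (auto simp: bump0_def frac_le)

lemma smooth_fun_affine: "smooth_fun (\<lambda>x::real. c * x + d)"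
  by (intro smooth_fun_add smooth_fun_const smooth_fun_bounded_linear bounded_linear_mult_right)

text \<open>The arguments of the two bumps add up to 1, so one of them is positive and the
  denominator never vanishes. The power -1 stands for division so that
  \<open>smooth_fun_powr\<close> applies.\<close>

definition smooth_step :: "real \<Rightarrow> real" where
  "smooth_step t = bump0 (t + 1) * (bump0 (t + 1) + bump0 (- t)) powr (-1)"

lemma smooth_step_smooth: "smooth_fun smooth_step"
proof -
  have 1: "smooth_fun (\<lambda>t. bump0 (t + 1))" "smooth_fun (\<lambda>t. bump0 (- t))"
    using smooth_fun_compose[OF smooth_bump0 smooth_fun_affine[of 1 1]]
      smooth_fun_compose[OF smooth_bump0 smooth_fun_affine[of "-1" 0]] by simp_all
  have "bump0 (t + 1) + bump0 (- t) > 0" for t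
    using bump0_simps(2)[of "t + 1"] bump0_simps(2)[of "- t"] bump0_simps(3)[of "t + 1"]
      bump0_simps(3)[of "- t"] by (cases "t > -1") auto
  then show ?thesis
    unfolding smooth_step_def[abs_def]
    by (intro smooth_fun_mult smooth_fun_powr smooth_fun_add 1)
qed

lemma smooth_step_eq_1: "t \<ge> 0 \<Longrightarrow> smooth_step t = 1"
  using bump0_simps(2)[of "t + 1"] by (simp add: smooth_step_def bump0_simps(1) powr_minus)

lemma smooth_step_eq_0: "t \<le> -1 \<Longrightarrow> smooth_step t = 0"
  by (simp add: smooth_step_def bump0_simps)

section \<open>Locally integrable singularities\<close>

lemma borel_measurable_norm_self [measurable]:
  "norm \<in> borel_measurable (borel :: 'a::real_normed_vector measure)"
  by (intro borel_measurable_continuous_onI continuous_intros)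

lemma borel_cball [measurable]: "cball c r \<in> sets borel"
  by simp

text \<open>A covering by balls stands in for polar coordinates: f is dominated by the sum of the
  indicators of the balls with coefficients \<open>c k\<close>, and the volume of a ball in
  dimension 3 scales as r^3.\<close>

lemma nn_integral_cball_cover:
  fixes f :: "real^3 \<Rightarrow> ennreal"
  assumes f: "\<And>x. f x = 0 \<or> (\<exists>k. norm x \<le> r k \<and> f x \<le> ennreal (c k))"
    and c: "\<And>k. c k \<ge> 0" and r: "\<And>k. r k \<ge> 0" and sm: "summable (\<lambda>k. c k * r k ^ 3)"
  shows "(\<integral>\<^sup>+x. f x \<partial>lborel) < \<infinity>"
proof -
  define V where "V = unit_ball_vol (real DIM(real^3))"
  have V: "V \<ge> 0" by (simp add: V_def)
  let ?g = "\<lambda>k x. ennreal (c k) * indicator (cball 0 (r k)) (x::real^3)"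
  have "f x \<le> (\<Sum>k. ?g k x)" for x
  proof (cases "f x = 0")
    case False
    then obtain k where k: "norm x \<le> r k" "f x \<le> ennreal (c k)" using f by blast
    then have "f x \<le> (\<Sum>i\<in>{k}. ?g i x)" by (simp add: indicator_def)
    also have "\<dots> \<le> (\<Sum>k. ?g k x)" by (intro sum_le_suminf) auto
    finally show ?thesis .
  qed simp
  then have "(\<integral>\<^sup>+x. f x \<partial>lborel) \<le> (\<integral>\<^sup>+x. (\<Sum>k. ?g k x) \<partial>lborel)"
    by (intro nn_integral_mono)
  also have "\<dots> = (\<Sum>k. \<integral>\<^sup>+x. ?g k x \<partial>lborel)"
    by (intro nn_integral_suminf borel_measurable_times_ennreal borel_measurable_indicator) auto
  also have "\<dots> = (\<Sum>k. ennreal (c k * r k ^ 3 * V))"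
  proof (intro arg_cong[where f=suminf] ext)
    fix k
    have "(\<integral>\<^sup>+x. ?g k x \<partial>lborel) = ennreal (c k) * emeasure lborel (cball (0::real^3) (r k))"
      by (rule nn_integral_cmult_indicator) simp
    also have "emeasure lborel (cball (0::real^3) (r k)) = ennreal (V * r k ^ 3)"
      using emeasure_cball[OF r, of "0::real^3" k] by (simp add: V_def)
    finally show "(\<integral>\<^sup>+x. ?g k x \<partial>lborel) = ennreal (c k * r k ^ 3 * V)"
      using c r V by (simp add: ennreal_mult'[symmetric] mult_ac)
  qed
  also have "\<dots> < \<infinity>"
    using c r V summable_mult2[OF sm, of V]
    by (subst suminf_ennreal2) auto
  finally show ?thesis .
qed

lemma nn_integral_inverse_square_ball:
  assumes "\<rho> > 0"
  shows "(\<integral>\<^sup>+x. ennreal (indicator (cball 0 \<rho>) (x::real^3) / (norm x)\<^sup>2) \<partial>lborel) < \<infinity>"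
proof (rule nn_integral_cball_cover[where r="\<lambda>k. \<rho> * (1/2)^k" and c="\<lambda>k. 4 * 4^k / \<rho>\<^sup>2"])
  fix x :: "real^3"
  show "ennreal (indicator (cball 0 \<rho>) x / (norm x)\<^sup>2) = 0 \<or>
    (\<exists>k. norm x \<le> \<rho> * (1/2)^k \<and>
       ennreal (indicator (cball 0 \<rho>) x / (norm x)\<^sup>2) \<le> ennreal (4 * 4^k / \<rho>\<^sup>2))"
  proof (cases "x = 0 \<or> norm x > \<rho>")
    case False
    then have x: "norm x > 0" "norm x \<le> \<rho>" by auto
    \<comment> \<open>The index of the dyadic shell \<rho> / 2^(k+1) < |x| \<le> \<rho> / 2^k. The
      factor 4 in the constant pays for the inner edge of the shell, and the contributions form a
      geometric series of ratio 1/2.\<close>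
    define k where "k = (LEAST k. \<rho> * (1/2)^Suc k < norm x)"
    obtain m where "(1/2::real)^m < norm x / \<rho>"
      using real_arch_pow_inv[of "norm x / \<rho>" "1/2"] x assms by auto
    then have "\<rho> * (1/2)^m < norm x" using assms by (simp add: field_simps)
    moreover have "\<rho> * (1/2)^Suc m \<le> \<rho> * (1/2)^m" using assms by simp
    ultimately have "\<rho> * (1/2)^Suc m < norm x" by linarith
    then have k: "\<rho> * (1/2)^Suc k < norm x" unfolding k_def by (rule LeastI)
    have k': "norm x \<le> \<rho> * (1/2)^k"
    proof (cases k)
      case (Suc j)
      then show ?thesis using not_less_Least[of j "\<lambda>k. \<rho> * (1/2)^Suc k < norm x"] k_def by auto
    qed (use x in simp)
    have "(\<rho> * (1/2)^Suc k)\<^sup>2 \<le> (norm x)\<^sup>2"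
      using k assms by (intro power_mono) auto
    moreover have "((1/2::real)^Suc k)\<^sup>2 = 1 / (4 * 4^k)"
      by (simp add: power_mult_distrib power_divide power_mult[symmetric] power2_eq_square
          flip: power_mult_distrib)
    ultimately have "\<rho>\<^sup>2 \<le> (norm x)\<^sup>2 * (4 * 4^k)"
      by (simp add: power_mult_distrib field_simps)
    then have "1 / (norm x)\<^sup>2 \<le> 4 * 4^k / \<rho>\<^sup>2"
      using x assms by (simp add: field_simps)
    then show ?thesis using k' x by (intro disjI2 exI[of _ k]) (auto intro: ennreal_leI)
  qed auto
next
  have "(\<lambda>k. 4 * 4^k / \<rho>\<^sup>2 * (\<rho> * (1/2)^k)^3) = (\<lambda>k. (4 * \<rho>) * (1/2)^k)"
  proof
    fix k
    have "(1/2::real)^k * (1/2)^k * 4^k = 1"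
      by (simp flip: power_mult_distrib)
    then have "4^k * ((1/2::real)^k)^3 = (1/2)^k"
      by (simp add: power3_eq_cube mult_ac)
    moreover have "\<rho> ^ 3 / \<rho>\<^sup>2 = \<rho>" using assms by (simp add: power3_eq_cube power2_eq_square)
    ultimately show "4 * 4^k / \<rho>\<^sup>2 * (\<rho> * (1/2)^k)^3 = (4 * \<rho>) * (1/2)^k"
      by (simp add: power_mult_distrib mult_ac) (metis mult.assoc mult.commute times_divide_eq_right)
  qed
  then show "summable (\<lambda>k. 4 * 4^k / \<rho>\<^sup>2 * (\<rho> * (1/2)^k)^3)"
    by (simp add: summable_mult summable_geometric del: times_divide_eq_left)
qed (use assms in auto)

text \<open>The shells now go outwards: decay 16^-k against volume 8^k again leaves ratio 1/2. The
  integrand is the power -4 of \<open>unit_rdist\<close>, which later dominates the rescaled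
  kernels.\<close>

lemma nn_integral_inverse_square_1_norm:
  "(\<integral>\<^sup>+y. ennreal (1 / (1 + (norm (y::real^3))\<^sup>2)\<^sup>2) \<partial>lborel) < \<infinity>"
proof (rule nn_integral_cball_cover[where r="\<lambda>k. 2^k" and c="\<lambda>k. 16 * (1/16)^k"])
  fix x :: "real^3"
  obtain m where "norm x < 2^m" using real_arch_pow[of 2 "norm x"] by auto
  then have ex: "norm x \<le> 2^m" by simp
  define k where "k = (LEAST k. norm x \<le> 2^k)"
  have k: "norm x \<le> 2^k" unfolding k_def using ex by (rule LeastI)
  have "1 / (1 + (norm x)\<^sup>2)\<^sup>2 \<le> 16 * (1/16)^k"
  proof (cases k)
    case 0
    have "1 ^ 2 \<le> (1 + (norm x)\<^sup>2)\<^sup>2" by (intro power_mono) auto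
    then have "1 / (1 + (norm x)\<^sup>2)\<^sup>2 \<le> 1" by (simp add: divide_le_eq_1)
    then show ?thesis using 0 by simp
  next
    case (Suc j)
    then have "2^j < norm x" using not_less_Least[of j "\<lambda>k. norm x \<le> 2^k"] k_def by auto
    then have "(2^j)^4 \<le> norm x ^ 4" by (intro power_mono) auto
    also have "norm x ^ 4 = ((norm x)\<^sup>2)\<^sup>2" by simp
    also have "\<dots> \<le> (1 + (norm x)\<^sup>2)\<^sup>2" by (intro power_mono) auto
    finally have "(2^j)^4 \<le> (1 + (norm x)\<^sup>2)\<^sup>2" .
    moreover have "((2::real)^j)^4 = 16^j"
      by (simp add: power_mult[symmetric] mult.commute[of j]) (simp add: power_mult)
    moreover have "(1 + (norm x)\<^sup>2)\<^sup>2 > 0" by (intro zero_less_power add_pos_nonneg) auto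
    ultimately have "1 / (1 + (norm x)\<^sup>2)\<^sup>2 \<le> 1 / 16^j"
      by (simp add: divide_simps)
    then show ?thesis using Suc by (simp add: power_divide)
  qed
  then show "ennreal (1 / (1 + (norm x)\<^sup>2)\<^sup>2) = 0 \<or>
    (\<exists>k. norm x \<le> 2^k \<and> ennreal (1 / (1 + (norm x)\<^sup>2)\<^sup>2) \<le> ennreal (16 * (1/16)^k))"
    using k by (intro disjI2 exI[of _ k]) (auto intro: ennreal_leI)
next
  have "(\<lambda>k. 16 * (1/16)^k * (2^k)^3) = (\<lambda>k. 16 * (1/2::real)^k)"
  proof
    fix k
    have "((2::real)^k)^3 = 8^k" by (simp add: power_mult[symmetric] mult.commute[of k]) (simp add: power_mult)
    then show "16 * (1/16)^k * (2^k)^3 = 16 * (1/2::real)^k" by (simp flip: power_mult_distrib)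
  qed
  then show "summable (\<lambda>k. 16 * (1/16)^k * ((2::real)^k)^3)"
    by (simp add: summable_mult summable_geometric)
qed auto

section \<open>Test functions and the cone\<close>

lemma tsupp_subset: "(\<And>x. g x \<noteq> 0 \<Longrightarrow> f x \<noteq> 0) \<Longrightarrow> tsupp g \<subseteq> tsupp f"
  unfolding tsupp_def by (rule closure_mono) auto

lemma not_in_tsupp: "x \<notin> tsupp f \<Longrightarrow> f x = 0"
  unfolding tsupp_def using closure_subset[of "{x. f x \<noteq> 0}"] by blast

lemma compact_tsupp_subset:
  fixes f g :: "'a::euclidean_space \<Rightarrow> real"
  assumes "compact (tsupp f)" "tsupp g \<subseteq> tsupp f"
  shows "compact (tsupp g)"
  using assms compact_Int_closed[of "tsupp f" "tsupp g"]
  by (simp add: tsupp_def Int_absorb1 inf.absorb_iff2)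

lemma test_function_mult:
  assumes "smooth_fun g" "test_function \<phi>"
  shows "test_function (\<lambda>x. g x * \<phi> x)"
proof -
  have "tsupp (\<lambda>x. g x * \<phi> x) \<subseteq> tsupp \<phi>" by (rule tsupp_subset) simp
  then show ?thesis
    using assms compact_tsupp_subset smooth_fun_mult unfolding test_function_def by blast
qed

lemma tsupp_dir_deriv:
  fixes f :: "'a::euclidean_space \<Rightarrow> real"
  shows "tsupp (dir_deriv v f) \<subseteq> tsupp f"
proof -
  have "dir_deriv v f x = 0" if "x \<notin> tsupp f" for x
  proof -
    have "(f has_derivative (\<lambda>h. 0)) (at x)"
      by (rule has_derivative_transform_within_open[of "\<lambda>x. 0" _ _ UNIV "- tsupp f"])
        (use that not_in_tsupp in \<open>auto simp: tsupp_def intro: has_derivative_const\<close>)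
    then show ?thesis by (rule dir_deriv_eqI)
  qed
  then have "{x. dir_deriv v f x \<noteq> 0} \<subseteq> tsupp f" by blast
  then show ?thesis unfolding tsupp_def by (metis closed_closure closure_minimal)
qed

lemma test_function_dir_deriv:
  assumes "test_function \<phi>"
  shows "test_function (dir_deriv v \<phi>)"
  using assms compact_tsupp_subset[OF _ tsupp_dir_deriv] smooth_fun_dir_deriv
  unfolding test_function_def by blast

lemma closed_light_cone_eq: "closed_light_cone = {p. norm (snd p) \<le> fst p}"
  by (auto simp: closed_light_cone_def)

lemma light_cone_interior_eq: "light_cone_interior = {p. norm (snd p) < fst p}"
  by (auto simp: light_cone_interior_def)

lemma closed_closed_light_cone: "closed closed_light_cone"
  unfolding closed_light_cone_eq by (intro closed_Collect_le continuous_intros)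

lemma open_light_cone_interior: "open light_cone_interior"
  unfolding light_cone_interior_eq by (intro open_Collect_less continuous_intros)

lemma light_cone_interior_subset: "light_cone_interior \<subseteq> closed_light_cone"
  by (auto simp: light_cone_interior_eq closed_light_cone_eq)

lemma C1_up_to_cone_continuous:
  assumes "C1_up_to_cone R"
  shows "continuous_on closed_light_cone R"
proof -
  obtain R' where "\<And>p. p \<in> closed_light_cone \<Longrightarrow>
      (R has_derivative blinfun_apply (R' p)) (at p within closed_light_cone)"
    using assms by (auto simp: C1_up_to_cone_def)
  then show ?thesis by (rule has_derivative_continuous_on)
qed

text \<open>The regular part is controlled only on the closed cone. Its continuity up to the
  boundary bounds it on the compact part of the cone that meets the support, and the indicator
  extends the integrand by zero.\<close>

lemma integrable_cone:
  fixes g \<psi> :: "spacetime \<Rightarrow> real"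
  assumes g: "continuous_on closed_light_cone g" and "test_function \<psi>"
  shows "integrable lborel (\<lambda>p. indicator light_cone_interior p * g p * \<psi> p)"
proof -
  let ?K = "tsupp \<psi> \<inter> closed_light_cone"
  have "compact ?K"
    using assms closed_closed_light_cone by (auto simp: test_function_def intro: compact_Int_closed)
  moreover have "continuous_on ?K (\<lambda>p. g p * \<psi> p)"
    using assms by (intro continuous_on_mult) (auto simp: test_function_def
        intro: continuous_on_subset smooth_fun_continuous)
  ultimately have "integrable lborel (\<lambda>p. indicator ?K p *\<^sub>R (g p * \<psi> p))"
    by (rule borel_integrable_compact)
  then have "integrable lborel (\<lambda>p. indicator light_cone_interior p *\<^sub>R (indicator ?K p *\<^sub>R (g p * \<psi> p)))"
    by (rule integrable_mult_indicator[rotated]) (simp add: open_light_cone_interior borel_open)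
  moreover have "(\<lambda>p. indicator light_cone_interior p *\<^sub>R (indicator ?K p *\<^sub>R (g p * \<psi> p)))
      = (\<lambda>p. indicator light_cone_interior p * g p * \<psi> p)"
    using light_cone_interior_subset not_in_tsupp[of _ \<psi>]
    by (intro ext) (auto simp: indicator_def)
  ultimately show ?thesis by simp
qed

lemma integrable_inverse_norm_ball:
  assumes "\<rho> > 0"
  shows "integrable lborel (\<lambda>x::real^3. indicator (cball 0 \<rho>) x / norm x)"
proof (rule integrableI_bounded)
  have "(\<integral>\<^sup>+x. ennreal (norm (indicator (cball 0 \<rho>) (x::real^3) / norm x)) \<partial>lborel)
     \<le> (\<integral>\<^sup>+x. ennreal \<rho> * ennreal (indicator (cball 0 \<rho>) (x::real^3) / (norm x)\<^sup>2) \<partial>lborel)"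
  proof (rule nn_integral_mono)
    fix x :: "real^3"
    have "indicator (cball 0 \<rho>) x / norm x \<le> \<rho> * (indicator (cball 0 \<rho>) x / (norm x)\<^sup>2)"
      by (cases "x = 0"; cases "norm x \<le> \<rho>") (auto simp: power2_eq_square field_simps)
    then show "ennreal (norm (indicator (cball 0 \<rho>) x / norm x))
        \<le> ennreal \<rho> * ennreal (indicator (cball 0 \<rho>) x / (norm x)\<^sup>2)"
      using assms by (subst ennreal_mult[symmetric]) (auto intro!: ennreal_leI)
  qed
  also have "\<dots> < \<infinity>"
    using nn_integral_inverse_square_ball[OF assms]
    by (subst nn_integral_cmult) (measurable, auto simp: ennreal_mult_less_top)
  finally show "(\<integral>\<^sup>+x. ennreal (norm (indicator (cball 0 \<rho>) (x::real^3) / norm x)) \<partial>lborel) < \<infinity>" .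
qed measurable

text \<open>A point (|x|, x) of the compact support has |x| \<le> \<rho>, so only the singularity
  1/|x| on a ball remains.\<close>

lemma integrable_spherical_wave:
  fixes \<psi> :: "spacetime \<Rightarrow> real"
  assumes "test_function \<psi>"
  shows "integrable lborel (\<lambda>x. \<psi> (norm x, x) / (4 * pi * norm x))"
proof -
  have cont: "continuous_on UNIV \<psi>" using assms by (auto simp: test_function_def smooth_fun_continuous)
  have comp: "compact (tsupp \<psi>)" using assms by (simp add: test_function_def)
  then obtain \<rho> where \<rho>: "\<rho> > 0" "\<And>p. p \<in> tsupp \<psi> \<Longrightarrow> norm p \<le> \<rho>"
    using compact_imp_bounded bounded_pos by metis
  have "compact (\<psi> ` tsupp \<psi>)"
    using comp cont by (intro compact_continuous_image) (auto intro: continuous_on_subset)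
  then obtain B where B: "B > 0" "\<And>p. p \<in> tsupp \<psi> \<Longrightarrow> \<bar>\<psi> p\<bar> \<le> B"
    using compact_imp_bounded bounded_pos by (metis imageI real_norm_def)
  have bd: "\<bar>\<psi> (norm x, x)\<bar> \<le> B * indicator (cball 0 \<rho>) x" for x
  proof (cases "(norm x, x) \<in> tsupp \<psi>")
    case True
    then have "norm x \<le> \<rho>" using \<rho>(2)[OF True] norm_snd_le[of x "norm x"] by simp
    then show ?thesis using B(2)[OF True] by simp
  qed (use not_in_tsupp[of "(norm x, x)" \<psi>] B in simp)
  have meas: "(\<lambda>x::real^3. \<psi> (norm x, x)) \<in> borel_measurable borel"
    using cont by (intro borel_measurable_continuous_onI continuous_on_compose2[OF cont] continuous_intros) auto
  show ?thesis
  proof (rule Bochner_Integration.integrable_bound)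
    show "integrable lborel (\<lambda>x::real^3. B / (4 * pi) * (indicator (cball 0 \<rho>) x / norm x))"
      by (intro integrable_mult_right integrable_inverse_norm_ball \<rho>)
    show "(\<lambda>x. \<psi> (norm x, x) / (4 * pi * norm x)) \<in> borel_measurable lborel"
      using meas by measurable
    show "AE x in lborel. norm (\<psi> (norm x, x) / (4 * pi * norm x))
        \<le> norm (B / (4 * pi) * (indicator (cball 0 \<rho>) x / norm x))"
      using bd B(1) by (intro AE_I2) (auto simp: abs_mult intro!: divide_right_mono)
  qed
qed

section \<open>The difference of two solutions\<close>

definition box_fun :: "(spacetime \<Rightarrow> real) \<Rightarrow> spacetime \<Rightarrow> real" where
  "box_fun \<phi> p = dir_deriv (1, 0) (dir_deriv (1, 0) \<phi>) p
      - (\<Sum>k\<in>UNIV. dir_deriv (0, axis k 1) (dir_deriv (0, axis k 1) \<phi>) p)"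

lemma dist_box_eq:
  "dist_box u \<phi> = u (dir_deriv (1, 0) (dir_deriv (1, 0) \<phi>))
      - (\<Sum>k\<in>UNIV. u (dir_deriv (0, axis k 1) (dir_deriv (0, axis k 1) \<phi>)))"
  by (simp add: dist_box_def dist_deriv_def)

lemma smooth_fun_snd:
  fixes g :: "real^3 \<Rightarrow> real"
  shows "smooth_fun g \<Longrightarrow> smooth_fun (\<lambda>p::spacetime. g (snd p))"
  by (rule smooth_fun_compose_linear[OF bounded_linear_snd])

lemma regular_part_pairing:
  assumes reg: "is_regular_part P U R" and "test_function \<psi>"
  shows "(U $ i) \<psi> = (LINT x|lborel. \<psi> (norm x, x) / (4 * pi * norm x))
      + (LINT p|lborel. indicator light_cone_interior p * R p $ i * \<psi> p)"
proof -
  have "(case p of (t, x) \<Rightarrow> heaviside (t - norm x) * R (t, x) $ i)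
      = indicator light_cone_interior p * R p $ i" for p
    by (cases p) (auto simp: heaviside_def light_cone_interior_def)
  then show ?thesis
    using assms by (simp add: is_regular_part_def dist_eq_on_def spherical_wave_def fun_dist_def)
qed

text \<open>All derivatives are moved onto \<open>\<phi>\<close>, so the singular and the regular
  part become ordinary integrals. Both components of the singular part are the same scalar wave,
  which is why the surface term sees the matrix only through its row sums.\<close>

lemma point_source_identity:
  fixes P :: "real^3 \<Rightarrow> real^2^2"
  assumes P: "\<And>i j. smooth_fun (\<lambda>x. P x $ i $ j)"
    and U: "solves_point_source_ivp P U" and reg: "is_regular_part P U R"
    and \<phi>: "test_function \<phi>"
  shows "(LINT x|lborel. box_fun \<phi> (norm x, x) / (4 * pi * norm x))
      + (LINT p|lborel. indicator light_cone_interior p * R p $ i * box_fun \<phi> p)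
    = \<phi> 0 + (LINT x|lborel. (\<Sum>j\<in>UNIV. P x $ i $ j) * \<phi> (norm x, x) / (4 * pi * norm x))
      + (LINT p|lborel. indicator light_cone_interior p * (\<Sum>j\<in>UNIV. P (snd p) $ i $ j * R p $ j) * \<phi> p)"
proof -
  define S where "S \<psi> = (LINT x|lborel. \<psi> (norm x, x) / (4 * pi * norm x))" for \<psi> :: "spacetime \<Rightarrow> real"
  define F where "F j \<psi> = (LINT p|lborel. indicator light_cone_interior p * R p $ j * \<psi> p)"
    for j and \<psi> :: "spacetime \<Rightarrow> real"
  have pair: "(U $ j) \<psi> = S \<psi> + F j \<psi>" if "test_function \<psi>" for j \<psi>
    using regular_part_pairing[OF reg that] by (simp add: S_def F_def)
  have R: "continuous_on closed_light_cone (\<lambda>p. R p $ j)" for j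
    using reg C1_up_to_cone_continuous
    by (intro continuous_on_component) (auto simp: is_regular_part_def)
  let ?t = "dir_deriv (1, 0) (dir_deriv (1, 0) \<phi>)"
  let ?x = "\<lambda>k. dir_deriv (0, axis k 1) (dir_deriv (0, axis k 1) \<phi>)"
  have t: "test_function ?t" and x: "test_function (?x k)" for k
    using \<phi> by (auto intro!: test_function_dir_deriv)
  have m: "test_function (\<lambda>p. P (snd p) $ i $ j * \<phi> p)" for j
    by (intro test_function_mult smooth_fun_snd P \<phi>)
  have "(wave_system_op P U $ i) \<phi> = dirac \<phi>"
    using U \<phi> by (auto simp: solves_point_source_ivp_def dist_eq_on_def)
  then have "(U $ i) ?t - (\<Sum>k\<in>UNIV. (U $ i) (?x k))
      - (\<Sum>j\<in>UNIV. (U $ j) (\<lambda>p. P (snd p) $ i $ j * \<phi> p)) = \<phi> 0"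
    by (simp add: wave_system_op_def dist_box_eq dist_mult_def dirac_def)
  then have main: "(S ?t - (\<Sum>k\<in>UNIV. S (?x k))) + (F i ?t - (\<Sum>k\<in>UNIV. F i (?x k)))
     = \<phi> 0 + (\<Sum>j\<in>UNIV. S (\<lambda>p. P (snd p) $ i $ j * \<phi> p)) + (\<Sum>j\<in>UNIV. F j (\<lambda>p. P (snd p) $ i $ j * \<phi> p))"
    by (simp add: pair t x m sum.distrib)
  have 1: "S (box_fun \<phi>) = S ?t - (\<Sum>k\<in>UNIV. S (?x k))"
  proof -
    have "S (box_fun \<phi>) = (LINT x|lborel. ?t (norm x, x) / (4 * pi * norm x)
        - (\<Sum>k\<in>UNIV. ?x k (norm x, x) / (4 * pi * norm x)))"
      by (simp add: S_def box_fun_def diff_divide_distrib sum_divide_distrib)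
    also have "\<dots> = S ?t - (\<Sum>k\<in>UNIV. S (?x k))"
      unfolding S_def using t x
      by (subst Bochner_Integration.integral_diff)
        (auto simp: Bochner_Integration.integral_sum integrable_spherical_wave
          intro!: Bochner_Integration.integrable_sum)
    finally show ?thesis .
  qed
  have 2: "F i (box_fun \<phi>) = F i ?t - (\<Sum>k\<in>UNIV. F i (?x k))"
  proof -
    have "F i (box_fun \<phi>) = (LINT p|lborel. indicator light_cone_interior p * R p $ i * ?t p
        - (\<Sum>k\<in>UNIV. indicator light_cone_interior p * R p $ i * ?x k p))"
      by (simp add: F_def box_fun_def right_diff_distrib sum_distrib_left)
    also have "\<dots> = F i ?t - (\<Sum>k\<in>UNIV. F i (?x k))"
      unfolding F_def using t x R
      by (subst Bochner_Integration.integral_diff)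
        (auto simp: Bochner_Integration.integral_sum integrable_cone
          intro!: Bochner_Integration.integrable_sum)
    finally show ?thesis .
  qed
  have 3: "(\<Sum>j\<in>UNIV. S (\<lambda>p. P (snd p) $ i $ j * \<phi> p))
      = (LINT x|lborel. (\<Sum>j\<in>UNIV. P x $ i $ j) * \<phi> (norm x, x) / (4 * pi * norm x))"
    unfolding S_def using integrable_spherical_wave[OF m]
    by (subst Bochner_Integration.integral_sum[symmetric])
       (auto simp: sum_distrib_right sum_divide_distrib)
  have 4: "(\<Sum>j\<in>UNIV. F j (\<lambda>p. P (snd p) $ i $ j * \<phi> p))
      = (LINT p|lborel. indicator light_cone_interior p * (\<Sum>j\<in>UNIV. P (snd p) $ i $ j * R p $ j) * \<phi> p)"
  proof -
    have "(\<Sum>j\<in>UNIV. F j (\<lambda>p. P (snd p) $ i $ j * \<phi> p)) = (LINT p|lborel.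
        (\<Sum>j\<in>UNIV. indicator light_cone_interior p * R p $ j * (P (snd p) $ i $ j * \<phi> p)))"
      unfolding F_def by (rule Bochner_Integration.integral_sum[symmetric]) (rule integrable_cone[OF R m])
    also have "\<dots> = (LINT p|lborel. indicator light_cone_interior p *
        (\<Sum>j\<in>UNIV. P (snd p) $ i $ j * R p $ j) * \<phi> p)"
      by (intro Bochner_Integration.integral_cong refl)
        (simp add: indicator_def sum_distrib_left mult_ac)
    finally show ?thesis .
  qed
  show ?thesis
    using main unfolding 1[symmetric] 2[symmetric] 3 4 by (simp add: S_def F_def)
qed

text \<open>The source value \<open>\<phi> 0\<close> and the surface integral of
  \<open>box_fun \<phi>\<close> agree for the two problems and drop out on subtraction.\<close>

lemma difference_identity:
  fixes P1 P2 :: "real^3 \<Rightarrow> real^2^2"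
  assumes P: "\<And>i j. smooth_fun (\<lambda>x. P1 x $ i $ j)" "\<And>i j. smooth_fun (\<lambda>x. P2 x $ i $ j)"
    and U: "solves_point_source_ivp P1 U1" "solves_point_source_ivp P2 U2"
    and reg: "is_regular_part P1 U1 R1" "is_regular_part P2 U2 R2"
    and \<phi>: "test_function \<phi>"
  shows "(LINT p|lborel. indicator light_cone_interior p * (R1 p $ i - R2 p $ i) * box_fun \<phi> p)
    = (LINT p|lborel. indicator light_cone_interior p *
          (\<Sum>j\<in>UNIV. P1 (snd p) $ i $ j * R1 p $ j - P2 (snd p) $ i $ j * R2 p $ j) * \<phi> p)
      + (LINT x|lborel. (\<Sum>j\<in>UNIV. P1 x $ i $ j - P2 x $ i $ j) * \<phi> (norm x, x) / (4 * pi * norm x))"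
proof -
  have R: "continuous_on closed_light_cone (\<lambda>p. R1 p $ j)"
    "continuous_on closed_light_cone (\<lambda>p. R2 p $ j)" for j
    using reg C1_up_to_cone_continuous
    by (auto simp: is_regular_part_def intro!: continuous_on_component)
  have cP: "continuous_on S (\<lambda>p::spacetime. P1 (snd p) $ i $ j)"
    "continuous_on S (\<lambda>p::spacetime. P2 (snd p) $ i $ j)" for j S
    using P by (auto intro!: smooth_fun_continuous smooth_fun_snd)
  have box: "integrable lborel (\<lambda>p. indicator light_cone_interior p * g p * box_fun \<phi> p)"
    if "continuous_on closed_light_cone g" for g
  proof -
    have "integrable lborel (\<lambda>p. indicator light_cone_interior p * g p * dir_deriv (1, 0) (dir_deriv (1, 0) \<phi>) p
      - (\<Sum>k\<in>UNIV. indicator light_cone_interior p * g p * dir_deriv (0, axis k 1) (dir_deriv (0, axis k 1) \<phi>) p))"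
      using that \<phi>
      by (intro Bochner_Integration.integrable_diff Bochner_Integration.integrable_sum integrable_cone
          test_function_dir_deriv)
    then show ?thesis by (simp add: box_fun_def right_diff_distrib sum_distrib_left)
  qed
  have i1: "(LINT p|lborel. indicator light_cone_interior p * (R1 p $ i - R2 p $ i) * box_fun \<phi> p)
     = (LINT p|lborel. indicator light_cone_interior p * R1 p $ i * box_fun \<phi> p)
     - (LINT p|lborel. indicator light_cone_interior p * R2 p $ i * box_fun \<phi> p)"
    using box[OF R(1)] box[OF R(2)]
    by (subst Bochner_Integration.integral_diff[symmetric]) (auto simp: algebra_simps)
  have c1: "continuous_on closed_light_cone (\<lambda>p. \<Sum>j\<in>UNIV. P1 (snd p) $ i $ j * R1 p $ j)"
    and c2: "continuous_on closed_light_cone (\<lambda>p. \<Sum>j\<in>UNIV. P2 (snd p) $ i $ j * R2 p $ j)"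
    by (intro continuous_intros R cP)+
  have i2: "(LINT p|lborel. indicator light_cone_interior p *
          (\<Sum>j\<in>UNIV. P1 (snd p) $ i $ j * R1 p $ j - P2 (snd p) $ i $ j * R2 p $ j) * \<phi> p)
     = (LINT p|lborel. indicator light_cone_interior p * (\<Sum>j\<in>UNIV. P1 (snd p) $ i $ j * R1 p $ j) * \<phi> p)
     - (LINT p|lborel. indicator light_cone_interior p * (\<Sum>j\<in>UNIV. P2 (snd p) $ i $ j * R2 p $ j) * \<phi> p)"
    using integrable_cone[OF c1 \<phi>] integrable_cone[OF c2 \<phi>]
    by (subst Bochner_Integration.integral_diff[symmetric]) (auto simp: algebra_simps sum_subtractf)
  have sm: "smooth_fun (\<lambda>x. \<Sum>j\<in>UNIV. P1 x $ i $ j)" "smooth_fun (\<lambda>x. \<Sum>j\<in>UNIV. P2 x $ i $ j)"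
    using P by (auto simp: sum_2 intro!: smooth_fun_add)
  have i3: "(LINT x|lborel. (\<Sum>j\<in>UNIV. P1 x $ i $ j - P2 x $ i $ j) * \<phi> (norm x, x) / (4 * pi * norm x))
     = (LINT x|lborel. (\<Sum>j\<in>UNIV. P1 x $ i $ j) * \<phi> (norm x, x) / (4 * pi * norm x))
     - (LINT x|lborel. (\<Sum>j\<in>UNIV. P2 x $ i $ j) * \<phi> (norm x, x) / (4 * pi * norm x))"
    using integrable_spherical_wave[OF test_function_mult[OF smooth_fun_snd[OF sm(1)] \<phi>]]
      integrable_spherical_wave[OF test_function_mult[OF smooth_fun_snd[OF sm(2)] \<phi>]]
    by (subst Bochner_Integration.integral_diff[symmetric])
      (auto simp: left_diff_distrib diff_divide_distrib sum_subtractf)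
  show ?thesis
    using point_source_identity[OF P(1) U(1) reg(1) \<phi>, of i]
      point_source_identity[OF P(2) U(2) reg(2) \<phi>, of i] unfolding i1 i2 i3 by linarith
qed

section \<open>Regularised spherical waves\<close>

text \<open>The regularisation is from above, so using it in place of |x - z| only decreases a
  nonnegative decreasing profile divided by the distance.\<close>

definition rdist :: "real \<Rightarrow> real^3 \<Rightarrow> real^3 \<Rightarrow> real" where
  "rdist \<delta> z x = sqrt (\<delta>\<^sup>2 + (norm (x - z))\<^sup>2)"

lemma rdist_pos: "\<delta> > 0 \<Longrightarrow> rdist \<delta> z x > 0"
  by (simp add: rdist_def add_pos_nonneg)

lemma rdist_ge: "norm (x - z) \<le> rdist \<delta> z x"
  by (auto simp: rdist_def intro!: real_le_rsqrt)

lemma rdist_sq: "(rdist \<delta> z x)\<^sup>2 = \<delta>\<^sup>2 + (norm (x - z))\<^sup>2"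
  by (simp add: rdist_def)

lemma continuous_on_rdist [continuous_intros]:
  "continuous_on S f \<Longrightarrow> continuous_on S g \<Longrightarrow> continuous_on S h \<Longrightarrow>
    continuous_on S (\<lambda>p. rdist (f p) (g p) (h p))"
  unfolding rdist_def by (intro continuous_intros)

text \<open>The right side is a power of a positive quadratic polynomial, to which
  \<open>smooth_fun_powr\<close> applies.\<close>

lemma rdist_powr:
  assumes "\<delta> > 0"
  shows "rdist \<delta> z x powr c = (x \<bullet> x + - 2 * (x \<bullet> z) + (z \<bullet> z + \<delta>\<^sup>2)) powr (c / 2)"
proof -
  have eq: "x \<bullet> x + - 2 * (x \<bullet> z) + (z \<bullet> z + \<delta>\<^sup>2) = (rdist \<delta> z x)\<^sup>2"
    by (simp add: rdist_sq power2_norm_eq_inner algebra_simps inner_commute)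
  have "(rdist \<delta> z x)\<^sup>2 = rdist \<delta> z x powr 2"
    using rdist_pos[OF assms, of z x] by simp
  then have "(rdist \<delta> z x)\<^sup>2 powr (c / 2) = rdist \<delta> z x powr (2 * (c / 2))"
    by (simp only: powr_powr)
  then show ?thesis unfolding eq by simp
qed

lemma smooth_rdist_powr: "\<delta> > 0 \<Longrightarrow> smooth_fun (\<lambda>x. rdist \<delta> z x powr c)"
proof -
  assume \<delta>: "\<delta> > 0"
  have eq: "x \<bullet> x + - 2 * (x \<bullet> z) + (z \<bullet> z + \<delta>\<^sup>2) = (rdist \<delta> z x)\<^sup>2" for x
    by (simp add: rdist_sq power2_norm_eq_inner algebra_simps inner_commute)
  have "0 < x \<bullet> x + - 2 * (x \<bullet> z) + (z \<bullet> z + \<delta>\<^sup>2)" for x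
    unfolding eq using rdist_pos[OF \<delta>, of z x] by simp
  then show ?thesis unfolding rdist_powr[OF \<delta>]
    by (intro smooth_fun_powr smooth_fun_add smooth_fun_mult smooth_fun_const smooth_fun_inner_self
        smooth_fun_bounded_linear bounded_linear_inner_left)
qed

lemma rdist_has_derivative:
  assumes "\<delta> > 0"
  shows "(rdist \<delta> z has_derivative (\<lambda>h. ((x - z) \<bullet> h) / rdist \<delta> z x)) (at x)"
proof -
  have eq: "rdist \<delta> z = (\<lambda>x. sqrt (\<delta>\<^sup>2 + (x - z) \<bullet> (x - z)))"
    by (simp add: rdist_def[abs_def] power2_norm_eq_inner)
  have pos: "\<delta>\<^sup>2 + (x - z) \<bullet> (x - z) > 0" using assms by (simp add: add_pos_nonneg)
  have "((\<lambda>x. \<delta>\<^sup>2 + (x - z) \<bullet> (x - z)) has_derivative (\<lambda>h. 2 * ((x - z) \<bullet> h))) (at x)"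
    by (auto intro!: derivative_eq_intros simp: inner_commute)
  from has_derivative_real_sqrt[OF pos this] show ?thesis
    unfolding eq by (simp add: field_simps)
qed

text \<open>The exponent \<open>m\<close> stays free because space derivatives raise it:
  differentiating a(u)/s in space gives x - z times a'(u)/s^2 - a(u)/s^3, and both terms have to be
  differentiated once more.\<close>

definition spherical_profile :: "(real \<Rightarrow> real) \<Rightarrow> nat \<Rightarrow> real \<Rightarrow> real^3 \<Rightarrow> spacetime \<Rightarrow> real" where
  "spherical_profile a m \<delta> z p = a (fst p + rdist \<delta> z (snd p)) / rdist \<delta> z (snd p) ^ m"

lemma spherical_profile_has_derivative:
  fixes z :: "real^3"
  assumes \<delta>: "\<delta> > 0" and a: "\<And>u. (a has_real_derivative a' u) (at u)"
  defines "s \<equiv> \<lambda>p. rdist \<delta> z (snd p)" and "y \<equiv> \<lambda>p. snd p - z"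
  shows "(spherical_profile a m \<delta> z has_derivative
     (\<lambda>h. a' (fst p + s p) / s p ^ m * (fst h + (y p \<bullet> snd h) / s p)
         - m * a (fst p + s p) * (y p \<bullet> snd h) / s p ^ (m + 2))) (at p)"
proof -
  have s: "s p > 0" for p using rdist_pos[OF \<delta>] by (simp add: s_def)
  have ds: "(s has_derivative (\<lambda>h. (y p \<bullet> snd h) / s p)) (at p)"
    using diff_chain_at[OF bounded_linear_imp_has_derivative[OF bounded_linear_snd]
        rdist_has_derivative[OF \<delta>, where z=z and x="snd p"]] by (simp add: o_def s_def[abs_def] y_def)
  have d\<sigma>: "((\<lambda>p. fst p + s p) has_derivative (\<lambda>h. fst h + (y p \<bullet> snd h) / s p)) (at p)"
    by (intro has_derivative_add ds bounded_linear_imp_has_derivative bounded_linear_fst)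
  have da: "((\<lambda>p. a (fst p + s p)) has_derivative (\<lambda>h. (fst h + (y p \<bullet> snd h) / s p) * a' (fst p + s p))) (at p)"
    by (rule DERIV_compose_FDERIV[OF a d\<sigma>])
  have "((\<lambda>u. u powr (- real m)) has_real_derivative (- real m) * s p powr (- real m - 1)) (at (s p))"
    by (rule has_real_derivative_powr[OF s])
  from DERIV_compose_FDERIV[OF this ds]
  have di: "((\<lambda>p. s p powr (- real m)) has_derivative
      (\<lambda>h. (y p \<bullet> snd h) / s p * ((- real m) * s p powr (- real m - 1)))) (at p)" .
  have pw: "s p powr (- real n) = 1 / s p ^ n" for n p
    using s[of p] by (simp add: powr_minus powr_realpow divide_inverse)
  have pw1: "s p powr (- real m - 1) = 1 / s p ^ (m + 1)"
  proof -
    have "- real m - 1 = - real (m + 1)" by simp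
    then show ?thesis by (simp only: pw)
  qed
  have "((\<lambda>p. a (fst p + s p) * s p powr (- real m)) has_derivative
      (\<lambda>h. a (fst p + s p) * ((y p \<bullet> snd h) / s p * ((- real m) * s p powr (- real m - 1)))
        + (fst h + (y p \<bullet> snd h) / s p) * a' (fst p + s p) * s p powr (- real m))) (at p)"
    by (rule has_derivative_mult[OF da di])
  moreover have "(\<lambda>p. a (fst p + s p) * s p powr (- real m)) = spherical_profile a m \<delta> z"
    by (intro ext, simp add: spherical_profile_def pw, simp add: s_def)
  moreover have "(\<lambda>h. a (fst p + s p) * ((y p \<bullet> snd h) / s p * ((- real m) * s p powr (- real m - 1)))
        + (fst h + (y p \<bullet> snd h) / s p) * a' (fst p + s p) * s p powr (- real m))
     = (\<lambda>h. a' (fst p + s p) / s p ^ m * (fst h + (y p \<bullet> snd h) / s p)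
         - m * a (fst p + s p) * (y p \<bullet> snd h) / s p ^ (m + 2))"
    using s[of p] by (auto simp: pw pw1 field_simps)
  ultimately show ?thesis by simp
qed

lemma dir_deriv_cong_open:
  assumes "open S" "x \<in> S" "\<And>y. y \<in> S \<Longrightarrow> f y = g y" "(g has_derivative g') (at x)"
  shows "dir_deriv v f x = g' v"
  using has_derivative_transform_within_open[OF assms(4,1,2), of f] assms(3)
  by (intro dir_deriv_eqI) auto

text \<open>The cut-off in time makes the support compact; it is invisible on the light cone.\<close>

definition cone_test :: "(real \<Rightarrow> real) \<Rightarrow> real \<Rightarrow> real^3 \<Rightarrow> spacetime \<Rightarrow> real" where
  "cone_test a \<delta> z p = smooth_step (fst p) * spherical_profile a 1 \<delta> z p"

lemma test_function_cone_test:
  assumes \<delta>: "\<delta> > 0" and a: "smooth_fun a" and A: "\<And>u. u \<ge> A \<Longrightarrow> a u = 0"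
  shows "test_function (cone_test a \<delta> z)"
proof -
  have pos: "rdist \<delta> z x > 0" for x by (rule rdist_pos[OF \<delta>])
  have sm: "smooth_fun (\<lambda>p::spacetime. rdist \<delta> z (snd p) powr c)" for c
    by (intro smooth_fun_snd smooth_rdist_powr \<delta>)
  have fst: "smooth_fun (\<lambda>p::spacetime. fst p)"
    by (rule smooth_fun_bounded_linear[OF bounded_linear_fst])
  have "smooth_fun (\<lambda>p::spacetime. smooth_step (fst p) *
      (a (fst p + rdist \<delta> z (snd p) powr 1) * rdist \<delta> z (snd p) powr (- 1)))"
    by (intro smooth_fun_mult smooth_fun_compose[OF smooth_step_smooth fst]
        smooth_fun_compose[OF a] smooth_fun_add fst sm)
  moreover have "cone_test a \<delta> z = (\<lambda>p. smooth_step (fst p) *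
      (a (fst p + rdist \<delta> z (snd p) powr 1) * rdist \<delta> z (snd p) powr (- 1)))"
    using pos by (auto simp: cone_test_def spherical_profile_def powr_minus divide_inverse less_imp_le)
  ultimately have 1: "smooth_fun (cone_test a \<delta> z)" by simp
  \<comment> \<open>The cut-off forces t > -1 and the profile forces t + s < A, hence |x - z| \<le>
    s < A + 1.\<close>
  have "tsupp (cone_test a \<delta> z) \<subseteq> {-1..A} \<times> cball z (A + 1)"
    unfolding tsupp_def
  proof (rule closure_minimal)
    show "closed ({-1..A} \<times> cball z (A + 1))" by (intro closed_Times) auto
    show "{p. cone_test a \<delta> z p \<noteq> 0} \<subseteq> {-1..A} \<times> cball z (A + 1)"
    proof
      fix p assume "p \<in> {p. cone_test a \<delta> z p \<noteq> 0}"
      then have "smooth_step (fst p) \<noteq> 0" "a (fst p + rdist \<delta> z (snd p)) \<noteq> 0"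
        by (auto simp: cone_test_def spherical_profile_def)
      then have "fst p > -1" "fst p + rdist \<delta> z (snd p) < A"
        using smooth_step_eq_0 A by (meson not_le)+
      then show "p \<in> {-1..A} \<times> cball z (A + 1)"
        using rdist_ge[of "snd p" z \<delta>] pos[of "snd p"]
        by (cases p) (auto simp: dist_norm norm_minus_commute)
    qed
  qed
  moreover have "compact ({-1..A} \<times> cball z (A + 1))" by (intro compact_Times) auto
  moreover have "closed (tsupp (cone_test a \<delta> z))" by (simp add: tsupp_def)
  ultimately have "compact (tsupp (cone_test a \<delta> z))"
    by (metis compact_Int_closed inf.absorb_iff2)
  with 1 show ?thesis by (simp add: test_function_def)
qed

text \<open>For \<open>s = rdist \<delta> z x\<close>, this is the d'Alembertian of \<open>a (t + s) / s\<close> with \<open>u = t + s\<close>;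
  the last term is, up to a constant factor, an approximate identity in \<open>x\<close>.\<close>

definition box_kernel :: "(real \<Rightarrow> real) \<Rightarrow> real \<Rightarrow> real \<Rightarrow> real \<Rightarrow> real" where
  "box_kernel a \<delta> s u = \<delta>\<^sup>2 * (deriv (deriv a) u / s ^ 3 - 3 * deriv a u / s ^ 4 + 3 * a u / s ^ 5)"

text \<open>In dimension 3 the function a(t + r)/r solves the wave equation away from r = 0. The
  same terms cancel here, except that |x - z|^2 is s^2 - \<delta>^2 instead of s^2, and this defect
  is the kernel. Positive time places the point where the cut-off is locally constant.\<close>

lemma box_cone_test:
  assumes \<delta>: "\<delta> > 0" and a: "smooth_fun a" and p: "fst p > 0"
  shows "box_fun (cone_test a \<delta> z) p
     = box_kernel a \<delta> (rdist \<delta> z (snd p)) (fst p + rdist \<delta> z (snd p))"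
proof -
  define s where "s = rdist \<delta> z (snd p)"
  define u where "u = fst p + s"
  define y where "y = snd p - z"
  define a1 where "a1 = deriv a"
  define a2 where "a2 = deriv (deriv a)"
  let ?O = "{p::spacetime. fst p > 0}"
  have O: "open ?O" by (intro open_Collect_less continuous_intros)
  have s: "s > 0" using rdist_pos[OF \<delta>] by (simp add: s_def)
  have d: "(a has_real_derivative a1 u) (at u)" "(a1 has_real_derivative a2 u) (at u)" for u
    unfolding a1_def a2_def
    by (intro smooth_fun_real_deriv smooth_fun_deriv a)+
  note D = spherical_profile_has_derivative[OF \<delta> d(1), where z=z]
  note D1 = spherical_profile_has_derivative[OF \<delta> d(2), where z=z]
  have eq: "cone_test a \<delta> z q = spherical_profile a 1 \<delta> z q" if "q \<in> ?O" for q
    using that by (simp add: cone_test_def smooth_step_eq_1)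
  have t1: "dir_deriv (1, 0) (cone_test a \<delta> z) q = spherical_profile a1 1 \<delta> z q" if "q \<in> ?O" for q
    using dir_deriv_cong_open[OF O that eq D[where m=1 and p=q], where v="(1, 0)"] by (simp add: spherical_profile_def)
  have t2: "dir_deriv (1, 0) (dir_deriv (1, 0) (cone_test a \<delta> z)) p = a2 u / s"
    using dir_deriv_cong_open[OF O _ t1 D1[where m=1 and p=p], where v="(1, 0)"] p
    by (simp add: s_def u_def)
  have x1: "dir_deriv (0, axis k 1) (cone_test a \<delta> z) q
      = (snd q - z) $ k * (spherical_profile a1 2 \<delta> z q - spherical_profile a 3 \<delta> z q)"
    if "q \<in> ?O" for q k
    using dir_deriv_cong_open[OF O that eq D[where m=1 and p=q], where v="(0, axis k 1)"]
    by (simp add: spherical_profile_def inner_axis right_diff_distrib power2_eq_square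
        power3_eq_cube mult_ac)
  have x2: "dir_deriv (0, axis k 1) (dir_deriv (0, axis k 1) (cone_test a \<delta> z)) p
      = (y $ k)\<^sup>2 * (a2 u / s ^ 3 - 3 * a1 u / s ^ 4 + 3 * a u / s ^ 5)
        + (a1 u / s ^ 2 - a u / s ^ 3)" for k
  proof -
    have "((\<lambda>q::spacetime. (snd q - z) $ k) has_derivative (\<lambda>h. snd h $ k)) (at p)"
      by (auto intro!: derivative_eq_intros bounded_linear_imp_has_derivative
          bounded_linear.has_derivative[OF bounded_linear_vec_nth])
    note Dx = has_derivative_mult[OF this has_derivative_diff[OF D1[where m=2 and p=p] D[where m=3 and p=p]]]
    show ?thesis
      using dir_deriv_cong_open[OF O _ x1 Dx, where v="(0, axis k 1)"] p s
      by (simp add: spherical_profile_def inner_axis flip: s_def u_def y_def)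
        (simp add: field_simps power2_eq_square power3_eq_cube power4_eq_xxxx eval_nat_numeral)
  qed
  have "(\<Sum>k\<in>UNIV. (y $ k)\<^sup>2) = (norm y)\<^sup>2"
    by (simp add: norm_vec_def L2_set_def sum_nonneg)
  then have y: "(\<Sum>k\<in>UNIV. (y $ k)\<^sup>2) = s\<^sup>2 - \<delta>\<^sup>2"
    using rdist_sq[of \<delta> z "snd p"] by (simp add: s_def y_def)
  have "box_fun (cone_test a \<delta> z) p
      = a2 u / s - ((s\<^sup>2 - \<delta>\<^sup>2) * (a2 u / s ^ 3 - 3 * a1 u / s ^ 4 + 3 * a u / s ^ 5)
        + 3 * (a1 u / s ^ 2 - a u / s ^ 3))"
    by (simp add: box_fun_def t2 x2 sum.distrib sum_distrib_right[symmetric] y)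
  also have "\<dots> = box_kernel a \<delta> s u"
    using s unfolding box_kernel_def a1_def a2_def by (simp add: field_simps eval_nat_numeral)
  finally show ?thesis by (simp add: s_def u_def)
qed

lemma cone_test_identity:
  fixes P1 P2 :: "real^3 \<Rightarrow> real^2^2" and z :: "real^3"
  assumes P: "\<And>i j. smooth_fun (\<lambda>x. P1 x $ i $ j)" "\<And>i j. smooth_fun (\<lambda>x. P2 x $ i $ j)"
    and U: "solves_point_source_ivp P1 U1" "solves_point_source_ivp P2 U2"
    and reg: "is_regular_part P1 U1 R1" "is_regular_part P2 U2 R2"
    and \<delta>: "\<delta> > 0" and a: "smooth_fun a" "\<And>u. u \<ge> A \<Longrightarrow> a u = 0"
  defines "s \<equiv> rdist \<delta> z"
  shows "(LINT p|lborel. indicator light_cone_interior p * (R1 p $ i - R2 p $ i) *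
        box_kernel a \<delta> (s (snd p)) (fst p + s (snd p)))
    = (LINT p|lborel. indicator light_cone_interior p *
          (\<Sum>j\<in>UNIV. P1 (snd p) $ i $ j * R1 p $ j - P2 (snd p) $ i $ j * R2 p $ j) *
          (a (fst p + s (snd p)) / s (snd p)))
      + (LINT x|lborel. (\<Sum>j\<in>UNIV. P1 x $ i $ j - P2 x $ i $ j) * (a (norm x + s x) / s x)
          / (4 * pi * norm x))"
proof -
  have fst: "fst p > 0" if "p \<in> light_cone_interior" for p
    using that norm_ge_zero[of "snd p"] unfolding light_cone_interior_eq mem_Collect_eq
    by linarith
  have 1: "indicator light_cone_interior p * c * box_fun (cone_test a \<delta> z) p
    = indicator light_cone_interior p * c * box_kernel a \<delta> (s (snd p)) (fst p + s (snd p))" for p c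
    using box_cone_test[OF \<delta> a(1) fst] by (simp add: indicator_def s_def)
  have 2: "indicator light_cone_interior p * c * cone_test a \<delta> z p
    = indicator light_cone_interior p * c * (a (fst p + s (snd p)) / s (snd p))" for p c
    using smooth_step_eq_1[OF less_imp_le[OF fst[of p]]]
    by (simp add: indicator_def s_def cone_test_def spherical_profile_def)
  have 3: "cone_test a \<delta> z (norm x, x) = a (norm x + s x) / s x" for x
    by (simp add: s_def cone_test_def smooth_step_eq_1 spherical_profile_def)
  show ?thesis
    using difference_identity[OF P U reg test_function_cone_test[OF \<delta> a, where z=z], where i=i]
    unfolding 1 2 3 .
qed

section \<open>Rescaling and the limit of the box kernel\<close>

lemma nn_integral_affine_euclidean:
  fixes G :: "'a::euclidean_space \<Rightarrow> ennreal"
  assumes [measurable]: "G \<in> borel_measurable borel" and "c > 0"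
  shows "(\<integral>\<^sup>+x. G x \<partial>lborel) = ennreal (c ^ DIM('a)) * (\<integral>\<^sup>+y. G (z + c *\<^sub>R y) \<partial>lborel)"
proof -
  have "(\<integral>\<^sup>+x. G x \<partial>lborel) =
      (\<integral>\<^sup>+x. G x \<partial>density (distr lborel borel (\<lambda>x. z + c *\<^sub>R x)) (\<lambda>_. ennreal (\<bar>c\<bar> ^ DIM('a))))"
    using lborel_affine[of c z] assms(2) by simp
  also have "\<dots> = ennreal (c ^ DIM('a)) * (\<integral>\<^sup>+y. G (z + c *\<^sub>R y) \<partial>lborel)"
    using assms(2) by (subst nn_integral_density) (auto simp: nn_integral_cmult nn_integral_distr)
  finally show ?thesis .
qed

lemma nn_integral_spacetime:
  fixes G :: "spacetime \<Rightarrow> ennreal"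
  assumes [measurable]: "G \<in> borel_measurable borel"
  shows "(\<integral>\<^sup>+p. G p \<partial>lborel) = (\<integral>\<^sup>+x. (\<integral>\<^sup>+t. G (t, x) \<partial>lborel) \<partial>lborel)"
proof -
  have "(\<integral>\<^sup>+p. G p \<partial>lborel) = (\<integral>\<^sup>+p. G p \<partial>(lborel \<Otimes>\<^sub>M lborel))" by (simp add: lborel_prod)
  also have "\<dots> = (\<integral>\<^sup>+x. (\<integral>\<^sup>+t. G (t, x) \<partial>lborel) \<partial>lborel)"
    by (rule lborel_pair.nn_integral_snd[symmetric]) (simp add: lborel_prod)
  finally show ?thesis .
qed

text \<open>A scaling with Jacobian \<open>\<epsilon> * \<delta> ^ 3\<close>, a translation, and a
  shear in time by \<open>h\<close>, which preserves volume: for fixed x it is a translation in t.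
  Tonelli gives the formula for nonnegative functions first.\<close>

lemma integral_shear_affine:
  fixes F :: "spacetime \<Rightarrow> real" and h :: "real^3 \<Rightarrow> real"
  assumes F[measurable]: "F \<in> borel_measurable borel" and h[measurable]: "h \<in> borel_measurable borel"
    and \<epsilon>: "\<epsilon> > 0" and \<delta>: "\<delta> > 0"
  shows "(LINT p|lborel. F p) =
    \<epsilon> * \<delta> ^ 3 * (LINT q|lborel. F (t0 + \<epsilon> * fst q - h (snd q), z + \<delta> *\<^sub>R snd q))"
proof -
  define \<Phi> :: "spacetime \<Rightarrow> spacetime"
    where "\<Phi> q = (t0 + \<epsilon> * fst q - h (snd q), z + \<delta> *\<^sub>R snd q)" for q
  have \<Phi>_meas[measurable]: "\<Phi> \<in> borel_measurable borel"
  proof -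
    have "\<Phi> \<in> borel \<rightarrow>\<^sub>M borel \<Otimes>\<^sub>M borel"
      unfolding \<Phi>_def[abs_def] by (subst borel_prod[symmetric]) measurable
    then show ?thesis by (simp add: borel_prod)
  qed
  have nn: "(\<integral>\<^sup>+p. G p \<partial>lborel) = ennreal (\<epsilon> * \<delta> ^ 3) * (\<integral>\<^sup>+q. G (\<Phi> q) \<partial>lborel)"
    if G[measurable]: "G \<in> borel_measurable borel" for G
  proof -
    have [measurable]: "(\<lambda>x. \<integral>\<^sup>+t. G (t, x) \<partial>lborel) \<in> borel_measurable borel"
      using lborel.borel_measurable_nn_integral[of "\<lambda>x t. G (t, x)" borel] by measurable
    have "(\<integral>\<^sup>+p. G p \<partial>lborel) = (\<integral>\<^sup>+x. (\<integral>\<^sup>+t. G (t, x) \<partial>lborel) \<partial>lborel)"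
      by (rule nn_integral_spacetime) fact
    also have "\<dots> = ennreal (\<delta> ^ 3) * (\<integral>\<^sup>+y. (\<integral>\<^sup>+t. G (t, z + \<delta> *\<^sub>R y) \<partial>lborel) \<partial>lborel)"
      using nn_integral_affine_euclidean[of "\<lambda>x. \<integral>\<^sup>+t. G (t, x) \<partial>lborel" \<delta> z] \<delta> by simp
    also have "(\<lambda>y. \<integral>\<^sup>+t. G (t, z + \<delta> *\<^sub>R y) \<partial>lborel)
        = (\<lambda>y. ennreal \<epsilon> * (\<integral>\<^sup>+\<tau>. G (\<Phi> (\<tau>, y)) \<partial>lborel))"
    proof
      fix y
      have "(\<lambda>t. G (t, z + \<delta> *\<^sub>R y)) \<in> borel_measurable borel" by measurable
      from nn_integral_real_affine[OF this, of \<epsilon> "t0 - h y"] \<epsilon>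
      show "(\<integral>\<^sup>+t. G (t, z + \<delta> *\<^sub>R y) \<partial>lborel) = ennreal \<epsilon> * (\<integral>\<^sup>+\<tau>. G (\<Phi> (\<tau>, y)) \<partial>lborel)"
        by (simp add: \<Phi>_def algebra_simps)
    qed
    also have "(\<integral>\<^sup>+y. ennreal \<epsilon> * (\<integral>\<^sup>+\<tau>. G (\<Phi> (\<tau>, y)) \<partial>lborel) \<partial>lborel)
        = ennreal \<epsilon> * (\<integral>\<^sup>+y. (\<integral>\<^sup>+\<tau>. G (\<Phi> (\<tau>, y)) \<partial>lborel) \<partial>lborel)"
      using lborel.borel_measurable_nn_integral[of "\<lambda>y \<tau>. G (\<Phi> (\<tau>, y))" borel]
      by (intro nn_integral_cmult) measurable
    also have "(\<integral>\<^sup>+y. (\<integral>\<^sup>+\<tau>. G (\<Phi> (\<tau>, y)) \<partial>lborel) \<partial>lborel) = (\<integral>\<^sup>+q. G (\<Phi> q) \<partial>lborel)"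
      by (rule nn_integral_spacetime[symmetric]) (rule measurable_compose[OF \<Phi>_meas G])
    finally have "(\<integral>\<^sup>+p. G p \<partial>lborel) = ennreal (\<delta> ^ 3) * (ennreal \<epsilon> * (\<integral>\<^sup>+q. G (\<Phi> q) \<partial>lborel))" .
    moreover have "ennreal (\<epsilon> * \<delta> ^ 3) = ennreal (\<delta> ^ 3) * ennreal \<epsilon>"
      using \<epsilon> \<delta> by (simp add: ennreal_mult' mult.commute)
    ultimately show ?thesis by (simp only: mult.assoc)
  qed
  \<comment> \<open>Applied to indicators, the formula becomes an identity of measures, which
    carries it over to signed integrands.\<close>
  have eq: "lborel = density (distr lborel borel \<Phi>) (\<lambda>_. ennreal (\<epsilon> * \<delta> ^ 3))"
  proof (rule measure_eqI)
    fix A :: "spacetime set" assume "A \<in> sets lborel"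
    then have A[measurable]: "A \<in> sets borel" by simp
    have "emeasure lborel A = (\<integral>\<^sup>+p. indicator A p \<partial>lborel)" by simp
    also have "\<dots> = ennreal (\<epsilon> * \<delta> ^ 3) * (\<integral>\<^sup>+q. indicator A (\<Phi> q) \<partial>lborel)"
      by (rule nn) measurable
    also have "(\<integral>\<^sup>+q. indicator A (\<Phi> q) \<partial>lborel) = (\<integral>\<^sup>+q. indicator A q \<partial>distr lborel borel \<Phi>)"
      by (subst nn_integral_distr) auto
    also have "ennreal (\<epsilon> * \<delta> ^ 3) * (\<integral>\<^sup>+q. indicator A q \<partial>distr lborel borel \<Phi>)
        = emeasure (density (distr lborel borel \<Phi>) (\<lambda>_. ennreal (\<epsilon> * \<delta> ^ 3))) A"
      by (subst emeasure_density) (auto simp: nn_integral_cmult)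
    finally show "emeasure lborel A
        = emeasure (density (distr lborel borel \<Phi>) (\<lambda>_. ennreal (\<epsilon> * \<delta> ^ 3))) A" .
  qed simp
  have "(LINT p|lborel. F p) = (LINT p|density (distr lborel borel \<Phi>) (\<lambda>_. ennreal (\<epsilon> * \<delta> ^ 3)). F p)"
    using eq by simp
  also have "\<dots> = (LINT p|distr lborel borel \<Phi>. (\<epsilon> * \<delta> ^ 3) *\<^sub>R F p)"
    using \<epsilon> \<delta> by (intro integral_density) auto
  also have "\<dots> = (LINT q|lborel. (\<epsilon> * \<delta> ^ 3) *\<^sub>R F (\<Phi> q))"
    by (rule integral_distr) auto
  finally show ?thesis by (simp add: \<Phi>_def)
qed

text \<open>This is \<open>rdist\<close> in the variable y = (x - z) / \<delta>, up to the factor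
  \<delta>.\<close>

definition unit_rdist :: "real^3 \<Rightarrow> real" where "unit_rdist y = sqrt (1 + (norm y)\<^sup>2)"

lemma unit_rdist_ge_1: "unit_rdist y \<ge> 1"
  by (simp add: unit_rdist_def)

lemma borel_measurable_unit_rdist [measurable]: "unit_rdist \<in> borel_measurable borel"
  unfolding unit_rdist_def[abs_def] by measurable

lemma rdist_scale: "\<delta> > 0 \<Longrightarrow> rdist \<delta> z (z + \<delta> *\<^sub>R y) = \<delta> * unit_rdist y"
proof -
  assume "\<delta> > 0"
  moreover have "\<delta>\<^sup>2 + (\<delta> * norm y)\<^sup>2 = \<delta>\<^sup>2 * (1 + (norm y)\<^sup>2)" by (simp add: algebra_simps power_mult_distrib)
  ultimately show ?thesis by (simp add: rdist_def unit_rdist_def real_sqrt_mult)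
qed

lemma integrable_time_unit_rdist:
  "integrable lborel (\<lambda>q::spacetime. indicator {lo..hi} (fst q) / unit_rdist (snd q) ^ 4)"
proof (rule integrableI_bounded)
  have p4: "unit_rdist y ^ 4 = (1 + (norm y)\<^sup>2)\<^sup>2" for y
  proof -
    have "unit_rdist y ^ 4 = ((unit_rdist y)\<^sup>2)\<^sup>2" by simp
    also have "(unit_rdist y)\<^sup>2 = 1 + (norm y)\<^sup>2" by (simp add: unit_rdist_def)
    finally show ?thesis .
  qed
  show m: "(\<lambda>q::spacetime. indicator {lo..hi} (fst q) / unit_rdist (snd q) ^ 4) \<in> borel_measurable lborel"
    by (simp, subst borel_prod[symmetric]) measurable
  have "(\<integral>\<^sup>+q. ennreal (norm (indicator {lo..hi} (fst q) / unit_rdist (snd q) ^ 4)) \<partial>(lborel::spacetime measure))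
     = (\<integral>\<^sup>+y. \<integral>\<^sup>+\<tau>. ennreal (1 / unit_rdist y ^ 4) * indicator {lo..hi} \<tau> \<partial>lborel \<partial>lborel)"
    using m by (subst nn_integral_spacetime) (auto intro!: nn_integral_cong simp: indicator_def)
  also have "\<dots> = (\<integral>\<^sup>+y. ennreal (1 / unit_rdist y ^ 4) * emeasure lborel {lo..hi} \<partial>lborel)"
    by (intro nn_integral_cong nn_integral_cmult_indicator) auto
  also have "\<dots> = (\<integral>\<^sup>+y. ennreal (1 / unit_rdist y ^ 4) \<partial>lborel) * emeasure lborel {lo..hi}"
    by (rule nn_integral_multc) measurable
  also have "\<dots> < \<infinity>"
    using nn_integral_inverse_square_1_norm by (simp add: p4 ennreal_mult_less_top emeasure_lborel_Icc_eq)
  finally show "(\<integral>\<^sup>+q. ennreal (norm (indicator {lo..hi} (fst q) / unit_rdist (snd q) ^ 4)) \<partial>(lborel::spacetime measure)) < \<infinity>" .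
qed

lemma deriv_rescale:
  fixes \<rho> :: "real \<Rightarrow> real" and t0 :: real
  assumes "smooth_fun \<rho>" "\<epsilon> > 0"
  defines "a \<equiv> \<lambda>u. \<rho> ((u - t0) / \<epsilon>) / \<epsilon>"
  shows "deriv a u = deriv \<rho> ((u - t0) / \<epsilon>) / \<epsilon>\<^sup>2"
    and "deriv (deriv a) u = deriv (deriv \<rho>) ((u - t0) / \<epsilon>) / \<epsilon> ^ 3"
proof -
  have l: "((\<lambda>u. (u - t0) / \<epsilon>) has_real_derivative 1 / \<epsilon>) (at u)" for u
    using assms(2) by (auto intro!: derivative_eq_intros)
  have d: "deriv a u = deriv \<rho> ((u - t0) / \<epsilon>) / \<epsilon>\<^sup>2" for u
    using DERIV_cdivide[OF DERIV_chain2[OF smooth_fun_real_deriv[OF assms(1)] l[of u]], of \<epsilon>]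
    unfolding a_def by (intro DERIV_imp_deriv) (simp add: power2_eq_square)
  show "deriv a u = deriv \<rho> ((u - t0) / \<epsilon>) / \<epsilon>\<^sup>2" by (rule d)
  have "deriv a = (\<lambda>u. deriv \<rho> ((u - t0) / \<epsilon>) / \<epsilon>\<^sup>2)" using d by blast
  then show "deriv (deriv a) u = deriv (deriv \<rho>) ((u - t0) / \<epsilon>) / \<epsilon> ^ 3"
    using DERIV_cdivide[OF DERIV_chain2[OF smooth_fun_real_deriv[OF smooth_fun_deriv[OF assms(1)]] l[of u]], of "\<epsilon>\<^sup>2"]
    by (simp add: DERIV_imp_deriv power2_eq_square power3_eq_cube mult.assoc)
qed

text \<open>The shear subtracts s itself, so the phase t + s becomes t0 + \<epsilon> \<tau> and the
  profile depends on \<tau> alone. All powers of \<delta> and \<epsilon> collect into the ratio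
  \<open>\<kappa>\<close>, and only the last of the three terms is free of it.\<close>

lemma box_kernel_rescale:
  fixes w :: "spacetime \<Rightarrow> real" and z :: "real^3" and t0 :: real
  assumes w: "w \<in> borel_measurable borel" and \<rho>: "smooth_fun \<rho>" and pos: "\<epsilon> > 0" "\<delta> > 0"
  defines "a \<equiv> \<lambda>u. \<rho> ((u - t0) / \<epsilon>) / \<epsilon>" and "s \<equiv> rdist \<delta> z" and "\<kappa> \<equiv> \<delta> / \<epsilon>"
  shows "(LINT p|lborel. w p * box_kernel a \<delta> (s (snd p)) (fst p + s (snd p)))
    = (LINT q|lborel. w (t0 + \<epsilon> * fst q - \<delta> * unit_rdist (snd q), z + \<delta> *\<^sub>R snd q) *
        (\<kappa>\<^sup>2 * deriv (deriv \<rho>) (fst q) / unit_rdist (snd q) ^ 3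
          - 3 * \<kappa> * deriv \<rho> (fst q) / unit_rdist (snd q) ^ 4 + 3 * \<rho> (fst q) / unit_rdist (snd q) ^ 5))"
proof -
  have cont: "continuous_on UNIV a" "continuous_on UNIV (deriv a)" "continuous_on UNIV (deriv (deriv a))"
  proof -
    have "smooth_fun a" unfolding a_def
      using smooth_fun_mult[OF smooth_fun_compose[OF \<rho> smooth_fun_affine[of "1/\<epsilon>" "- t0/\<epsilon>"]] smooth_fun_const[of "1/\<epsilon>"]]
      by (simp add: diff_divide_distrib)
    then show "continuous_on UNIV a" "continuous_on UNIV (deriv a)" "continuous_on UNIV (deriv (deriv a))"
      by (auto intro!: smooth_fun_continuous smooth_fun_deriv)
  qed
  have m: "(\<lambda>p::spacetime. box_kernel a \<delta> (s (snd p)) (fst p + s (snd p))) \<in> borel_measurable borel"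
  proof -
    have s: "continuous_on UNIV (\<lambda>p::spacetime. s (snd p))"
      unfolding s_def by (intro continuous_intros)
    have c: "continuous_on UNIV (\<lambda>p::spacetime. g (fst p + s (snd p)))"
      if "continuous_on UNIV g" for g :: "real \<Rightarrow> real"
      by (rule continuous_on_compose2[OF that]) (auto intro!: continuous_on_add s continuous_on_fst continuous_on_id)
    have "s (snd p) ^ n \<noteq> 0" for p :: spacetime and n
      using rdist_pos[OF pos(2), of z "snd p"] by (simp add: s_def)
    then show ?thesis
      unfolding box_kernel_def
      by (intro borel_measurable_continuous_onI continuous_on_mult continuous_on_add continuous_on_diff
          continuous_on_divide continuous_on_const c cont continuous_on_power s) blast+
  qed
  have "(LINT p|lborel. w p * box_kernel a \<delta> (s (snd p)) (fst p + s (snd p)))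
    = \<epsilon> * \<delta> ^ 3 * (LINT q|lborel. w (t0 + \<epsilon> * fst q - \<delta> * unit_rdist (snd q), z + \<delta> *\<^sub>R snd q) *
        box_kernel a \<delta> (s (z + \<delta> *\<^sub>R snd q)) (t0 + \<epsilon> * fst q - \<delta> * unit_rdist (snd q) + s (z + \<delta> *\<^sub>R snd q)))"
    using integral_shear_affine[of "\<lambda>p. w p * box_kernel a \<delta> (s (snd p)) (fst p + s (snd p))"
        "\<lambda>y. \<delta> * unit_rdist y" \<epsilon> \<delta> t0 z] w m pos by simp
  also have "\<dots> = (LINT q|lborel. w (t0 + \<epsilon> * fst q - \<delta> * unit_rdist (snd q), z + \<delta> *\<^sub>R snd q) *
        (\<epsilon> * \<delta> ^ 3 * box_kernel a \<delta> (\<delta> * unit_rdist (snd q)) (t0 + \<epsilon> * fst q)))"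
    by (subst integral_mult_right_zero[symmetric]) (simp add: s_def rdist_scale[OF pos(2)] mult_ac)
  also have "\<dots> = (LINT q|lborel. w (t0 + \<epsilon> * fst q - \<delta> * unit_rdist (snd q), z + \<delta> *\<^sub>R snd q) *
        (\<kappa>\<^sup>2 * deriv (deriv \<rho>) (fst q) / unit_rdist (snd q) ^ 3
          - 3 * \<kappa> * deriv \<rho> (fst q) / unit_rdist (snd q) ^ 4 + 3 * \<rho> (fst q) / unit_rdist (snd q) ^ 5))"
  proof (intro Bochner_Integration.integral_cong refl arg_cong2[where f="(*)"])
    fix q :: spacetime
    have "unit_rdist (snd q) > 0" using unit_rdist_ge_1[of "snd q"] by linarith
    then show "\<epsilon> * \<delta> ^ 3 * box_kernel a \<delta> (\<delta> * unit_rdist (snd q)) (t0 + \<epsilon> * fst q)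
      = \<kappa>\<^sup>2 * deriv (deriv \<rho>) (fst q) / unit_rdist (snd q) ^ 3
          - 3 * \<kappa> * deriv \<rho> (fst q) / unit_rdist (snd q) ^ 4 + 3 * \<rho> (fst q) / unit_rdist (snd q) ^ 5"
      using pos unfolding box_kernel_def a_def deriv_rescale[OF \<rho> pos(1)] \<kappa>_def
      by (simp add: power_mult_distrib) (simp add: field_simps eval_nat_numeral)
  qed
  finally show ?thesis .
qed

text \<open>Dominated convergence in the rescaled variables. The obstacle is the term with the
  second derivative, of order r^-3 for r = \<open>unit_rdist y\<close>, which is not integrable in
  dimension 3. Causality rescues it: \<open>w\<close> vanishes at nonpositive times, so \<delta> r <
  Tm wherever the integrand is nonzero, and the assumption that the square of \<delta> / \<epsilon>
  is at most \<delta> leaves a bound of order Tm / r^4. The hypothesis \<open>out\<close> admits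
  both profiles that vanish outside an interval and profiles that live on at negative times, where
  \<open>w\<close> vanishes instead.\<close>

lemma box_kernel_limit:
  fixes w :: "spacetime \<Rightarrow> real" and \<epsilon> \<delta> :: "nat \<Rightarrow> real" and z :: "real^3"
  assumes w: "w \<in> borel_measurable borel" and \<rho>: "smooth_fun \<rho>"
    and pos: "\<And>k. \<epsilon> k > 0" "\<And>k. \<delta> k > 0"
    and \<delta>0: "\<delta> \<longlonglongrightarrow> 0" "(\<lambda>k. \<delta> k / \<epsilon> k) \<longlonglongrightarrow> 0"
    and \<kappa>: "\<And>k. (\<delta> k / \<epsilon> k)\<^sup>2 \<le> \<delta> k" "\<And>k. \<delta> k / \<epsilon> k \<le> 1"
    and w0: "\<And>p. fst p \<le> 0 \<Longrightarrow> w p = 0"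
    and bd: "\<And>p. fst p \<le> Tm \<Longrightarrow> \<bar>w p\<bar> \<le> M" and M: "M \<ge> 0" and Tm: "Tm \<ge> 0"
    and range: "\<And>k \<tau>. \<tau> \<in> {lo..hi} \<Longrightarrow> t0 + \<epsilon> k * \<tau> \<le> Tm"
    and out: "\<And>\<tau>. \<tau> \<notin> {lo..hi} \<Longrightarrow>
        (\<rho> \<tau> = 0 \<and> deriv \<rho> \<tau> = 0 \<and> deriv (deriv \<rho>) \<tau> = 0) \<or> (\<forall>k. t0 + \<epsilon> k * \<tau> \<le> 0)"
    and lim: "\<And>\<tau> y. (\<lambda>k. w (t0 + \<epsilon> k * \<tau> - \<delta> k * unit_rdist y, z + \<delta> k *\<^sub>R y)) \<longlonglongrightarrow> W \<tau>"
    and W: "W \<in> borel_measurable borel"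
  shows "(\<lambda>k. LINT p|lborel. w p * box_kernel (\<lambda>u. \<rho> ((u - t0) / \<epsilon> k) / \<epsilon> k) (\<delta> k)
            (rdist (\<delta> k) z (snd p)) (fst p + rdist (\<delta> k) z (snd p)))
     \<longlonglongrightarrow> (LINT q|lborel. W (fst q) * (3 * \<rho> (fst q) / unit_rdist (snd q) ^ 5))"
proof -
  define \<rho>1 where "\<rho>1 = deriv \<rho>"
  define \<rho>2 where "\<rho>2 = deriv (deriv \<rho>)"
  have cont: "continuous_on S \<rho>" "continuous_on S \<rho>1" "continuous_on S \<rho>2" for S
    unfolding \<rho>1_def \<rho>2_def by (intro smooth_fun_continuous smooth_fun_deriv \<rho>)+
  obtain B where B: "B > 0" "\<And>\<tau>. \<tau> \<in> {lo..hi} \<Longrightarrow> \<bar>\<rho> \<tau>\<bar> \<le> B \<and> \<bar>\<rho>1 \<tau>\<bar> \<le> B \<and> \<bar>\<rho>2 \<tau>\<bar> \<le> B"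
  proof -
    have "\<exists>b. \<forall>\<tau>\<in>{lo..hi}. \<bar>g \<tau>\<bar> \<le> b" if "continuous_on {lo..hi} g" for g :: "real \<Rightarrow> real"
    proof -
      have "bounded (g ` {lo..hi})"
        by (intro compact_imp_bounded compact_continuous_image that) simp
      then show ?thesis by (auto simp: bounded_iff)
    qed
    then obtain b0 b1 b2 where b: "\<forall>\<tau>\<in>{lo..hi}. \<bar>\<rho> \<tau>\<bar> \<le> b0" "\<forall>\<tau>\<in>{lo..hi}. \<bar>\<rho>1 \<tau>\<bar> \<le> b1"
      "\<forall>\<tau>\<in>{lo..hi}. \<bar>\<rho>2 \<tau>\<bar> \<le> b2" using cont by meson
    show ?thesis
    proof (rule that[of "1 + \<bar>b0\<bar> + \<bar>b1\<bar> + \<bar>b2\<bar>"])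
      show "0 < 1 + \<bar>b0\<bar> + \<bar>b1\<bar> + \<bar>b2\<bar>" by linarith
      fix \<tau> assume "\<tau> \<in> {lo..hi}"
      then have "\<bar>\<rho> \<tau>\<bar> \<le> b0" "\<bar>\<rho>1 \<tau>\<bar> \<le> b1" "\<bar>\<rho>2 \<tau>\<bar> \<le> b2" using b by blast+
      then show "\<bar>\<rho> \<tau>\<bar> \<le> 1 + \<bar>b0\<bar> + \<bar>b1\<bar> + \<bar>b2\<bar> \<and> \<bar>\<rho>1 \<tau>\<bar> \<le> 1 + \<bar>b0\<bar> + \<bar>b1\<bar> + \<bar>b2\<bar>
          \<and> \<bar>\<rho>2 \<tau>\<bar> \<le> 1 + \<bar>b0\<bar> + \<bar>b1\<bar> + \<bar>b2\<bar>"
        by linarith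
    qed
  qed
  define \<Phi> :: "nat \<Rightarrow> spacetime \<Rightarrow> spacetime"
    where "\<Phi> k q = (t0 + \<epsilon> k * fst q - \<delta> k * unit_rdist (snd q), z + \<delta> k *\<^sub>R snd q)" for k q
  define K where "K k q = (\<delta> k / \<epsilon> k)\<^sup>2 * \<rho>2 (fst q) / unit_rdist (snd q) ^ 3
      - 3 * (\<delta> k / \<epsilon> k) * \<rho>1 (fst q) / unit_rdist (snd q) ^ 4 + 3 * \<rho> (fst q) / unit_rdist (snd q) ^ 5"
    for k and q :: spacetime
  have u1: "unit_rdist y \<ge> 1" for y by (rule unit_rdist_ge_1)
  have meas\<Phi>: "\<Phi> k \<in> borel_measurable borel" for k
  proof -
    have "\<Phi> k \<in> borel \<rightarrow>\<^sub>M borel \<Otimes>\<^sub>M borel"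
      unfolding \<Phi>_def[abs_def] by (subst borel_prod[symmetric]) measurable
    then show ?thesis by (simp add: borel_prod)
  qed
  have [measurable]: "\<rho> \<in> borel_measurable borel" "\<rho>1 \<in> borel_measurable borel" "\<rho>2 \<in> borel_measurable borel"
    using cont by (auto intro: borel_measurable_continuous_onI)
  note W[measurable]
  have measK: "K k \<in> borel_measurable borel" for k
    unfolding K_def[abs_def] by (subst borel_prod[symmetric]) measurable
  have "(\<lambda>k. LINT q|lborel. w (\<Phi> k q) * K k q)
      \<longlonglongrightarrow> (LINT q|lborel. W (fst q) * (3 * \<rho> (fst q) / unit_rdist (snd q) ^ 5))"
  proof (rule integral_dominated_convergence)
    show "(\<lambda>q::spacetime. W (fst q) * (3 * \<rho> (fst q) / unit_rdist (snd q) ^ 5)) \<in> borel_measurable lborel"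
      by (simp, subst borel_prod[symmetric]) measurable
    show "(\<lambda>q. w (\<Phi> k q) * K k q) \<in> borel_measurable lborel" for k
      using measurable_compose[OF meas\<Phi> w] measK by simp
    \<comment> \<open>The constant is Tm + 3 + 3, one summand for each term of the kernel.\<close>
    show "integrable lborel (\<lambda>q::spacetime. M * (B * (Tm + 6)) * (indicator {lo..hi} (fst q) / unit_rdist (snd q) ^ 4))"
      by (intro integrable_mult_right integrable_time_unit_rdist)
    show "AE q in lborel. (\<lambda>k. w (\<Phi> k q) * K k q)
        \<longlonglongrightarrow> W (fst q) * (3 * \<rho> (fst q) / unit_rdist (snd q) ^ 5)"
    proof (rule AE_I2)
      fix q :: spacetime
      have "(\<lambda>k. K k q) \<longlonglongrightarrow> 0\<^sup>2 * \<rho>2 (fst q) / unit_rdist (snd q) ^ 3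
          - 3 * 0 * \<rho>1 (fst q) / unit_rdist (snd q) ^ 4 + 3 * \<rho> (fst q) / unit_rdist (snd q) ^ 5"
        unfolding K_def using u1[of "snd q"] by (intro tendsto_intros \<delta>0) auto
      then show "(\<lambda>k. w (\<Phi> k q) * K k q) \<longlonglongrightarrow> W (fst q) * (3 * \<rho> (fst q) / unit_rdist (snd q) ^ 5)"
        unfolding \<Phi>_def by (intro tendsto_mult lim) simp
    qed
    show "AE q in lborel. norm (w (\<Phi> k q) * K k q)
        \<le> M * (B * (Tm + 6)) * (indicator {lo..hi} (fst q) / unit_rdist (snd q) ^ 4)" for k
    proof (rule AE_I2)
      fix q :: spacetime
      define s where "s = unit_rdist (snd q)"
      have s: "s \<ge> 1" using u1 s_def by simp
      show "norm (w (\<Phi> k q) * K k q)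
        \<le> M * (B * (Tm + 6)) * (indicator {lo..hi} (fst q) / unit_rdist (snd q) ^ 4)"
      proof (cases "w (\<Phi> k q) = 0 \<or> K k q = 0")
        case True
        then show ?thesis using M B Tm u1[of "snd q"] by (auto intro!: mult_nonneg_nonneg)
      next
        case False
        then have t: "t0 + \<epsilon> k * fst q - \<delta> k * s > 0"
          using w0[of "\<Phi> k q"] by (force simp: \<Phi>_def s_def)
        have ds: "\<delta> k * s > 0" using pos(2)[of k] s by simp
        have tpos: "t0 + \<epsilon> k * fst q > 0" using t ds by linarith
        have q: "fst q \<in> {lo..hi}"
        proof (rule ccontr)
          assume "fst q \<notin> {lo..hi}"
          from out[OF this] show False
          proof
            assume "\<rho> (fst q) = 0 \<and> deriv \<rho> (fst q) = 0 \<and> deriv (deriv \<rho>) (fst q) = 0"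
            then have "K k q = 0" by (simp add: K_def \<rho>1_def \<rho>2_def)
            then show False using False by simp
          next
            assume "\<forall>k. t0 + \<epsilon> k * fst q \<le> 0"
            then show False using tpos by (meson not_le)
          qed
        qed
        have Tq: "t0 + \<epsilon> k * fst q \<le> Tm" using range[OF q] by simp
        have "\<bar>w (\<Phi> k q)\<bar> \<le> M" using ds Tq by (intro bd) (simp add: \<Phi>_def s_def)
        moreover have "\<bar>K k q\<bar> \<le> B * (Tm + 6) / s ^ 4"
        proof -
          let ?\<kappa> = "\<delta> k / \<epsilon> k"
          have k0: "?\<kappa> > 0" using pos by simp
          have "?\<kappa>\<^sup>2 * s \<le> \<delta> k * s" using \<kappa>(1)[of k] s by (intro mult_right_mono) auto
          also have "\<dots> \<le> Tm" using t Tq by linarith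
          finally have k2: "?\<kappa>\<^sup>2 * s \<le> Tm" .
          have "\<bar>?\<kappa>\<^sup>2 * \<rho>2 (fst q) / s ^ 3\<bar> = (?\<kappa>\<^sup>2 * s) * \<bar>\<rho>2 (fst q)\<bar> / s ^ 4"
            using s by (simp add: abs_mult field_simps eval_nat_numeral)
          also have "\<dots> \<le> Tm * B / s ^ 4"
            using k2 B(2)[OF q] s Tm by (intro divide_right_mono mult_mono) auto
          finally have 1: "\<bar>?\<kappa>\<^sup>2 * \<rho>2 (fst q) / s ^ 3\<bar> \<le> Tm * B / s ^ 4" .
          have "\<bar>3 * ?\<kappa> * \<rho>1 (fst q) / s ^ 4\<bar> = 3 * (?\<kappa> * \<bar>\<rho>1 (fst q)\<bar>) / s ^ 4"
            using s pos(1)[of k] pos(2)[of k] by (simp add: abs_mult)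
          also have "\<dots> \<le> 3 * (1 * B) / s ^ 4"
            using \<kappa>(2)[of k] B(2)[OF q] s k0 by (intro divide_right_mono mult_left_mono mult_mono) auto
          finally have 2: "\<bar>3 * ?\<kappa> * \<rho>1 (fst q) / s ^ 4\<bar> \<le> 3 * B / s ^ 4" by simp
          have "\<bar>3 * \<rho> (fst q) / s ^ 5\<bar> = 3 * \<bar>\<rho> (fst q)\<bar> / s ^ 5" using s by (simp add: abs_mult)
          also have "\<dots> \<le> 3 * B / s ^ 4"
            using B(2)[OF q] B(1) s by (intro frac_le mult_left_mono power_increasing) auto
          finally have 3: "\<bar>3 * \<rho> (fst q) / s ^ 5\<bar> \<le> 3 * B / s ^ 4" .
          have "\<bar>K k q\<bar> \<le> \<bar>?\<kappa>\<^sup>2 * \<rho>2 (fst q) / s ^ 3\<bar> + \<bar>3 * ?\<kappa> * \<rho>1 (fst q) / s ^ 4\<bar> + \<bar>3 * \<rho> (fst q) / s ^ 5\<bar>"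
            unfolding K_def s_def[symmetric] by linarith
          also have "\<dots> \<le> Tm * B / s ^ 4 + 3 * B / s ^ 4 + 3 * B / s ^ 4" using 1 2 3 by linarith
          also have "\<dots> = B * (Tm + 6) / s ^ 4" by (simp add: add_divide_distrib algebra_simps)
          finally show ?thesis .
        qed
        ultimately have "\<bar>w (\<Phi> k q)\<bar> * \<bar>K k q\<bar> \<le> M * (B * (Tm + 6) / s ^ 4)"
          using M by (intro mult_mono) auto
        then show ?thesis using q by (simp add: abs_mult s_def)
      qed
    qed
  qed
  then show ?thesis
    unfolding box_kernel_rescale[OF w \<rho> pos] by (simp add: \<Phi>_def K_def \<rho>1_def \<rho>2_def)
qed

section \<open>Two-centre potentials\<close>

lemma nn_integral_reflect:
  fixes G :: "'a::euclidean_space \<Rightarrow> ennreal"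
  assumes [measurable]: "G \<in> borel_measurable borel"
  shows "(\<integral>\<^sup>+y. G (x - y) \<partial>lborel) = (\<integral>\<^sup>+y. G y \<partial>lborel)"
proof -
  have "(\<integral>\<^sup>+y. G y \<partial>lborel) =
      (\<integral>\<^sup>+y. G y \<partial>density (distr lborel borel (\<lambda>y. x + (-1) *\<^sub>R y)) (\<lambda>_. ennreal (\<bar>-1\<bar> ^ DIM('a))))"
    using lborel_affine[of "-1" x] by simp
  also have "\<dots> = (\<integral>\<^sup>+y. G (x - y) \<partial>lborel)"
    by (subst nn_integral_density) (auto simp: nn_integral_distr)
  finally show ?thesis by simp
qed

section \<open>Rotation invariance and concentration near a ray\<close>

lemma orthogonal_transformation_measurable:
  fixes f :: "'a::euclidean_space \<Rightarrow> 'a"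
  assumes "orthogonal_transformation f"
  shows "f \<in> borel_measurable borel"
  using orthogonal_transformation_linear[OF assms]
  by (intro borel_measurable_continuous_onI linear_continuous_on)
    (rule linear_conv_bounded_linear[THEN iffD1])

lemma lborel_distr_orthogonal:
  fixes f :: "real^'n::{finite,wellorder} \<Rightarrow> real^'n::_"
  assumes f: "orthogonal_transformation f"
  shows "distr lborel borel f = lborel"
proof (rule lborel_eqI[symmetric])
  fix l u :: "real^'n::{finite,wellorder}" assume lu: "\<And>b. b \<in> Basis \<Longrightarrow> l \<bullet> b \<le> u \<bullet> b"
  have bij: "bij f" using f by (rule orthogonal_transformation_bij)
  have g: "orthogonal_transformation (inv f)" using f by (rule orthogonal_transformation_inv)
  have [measurable]: "f \<in> borel_measurable borel"
    using f by (rule orthogonal_transformation_measurable)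
  \<comment> \<open>A preimage under an orthogonal map is an image under its inverse, so the
    invariance of the measure of images applies to boxes.\<close>
  have vi: "f -` box l u = inv f ` box l u" using bij by (simp add: bij_vimage_eq_inv_image)
  have lm: "inv f ` box l u \<in> lmeasurable" by (rule measurable_orthogonal_image[OF g]) simp
  have "inv f ` box l u \<in> sets borel"
    using measurable_sets[of f borel borel "box l u"] by (simp add: vi)
  then have "emeasure lborel (inv f ` box l u) = emeasure lebesgue (inv f ` box l u)" by simp
  also have "\<dots> = ennreal (measure lebesgue (inv f ` box l u))"
    using lm by (simp add: emeasure_eq_measure2)
  also have "\<dots> = ennreal (measure lebesgue (box l u))"
    by (subst measure_orthogonal_image[OF g]) auto
  also have "\<dots> = ennreal (\<Prod>b\<in>Basis. (u - l) \<bullet> b)"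
    using lu by (simp add: measure_completion)
  finally show "emeasure (distr lborel borel f) (box l u) = ennreal (\<Prod>b\<in>Basis. (u - l) \<bullet> b)"
    by (simp add: emeasure_distr vi)
qed simp

text \<open>For a unit vector \<open>e\<close> the exponent |y| - y \<bullet> e vanishes exactly on
  the ray through \<open>e\<close>, so a large \<open>\<mu>\<close> confines the mass to a
  neighbourhood of that ray. The remaining factor is the locally integrable singularity
  1/|y|^2.\<close>

definition ray_weight :: "real \<Rightarrow> real \<Rightarrow> real^3 \<Rightarrow> real^3 \<Rightarrow> real" where
  "ray_weight T \<mu> e y = indicator (cball 0 T) y * exp (- (\<mu> * (norm y - y \<bullet> e))) / (norm y)\<^sup>2"

definition ray_integral :: "real \<Rightarrow> real \<Rightarrow> ennreal" where
  "ray_integral T \<mu> = (\<integral>\<^sup>+y. ennreal (ray_weight T \<mu> (axis 1 1) y) \<partial>lborel)"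

lemma ray_weight_measurable [measurable]: "ray_weight T \<mu> e \<in> borel_measurable borel"
  unfolding ray_weight_def[abs_def] by measurable

lemma ray_weight_nonneg: "ray_weight T \<mu> e y \<ge> 0"
  by (simp add: ray_weight_def)

text \<open>Rotation invariance removes the direction, which makes the two-centre bound uniform in
  the point x.\<close>

lemma nn_integral_ray_weight:
  assumes "norm e = 1"
  shows "(\<integral>\<^sup>+y. ennreal (ray_weight T \<mu> e y) \<partial>lborel) = ray_integral T \<mu>"
proof -
  have "norm e = norm (axis 1 1 :: real^3)" using assms by (simp add: norm_axis_1)
  then obtain f :: "real^3 \<Rightarrow> real^3" where f: "orthogonal_transformation f" "f e = axis 1 1"
    by (rule orthogonal_transformation_exists)
  have [measurable]: "f \<in> borel_measurable borel"
    using f(1) by (rule orthogonal_transformation_measurable)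
  have eq: "ray_weight T \<mu> (axis 1 1) (f y) = ray_weight T \<mu> e y" for y
  proof -
    have "f y \<bullet> axis 1 1 = y \<bullet> e"
      using f(1) by (simp add: orthogonal_transformation_def flip: f(2))
    then show ?thesis by (simp add: ray_weight_def orthogonal_transformation_norm[OF f(1)] indicator_def)
  qed
  have "ray_integral T \<mu> = (\<integral>\<^sup>+y. ennreal (ray_weight T \<mu> (axis 1 1) y) \<partial>distr lborel borel f)"
    by (simp add: ray_integral_def lborel_distr_orthogonal[OF f(1)])
  also have "\<dots> = (\<integral>\<^sup>+y. ennreal (ray_weight T \<mu> (axis 1 1) (f y)) \<partial>lborel)"
    by (subst nn_integral_distr) auto
  finally show ?thesis by (simp add: eq)
qed

lemma ray_integral_tendsto_0:
  assumes T: "T > 0" and \<mu>: "filterlim \<mu> at_top sequentially" "\<And>n. \<mu> n \<ge> 0"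
  shows "(\<lambda>n::nat. ray_integral T (\<mu> n)) \<longlonglongrightarrow> 0"
proof -
  let ?e = "axis 1 1 :: real^3"
  have ye: "y \<bullet> ?e \<le> norm y" for y
    using norm_cauchy_schwarz[of y ?e] by (simp add: norm_axis_1)
  \<comment> \<open>This null hyperplane contains the ray of the first axis vector, and outside it
    \<open>y $ 1\<close> is strictly smaller than |y|.\<close>
  have "negligible {y::real^3. y \<bullet> axis 2 1 = 0}"
    by (rule negligible_standard_hyperplane) (simp add: axis_in_Basis_iff)
  moreover have b: "{y::real^3. y \<bullet> axis 2 1 = 0} \<in> sets borel" by measurable
  ultimately have null: "{y::real^3. y \<bullet> axis 2 1 = 0} \<in> null_sets lborel"
    using null_sets_completion_iff[of "{y::real^3. y \<bullet> axis 2 1 = 0}" lborel]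
    by (simp add: negligible_iff_null_sets)
  have "(\<lambda>n. \<integral>\<^sup>+y. ennreal (ray_weight T (\<mu> n) ?e y) \<partial>lborel) \<longlonglongrightarrow> (\<integral>\<^sup>+(y::real^3). 0 \<partial>lborel)"
  proof (rule nn_integral_dominated_convergence)
    show "(\<integral>\<^sup>+(y::real^3). ennreal (indicator (cball 0 T) y / (norm y)\<^sup>2) \<partial>lborel) < \<infinity>"
      by (rule nn_integral_inverse_square_ball[OF T])
    show "AE y in lborel. ennreal (ray_weight T (\<mu> n) ?e y) \<le> ennreal (indicator (cball 0 T) y / (norm y)\<^sup>2)" for n
      using \<mu>(2)[of n] ye
      by (intro AE_I2 ennreal_leI) (auto simp: ray_weight_def indicator_def intro!: divide_right_mono)
    show "AE y in lborel. (\<lambda>n. ennreal (ray_weight T (\<mu> n) ?e y)) \<longlonglongrightarrow> 0"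
    proof (rule AE_I')
      show "{y \<in> space lborel. \<not> (\<lambda>n. ennreal (ray_weight T (\<mu> n) ?e y)) \<longlonglongrightarrow> 0} \<subseteq> {y. y \<bullet> axis 2 1 = 0}"
      proof (intro subsetI CollectI, rule ccontr)
        fix y :: "real^3"
        assume y: "y \<in> {y \<in> space lborel. \<not> (\<lambda>n. ennreal (ray_weight T (\<mu> n) ?e y)) \<longlonglongrightarrow> 0}"
          and "y \<bullet> axis 2 1 \<noteq> 0"
        then have "y $ 2 \<noteq> 0" by (simp add: inner_axis)
        then have "(y $ 1)\<^sup>2 < (\<Sum>k\<in>UNIV. (y $ k)\<^sup>2)" by (simp add: sum_3 add_pos_nonneg)
        also have "\<dots> = (norm y)\<^sup>2" by (simp add: norm_vec_def L2_set_def sum_nonneg)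
        finally have "y $ 1 < norm y" by (rule power2_less_imp_less) simp
        then have c: "norm y - y \<bullet> ?e > 0" by (simp add: inner_axis)
        have "filterlim (\<lambda>n. \<mu> n * (norm y - y \<bullet> ?e)) at_top sequentially"
          by (rule filterlim_at_top_mult_tendsto_pos[OF tendsto_const c \<mu>(1)])
        then have "filterlim (\<lambda>n. - (\<mu> n * (norm y - y \<bullet> ?e))) at_bot sequentially"
          by (simp add: filterlim_uminus_at_bot)
        then have "(\<lambda>n. exp (- (\<mu> n * (norm y - y \<bullet> ?e)))) \<longlonglongrightarrow> 0"
          by (rule filterlim_compose[OF exp_at_bot])
        then have "(\<lambda>n. indicator (cball 0 T) y / (norm y)\<^sup>2 * exp (- (\<mu> n * (norm y - y \<bullet> ?e))))
            \<longlonglongrightarrow> indicator (cball 0 T) y / (norm y)\<^sup>2 * 0"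
          by (intro tendsto_mult tendsto_const)
        then have "(\<lambda>n. ray_weight T (\<mu> n) ?e y) \<longlonglongrightarrow> 0" by (simp add: ray_weight_def)
        then have "(\<lambda>n. ennreal (ray_weight T (\<mu> n) ?e y)) \<longlonglongrightarrow> ennreal 0" by (rule tendsto_ennrealI)
        then show False using y by simp
      qed
    qed (rule null)
  qed measurable
  then show ?thesis by (simp add: ray_integral_def)
qed

section \<open>The decreasing weight and its gain under a shift\<close>

definition exp_weight :: "real \<Rightarrow> nat \<Rightarrow> real \<Rightarrow> real" where
  "exp_weight T n u = bump0 ((T - u) / real n)"

lemma exp_weight_nonneg: "exp_weight T n u \<ge> 0"
  by (simp add: exp_weight_def bump0_simps)

lemma exp_weight_le_1: "exp_weight T n u \<le> 1"
  by (simp add: exp_weight_def bump0_simps)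

lemma exp_weight_antimono: "u \<le> v \<Longrightarrow> exp_weight T n v \<le> exp_weight T n u"
  unfolding exp_weight_def by (intro bump0_mono divide_right_mono) auto

lemma exp_weight_eq_0: "u \<ge> T \<Longrightarrow> exp_weight T n u = 0"
  unfolding exp_weight_def by (intro bump0_simps) (simp add: divide_nonpos_nonneg)

lemma exp_weight_pos: "u < T \<Longrightarrow> n > 0 \<Longrightarrow> exp_weight T n u > 0"
  unfolding exp_weight_def by (intro bump0_simps) simp

lemma smooth_exp_weight: "smooth_fun (exp_weight T n)"
proof -
  have "smooth_fun (\<lambda>u. bump0 (- (1 / real n) * u + T / real n))"
    by (rule smooth_fun_compose[OF smooth_bump0 smooth_fun_affine])
  moreover have "exp_weight T n = (\<lambda>u. bump0 (- (1 / real n) * u + T / real n))"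
    by (auto simp: exp_weight_def diff_divide_distrib)
  ultimately show ?thesis by simp
qed

lemma exp_weight_measurable [measurable]: "exp_weight T n \<in> borel_measurable borel"
  by (intro borel_measurable_continuous_onI smooth_fun_continuous smooth_exp_weight)

text \<open>With a = T - u and b = a - L, the exponent drops by n/b - n/a = n L / (a b), and 0 < b
  \<le> a \<le> T bounds a b by T^2.\<close>

lemma exp_weight_shift:
  assumes "u \<ge> 0" "L \<ge> 0" "T > 0"
  shows "exp_weight T n (u + L) \<le> exp_weight T n u * exp (- (real n / T\<^sup>2 * L))"
proof (cases "u + L < T \<and> n > 0")
  case True
  define a where "a = T - u"
  define b where "b = T - u - L"
  have b: "0 < b" "b \<le> a" "a \<le> T" "b \<le> T" "L = a - b" using True assms by (auto simp: a_def b_def)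
  have ab: "a * b \<le> T\<^sup>2" using b assms by (simp add: power2_eq_square mult_mono)
  have "real n * (L / T\<^sup>2) \<le> real n * (L / (a * b))"
    using b ab assms by (intro mult_left_mono divide_left_mono) auto
  also have "\<dots> = real n / b - real n / a"
    unfolding \<open>L = a - b\<close> using b(1,2) by (simp add: field_simps)
  finally have "- (real n / b) \<le> - (real n / a) + - (real n / T\<^sup>2 * L)" by simp
  then have "exp (- (real n / b)) \<le> exp (- (real n / a)) * exp (- (real n / T\<^sup>2 * L))"
    by (simp flip: exp_add)
  moreover have "exp_weight T n (u + L) = exp (- (real n / b))" "exp_weight T n u = exp (- (real n / a))"
  proof -
    have "T - (u + L) = b" "T - u = a" "a > 0" "b > 0" "n > 0"
      using True b(1,2) by (simp_all add: a_def b_def)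
    then show "exp_weight T n (u + L) = exp (- (real n / b))" "exp_weight T n u = exp (- (real n / a))"
      by (simp_all add: exp_weight_def bump0_def)
  qed
  ultimately show ?thesis by simp
next
  case False
  \<comment> \<open>For n = 0 the convention for division by zero makes the weight vanish
    identically.\<close>
  then have "exp_weight T n (u + L) = 0"
    by (cases "n = 0") (simp_all add: exp_weight_def[of T 0] bump0_simps exp_weight_eq_0)
  then show ?thesis by (simp add: exp_weight_nonneg)
qed

text \<open>Since \<open>1/(|z| |x - z|) \<le> 1/|z|\<^sup>2 + 1/|x - z|\<^sup>2\<close> and
  \<open>|z| + |x - z| - |x| \<ge> |z| - z \<bullet> x/|x|\<close>, the exponential decay of the weight gains a
  factor that vanishes as \<open>n\<close> grows.\<close>

lemma two_centre_estimate:
  fixes x :: "real^3"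
  assumes T: "T > 0" and t: "t \<ge> 0"
  shows "(\<integral>\<^sup>+z. ennreal (exp_weight T n (t + norm (x - z) + norm z) / (norm z * norm (x - z))) \<partial>lborel)
    \<le> ennreal (exp_weight T n (t + norm x)) * (2 * ray_integral T (real n / T\<^sup>2))"
proof -
  define \<mu> where "\<mu> = real n / T\<^sup>2"
  \<comment> \<open>At x = 0 any unit vector serves: what counts is |e| = 1 and x \<bullet> e =
    |x|.\<close>
  define e where "e = (if x = 0 then axis 1 1 else x /\<^sub>R norm x)"
  have e: "norm e = 1" by (simp add: e_def norm_axis_1)
  have xe: "x \<bullet> e = norm x"
    by (simp add: e_def) (metis inner_commute norm_eq_sqrt_inner power2_norm_eq_inner dot_square_norm
        power2_eq_square nonzero_mult_div_cancel_left norm_eq_zero divide_inverse mult.commute)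
  define b where "b = exp_weight T n (t + norm x)"
  have b: "b \<ge> 0" by (simp add: b_def exp_weight_nonneg)
  \<comment> \<open>Where 0 is the nearer centre, the denominator is at least |z|^2. The other half
    of space follows by the reflection of z to x - z.\<close>
  have key: "exp_weight T n (t + norm (x - z) + norm z) / (norm z * norm (x - z))
      \<le> b * ray_weight T \<mu> e z" if "norm z \<le> norm (x - z)" for z
  proof (cases "z = 0 \<or> T \<le> t + norm (x - z) + norm z")
    case True
    then show ?thesis using b by (auto simp: exp_weight_eq_0 ray_weight_nonneg)
  next
    case False
    then have z: "norm z > 0" "norm z \<le> T"
      using t norm_ge_zero[of "x - z"] by (auto simp del: norm_ge_zero)
    have "(x - z) \<bullet> e \<le> norm (x - z)"
      using norm_cauchy_schwarz[of "x - z" e] e by simp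
    then have L: "norm z - z \<bullet> e \<le> norm (x - z) + norm z - norm x"
      by (simp add: inner_diff_left xe)
    have L0: "norm (x - z) + norm z - norm x \<ge> 0" using norm_triangle_ineq[of "x - z" z] by simp
    have "exp_weight T n (t + norm (x - z) + norm z)
        \<le> b * exp (- (\<mu> * (norm (x - z) + norm z - norm x)))"
      using exp_weight_shift[of "t + norm x" "norm (x - z) + norm z - norm x" T n] t T L0
      by (simp add: b_def \<mu>_def algebra_simps)
    also have "\<mu> * (norm z - z \<bullet> e) \<le> \<mu> * (norm (x - z) + norm z - norm x)"
      using L by (intro mult_left_mono) (auto simp: \<mu>_def)
    then have "b * exp (- (\<mu> * (norm (x - z) + norm z - norm x))) \<le> b * exp (- (\<mu> * (norm z - z \<bullet> e)))"
      using b by (intro mult_left_mono) auto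
    finally have w: "exp_weight T n (t + norm (x - z) + norm z) \<le> b * exp (- (\<mu> * (norm z - z \<bullet> e)))" .
    have "exp_weight T n (t + norm (x - z) + norm z) / (norm z * norm (x - z))
        \<le> b * exp (- (\<mu> * (norm z - z \<bullet> e))) / (norm z)\<^sup>2"
      using w z that b by (intro frac_le) (auto simp: power2_eq_square)
    then show ?thesis using z by (simp add: ray_weight_def)
  qed
  have bound: "exp_weight T n (t + norm (x - z) + norm z) / (norm z * norm (x - z))
      \<le> b * (ray_weight T \<mu> e z + ray_weight T \<mu> e (x - z))" for z
  proof (cases "norm z \<le> norm (x - z)")
    case True
    have "b * ray_weight T \<mu> e z \<le> b * (ray_weight T \<mu> e z + ray_weight T \<mu> e (x - z))"
      using b by (intro mult_left_mono) (auto simp: ray_weight_nonneg)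
    then show ?thesis using key[OF True] by linarith
  next
    case False
    then have "norm (x - z) \<le> norm (x - (x - z))" by simp
    from key[OF this] have "exp_weight T n (t + norm (x - z) + norm z) / (norm z * norm (x - z))
        \<le> b * ray_weight T \<mu> e (x - z)" by (simp add: algebra_simps)
    also have "\<dots> \<le> b * (ray_weight T \<mu> e z + ray_weight T \<mu> e (x - z))"
      using b by (intro mult_left_mono) (auto simp: ray_weight_nonneg)
    finally show ?thesis .
  qed
  have "(\<integral>\<^sup>+z. ennreal (exp_weight T n (t + norm (x - z) + norm z) / (norm z * norm (x - z))) \<partial>lborel)
    \<le> (\<integral>\<^sup>+z. ennreal b * (ennreal (ray_weight T \<mu> e z) + ennreal (ray_weight T \<mu> e (x - z))) \<partial>lborel)"
  proof (rule nn_integral_mono)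
    fix z
    show "ennreal (exp_weight T n (t + norm (x - z) + norm z) / (norm z * norm (x - z)))
      \<le> ennreal b * (ennreal (ray_weight T \<mu> e z) + ennreal (ray_weight T \<mu> e (x - z)))"
      using ennreal_leI[OF bound[of z]] b by (simp add: ennreal_mult' ennreal_plus ray_weight_nonneg)
  qed
  also have "\<dots> = ennreal b * (\<integral>\<^sup>+z. (ennreal (ray_weight T \<mu> e z) + ennreal (ray_weight T \<mu> e (x - z))) \<partial>lborel)"
    by (rule nn_integral_cmult) measurable
  also have "(\<integral>\<^sup>+z. (ennreal (ray_weight T \<mu> e z) + ennreal (ray_weight T \<mu> e (x - z))) \<partial>lborel)
     = (\<integral>\<^sup>+z. ennreal (ray_weight T \<mu> e z) \<partial>lborel) + (\<integral>\<^sup>+z. ennreal (ray_weight T \<mu> e (x - z)) \<partial>lborel)"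
    by (rule nn_integral_add) measurable
  also have "(\<integral>\<^sup>+z. ennreal (ray_weight T \<mu> e (x - z)) \<partial>lborel) = (\<integral>\<^sup>+z. ennreal (ray_weight T \<mu> e z) \<partial>lborel)"
    by (rule nn_integral_reflect) measurable
  also have "(\<integral>\<^sup>+z. ennreal (ray_weight T \<mu> e z) \<partial>lborel) = ray_integral T \<mu>"
    by (rule nn_integral_ray_weight[OF e])
  finally show ?thesis by (simp add: b_def \<mu>_def mult_2)
qed

section \<open>The weighted estimates\<close>

lemma deriv_zero_open:
  fixes \<rho> :: "real \<Rightarrow> real"
  assumes "open S" "x \<in> S" "\<And>y. y \<in> S \<Longrightarrow> \<rho> y = 0"
  shows "deriv \<rho> x = 0" "deriv (deriv \<rho>) x = 0"
proof -
  have d: "deriv f y = 0" if "y \<in> S" "\<And>y. y \<in> S \<Longrightarrow> f y = 0" for f :: "real \<Rightarrow> real" and y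
  proof (rule DERIV_imp_deriv)
    show "(f has_real_derivative 0) (at y)"
      by (rule has_field_derivative_transform_within_open[OF DERIV_const[of 0] assms(1) that(1)])
        (simp add: that(2))
  qed
  show "deriv \<rho> x = 0" by (rule d[OF assms(2,3)])
  show "deriv (deriv \<rho>) x = 0" by (rule d[OF assms(2)]) (rule d[OF _ assms(3)])
qed

section \<open>A time profile supported on one side of its centre\<close>

definition time_bump :: "real \<Rightarrow> real" where
  "time_bump u = bump0 (u + 1) * bump0 (- u)"

lemma smooth_time_bump: "smooth_fun time_bump"
  unfolding time_bump_def[abs_def]
  using smooth_fun_compose[OF smooth_bump0 smooth_fun_affine[of 1 1]]
      smooth_fun_compose[OF smooth_bump0 smooth_fun_affine[of "-1" 0]]
  by (intro smooth_fun_mult) simp_all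

lemma time_bump_measurable [measurable]: "time_bump \<in> borel_measurable borel"
  by (intro borel_measurable_continuous_onI smooth_fun_continuous smooth_time_bump)

lemma time_bump_nonneg: "time_bump u \<ge> 0"
  by (simp add: time_bump_def bump0_simps)

lemma time_bump_le_indicator: "time_bump u \<le> indicator {-1..0} u"
  using mult_mono[OF bump0_simps(4)[of "u + 1"] bump0_simps(4)[of "- u"]]
  by (auto simp: time_bump_def bump0_simps indicator_def)

lemma time_bump_eq_0: "u \<notin> {-1<..<0} \<Longrightarrow> time_bump u = 0"
  by (auto simp: time_bump_def bump0_simps)

lemma time_bump_pos: "-1 < u \<Longrightarrow> u < 0 \<Longrightarrow> time_bump u > 0"
  by (auto simp: time_bump_def intro!: mult_pos_pos bump0_simps)

text \<open>The substitution t = u - \<epsilon> \<tau> removes \<epsilon>, and the profile lies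
  below the indicator of an interval of length 1.\<close>

lemma nn_integral_time_bump_rescaled:
  assumes "\<epsilon> > 0"
  shows "(\<integral>\<^sup>+t. ennreal (time_bump ((u - t) / \<epsilon>) / \<epsilon>) \<partial>lborel) \<le> 1"
proof -
  have "(\<integral>\<^sup>+t. ennreal (time_bump ((u - t) / \<epsilon>) / \<epsilon>) \<partial>lborel)
     = ennreal \<bar>-\<epsilon>\<bar> * (\<integral>\<^sup>+t. ennreal (time_bump ((u - (u + (-\<epsilon>) * t)) / \<epsilon>) / \<epsilon>) \<partial>lborel)"
    using assms by (intro nn_integral_real_affine) auto
  also have "\<dots> = (\<integral>\<^sup>+t. ennreal \<bar>-\<epsilon>\<bar> * ennreal (time_bump ((u - (u + (-\<epsilon>) * t)) / \<epsilon>) / \<epsilon>) \<partial>lborel)"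
    by (rule nn_integral_cmult[symmetric]) measurable
  also have "\<dots> = (\<integral>\<^sup>+t. ennreal (time_bump t) \<partial>lborel)"
    using assms by (intro nn_integral_cong) (simp add: ennreal_mult'[symmetric])
  also have "\<dots> \<le> (\<integral>\<^sup>+t. ennreal (indicator {-1..0::real} t) \<partial>lborel)"
    by (intro nn_integral_mono) (rule ennreal_leI[OF time_bump_le_indicator])
  also have "\<dots> = 1" by (simp add: ennreal_indicator)
  finally show ?thesis .
qed

text \<open>The constant that the limit of the box kernels puts in front of \<open>w\<close>. The
  profile is not normalised; positivity of this constant is enough to divide by it.\<close>

definition bump_mass :: real where
  "bump_mass = (LINT q|(lborel::spacetime measure). 3 * time_bump (fst q) / unit_rdist (snd q) ^ 5)"

lemma bump_mass_pos: "bump_mass > 0"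
proof -
  let ?h = "\<lambda>q::spacetime. 3 * time_bump (fst q) / unit_rdist (snd q) ^ 5"
  have u: "unit_rdist y > 0" for y using unit_rdist_ge_1[of y] by linarith
  have nonneg: "?h q \<ge> 0" for q
    using time_bump_nonneg u[of "snd q"] by (intro divide_nonneg_nonneg) auto
  have int: "integrable lborel ?h"
  proof (rule Bochner_Integration.integrable_bound)
    show "integrable lborel (\<lambda>q::spacetime. 3 * (indicator {-1..0} (fst q) / unit_rdist (snd q) ^ 4))"
      by (intro integrable_mult_right integrable_time_unit_rdist)
    show "?h \<in> borel_measurable lborel"
      by (simp, subst borel_prod[symmetric]) measurable
    show "AE q in lborel. norm (?h q) \<le> norm (3 * (indicator {-1..0} (fst q) / unit_rdist (snd q) ^ 4))"
    proof (rule AE_I2)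
      fix q :: spacetime
      have "?h q \<le> 3 * indicator {-1..0} (fst q) / unit_rdist (snd q) ^ 4"
        using time_bump_le_indicator[of "fst q"] time_bump_nonneg[of "fst q"] unit_rdist_ge_1[of "snd q"]
        by (intro frac_le mult_left_mono power_increasing) auto
      then show "norm (?h q) \<le> norm (3 * (indicator {-1..0} (fst q) / unit_rdist (snd q) ^ 4))"
        using nonneg[of q] u[of "snd q"] by simp
    qed
  qed
  have "bump_mass \<ge> 0" unfolding bump_mass_def by (intro integral_nonneg_AE AE_I2 nonneg)
  moreover have "bump_mass \<noteq> 0"
  proof
    assume "bump_mass = 0"
    then have "AE q in lborel. ?h q = 0"
      unfolding bump_mass_def using int nonneg by (subst (asm) integral_nonneg_eq_0_iff_AE) auto
    \<comment> \<open>The integrand is positive on an open strip, and nonempty open sets are not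
      negligible.\<close>
    moreover have "?h q \<noteq> 0" if "q \<in> {-1<..<0} \<times> UNIV" for q
      using that time_bump_pos[of "fst q"] u[of "snd q"] by auto
    ultimately have "AE q in lborel. q \<notin> {-1<..<0::real} \<times> (UNIV::(real^3) set)"
      by (auto elim: eventually_mono)
    then have "{-1<..<0::real} \<times> (UNIV::(real^3) set) \<in> null_sets lborel"
      by (subst AE_iff_null_sets) (auto intro!: borel_open open_Times)
    then have "negligible ({-1<..<0::real} \<times> (UNIV::(real^3) set))"
      by (simp add: negligible_iff_null_sets null_sets_completionI)
    then show False
      using open_not_negligible[of "{-1<..<0::real} \<times> (UNIV::(real^3) set)"]
      by (auto simp: open_Times)
  qed
  ultimately show ?thesis by simp
qed

lemma cone_bounded:
  fixes g :: "spacetime \<Rightarrow> real"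
  assumes "continuous_on closed_light_cone g"
  obtains M where "M \<ge> 0" "\<And>p. p \<in> closed_light_cone \<Longrightarrow> fst p \<le> c \<Longrightarrow> \<bar>g p\<bar> \<le> M"
proof -
  let ?K = "closed_light_cone \<inter> {p. fst p \<le> c}"
  have "closed ?K"
    by (intro closed_Int closed_closed_light_cone closed_Collect_le continuous_intros)
  moreover have "?K \<subseteq> {0..c} \<times> cball 0 c"
  proof
    fix p assume "p \<in> ?K"
    then have "norm (snd p) \<le> fst p" "fst p \<le> c" by (auto simp: closed_light_cone_eq)
    moreover have "norm (snd p) \<ge> 0" by simp
    ultimately have "0 \<le> fst p" "norm (snd p) \<le> c" by linarith+
    then show "p \<in> {0..c} \<times> cball 0 c" using \<open>fst p \<le> c\<close> by (cases p) simp
  qed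
  moreover have "compact ({0..c} \<times> cball (0::real^3) c)" by (intro compact_Times) auto
  ultimately have "compact ?K" by (metis compact_Int_closed inf.absorb_iff2)
  then have "compact (g ` ?K)"
    using assms by (intro compact_continuous_image) (auto intro: continuous_on_subset)
  then obtain M where "\<forall>v\<in>g ` ?K. norm v \<le> M" using compact_imp_bounded bounded_iff by blast
  then have M: "\<bar>g p\<bar> \<le> M" if "p \<in> closed_light_cone" "fst p \<le> c" for p
    using that by simp
  show thesis
  proof (rule that[of "\<bar>M\<bar>"])
    fix p assume "p \<in> closed_light_cone" "fst p \<le> c"
    from M[OF this] show "\<bar>g p\<bar> \<le> \<bar>M\<bar>" by linarith
  qed simp
qed

text \<open>The time axis lies in the hyperplane where the first space coordinate vanishes.\<close>

lemma AE_snd_nonzero: "AE p::spacetime in lborel. snd p \<noteq> 0"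
proof -
  let ?H = "{p::spacetime. p \<bullet> (0, axis 1 1) = 0}"
  have "negligible ?H"
    by (rule negligible_standard_hyperplane) (simp add: Basis_prod_def axis_in_Basis_iff)
  moreover have "?H \<in> sets borel" by measurable
  ultimately have "?H \<in> null_sets lborel"
    using null_sets_completion_iff[of ?H lborel] by (simp add: negligible_iff_null_sets)
  then have "AE p in lborel. p \<notin> ?H" by (rule AE_not_in)
  then show ?thesis by eventually_elim (auto simp: inner_prod_def)
qed

section \<open>The two systems compared, and the limits of the tested identity\<close>

locale wave_pair =
  fixes T :: real
    and P1 P2 :: "real^3 \<Rightarrow> real^2^2"
    and U1 U2 :: "(spacetime functional)^2"
    and R1 R2 :: "spacetime \<Rightarrow> real^2"
  assumes T: "T > 0"
    and P1: "\<And>i j. smooth_fun (\<lambda>x. P1 x $ i $ j)"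
    and P2: "\<And>i j. smooth_fun (\<lambda>x. P2 x $ i $ j)"
    and U1: "solves_point_source_ivp P1 U1"
    and U2: "solves_point_source_ivp P2 U2"
    and R1: "is_regular_part P1 U1 R1"
    and R2: "is_regular_part P2 U2 R2"
    and P_le: "\<And>x i j. P1 x $ i $ j \<ge> P2 x $ i $ j"
    and R_eq: "\<And>t. 0 < t \<Longrightarrow> t \<le> T \<Longrightarrow> R1 (t, 0) = R2 (t, 0)"
begin

definition w :: "2 \<Rightarrow> spacetime \<Rightarrow> real" where
  "w i p = indicator light_cone_interior p * (R1 p $ i - R2 p $ i)"

definition f :: "2 \<Rightarrow> spacetime \<Rightarrow> real" where
  "f i p = indicator light_cone_interior p *
     (\<Sum>j\<in>UNIV. P1 (snd p) $ i $ j * R1 p $ j - P2 (snd p) $ i $ j * R2 p $ j)"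

definition Q :: "2 \<Rightarrow> real^3 \<Rightarrow> real" where
  "Q i x = (\<Sum>j\<in>UNIV. P1 x $ i $ j - P2 x $ i $ j)"

text \<open>Inside the cone and off the axis, this is the limit as \<delta> tends to 0 of the
  axis-centred test function with profile \<open>exp_weight T n\<close>.\<close>

definition pot :: "nat \<Rightarrow> spacetime \<Rightarrow> real" where
  "pot n p = exp_weight T n (fst p + norm (snd p)) / norm (snd p)"

lemma identity:
  assumes "\<delta> > 0" and "smooth_fun a" "\<And>u. u \<ge> A \<Longrightarrow> a u = 0"
  shows "(LINT p|lborel. w i p * box_kernel a \<delta> (rdist \<delta> z (snd p)) (fst p + rdist \<delta> z (snd p)))
    = (LINT p|lborel. f i p * (a (fst p + rdist \<delta> z (snd p)) / rdist \<delta> z (snd p)))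
      + (LINT x|lborel. Q i x * (a (norm x + rdist \<delta> z x) / rdist \<delta> z x) / (4 * pi * norm x))"
  using cone_test_identity[OF P1 P2 U1 U2 R1 R2 assms, where i=i and z=z]
  by (simp add: w_def f_def Q_def)

lemma continuous_R:
  "continuous_on closed_light_cone (\<lambda>p. R1 p $ j)" "continuous_on closed_light_cone (\<lambda>p. R2 p $ j)"
  using R1 R2 C1_up_to_cone_continuous
  by (auto simp: is_regular_part_def intro!: continuous_on_component)

lemma continuous_P:
  "continuous_on S (\<lambda>x. P1 x $ i $ j)" "continuous_on S (\<lambda>x. P2 x $ i $ j)"
  by (intro smooth_fun_continuous P1 P2)+

lemma continuous_P_snd:
  "continuous_on S (\<lambda>p::spacetime. P1 (snd p) $ i $ j)"
  "continuous_on S (\<lambda>p::spacetime. P2 (snd p) $ i $ j)"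
  by (intro smooth_fun_continuous smooth_fun_snd P1 P2)+

lemma cone_indicator_measurable:
  fixes g :: "spacetime \<Rightarrow> real"
  assumes "continuous_on closed_light_cone g"
  shows "(\<lambda>p. indicator light_cone_interior p * g p) \<in> borel_measurable borel"
proof -
  have "(\<lambda>p. indicator light_cone_interior p *\<^sub>R g p) \<in> borel_measurable borel"
    using open_light_cone_interior continuous_on_subset[OF assms light_cone_interior_subset]
    by (intro borel_measurable_continuous_on_indicator) auto
  then show ?thesis by simp
qed

lemma w_measurable [measurable]: "w i \<in> borel_measurable borel"
  unfolding w_def[abs_def] by (intro cone_indicator_measurable continuous_intros continuous_R)

lemma f_measurable [measurable]: "f i \<in> borel_measurable borel"
  unfolding f_def[abs_def]
  by (intro cone_indicator_measurable continuous_intros continuous_R continuous_P_snd)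

lemma continuous_Q: "continuous_on S (Q i)"
  unfolding Q_def[abs_def] by (intro continuous_intros continuous_P)

lemma Q_measurable [measurable]: "Q i \<in> borel_measurable borel"
  by (intro borel_measurable_continuous_onI continuous_Q)

lemma Q_nonneg: "Q i x \<ge> 0"
  unfolding Q_def by (intro sum_nonneg) (simp add: P_le)

lemma w_eq_0: "fst p \<le> 0 \<Longrightarrow> w i p = 0"
  using norm_ge_zero[of "snd p"] by (auto simp: w_def light_cone_interior_eq indicator_def simp del: norm_ge_zero)

lemma w_bounded:
  obtains M where "M \<ge> 0" "\<And>p. fst p \<le> c \<Longrightarrow> \<bar>w i p\<bar> \<le> M"
proof -
  have "continuous_on closed_light_cone (\<lambda>p. R1 p $ i - R2 p $ i)"
    by (intro continuous_intros continuous_R)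
  from cone_bounded[OF this, of c] obtain M where M: "M \<ge> 0"
    "\<And>p. p \<in> closed_light_cone \<Longrightarrow> fst p \<le> c \<Longrightarrow> \<bar>R1 p $ i - R2 p $ i\<bar> \<le> M" by blast
  have "\<bar>w i p\<bar> \<le> M" if "fst p \<le> c" for p
  proof (cases "p \<in> light_cone_interior")
    case True
    then have "p \<in> closed_light_cone" using light_cone_interior_subset by blast
    from M(2)[OF this that] True show ?thesis by (simp add: w_def)
  qed (use M(1) in \<open>simp add: w_def\<close>)
  then show thesis using that M(1) by blast
qed

lemma w_isCont:
  assumes "p \<in> light_cone_interior"
  shows "isCont (w i) p"
proof -
  have "continuous_on light_cone_interior (\<lambda>p. R1 p $ i - R2 p $ i)"
    by (intro continuous_intros continuous_on_subset[OF continuous_R(1)]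
        continuous_on_subset[OF continuous_R(2)] light_cone_interior_subset)
  then have "continuous_on light_cone_interior (w i)"
    by (rule continuous_on_eq) (simp add: w_def)
  then show ?thesis
    using assms open_light_cone_interior by (simp add: continuous_on_eq_continuous_at)
qed

lemma w_axis: "\<tau> \<le> T \<Longrightarrow> w i (\<tau>, 0) = 0"
  using R_eq[of \<tau>] by (auto simp: w_def light_cone_interior_eq indicator_def)

text \<open>Concentrating the profile near t0 while the spatial regularisation shrinks faster
  recovers \<open>w\<close> at an interior point, where it is continuous. The bump lives on phases
  below t0, so the integrand involves \<open>w\<close> only before time t0.\<close>

lemma tendsto_bump_mass:
  assumes p: "(t0, z) \<in> light_cone_interior"
  defines "\<epsilon> \<equiv> \<lambda>k::nat. 1 / real (Suc k)"
  shows "(\<lambda>k. LINT p|lborel. w i p * box_kernel (\<lambda>u. time_bump ((u - t0) / \<epsilon> k) / \<epsilon> k) ((\<epsilon> k)\<^sup>2)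
            (rdist ((\<epsilon> k)\<^sup>2) z (snd p)) (fst p + rdist ((\<epsilon> k)\<^sup>2) z (snd p)))
     \<longlonglongrightarrow> w i (t0, z) * bump_mass"
proof -
  obtain M where M: "M \<ge> 0" "\<And>p. fst p \<le> t0 \<Longrightarrow> \<bar>w i p\<bar> \<le> M" using w_bounded by blast
  have t0: "t0 > 0" using p norm_ge_zero[of z] by (simp add: light_cone_interior_def del: norm_ge_zero)
  have \<epsilon>: "\<epsilon> k > 0" "\<epsilon> k \<le> 1" for k by (auto simp: \<epsilon>_def)
  have \<epsilon>0: "\<epsilon> \<longlonglongrightarrow> 0" unfolding \<epsilon>_def by (rule LIMSEQ_Suc[OF lim_1_over_n])
  \<comment> \<open>With \<delta> = \<epsilon>^2 the ratio \<delta> / \<epsilon> is \<epsilon>,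
    whose square is exactly \<delta>: the borderline allowed by the domination in
    \<open>box_kernel_limit\<close>.\<close>
  have q: "(\<epsilon> k)\<^sup>2 / \<epsilon> k = \<epsilon> k" for k using \<epsilon>(1)[of k] by (simp add: power2_eq_square)
  have "(\<lambda>k. LINT p|lborel. w i p * box_kernel (\<lambda>u. time_bump ((u - t0) / \<epsilon> k) / \<epsilon> k) ((\<epsilon> k)\<^sup>2)
            (rdist ((\<epsilon> k)\<^sup>2) z (snd p)) (fst p + rdist ((\<epsilon> k)\<^sup>2) z (snd p)))
     \<longlonglongrightarrow> (LINT q|lborel. w i (t0, z) * (3 * time_bump (fst (q::spacetime)) / unit_rdist (snd q) ^ 5))"
  proof (rule box_kernel_limit[where M=M and Tm=t0 and lo="-1" and hi=0])
    show "(\<lambda>k. (\<epsilon> k)\<^sup>2) \<longlonglongrightarrow> 0" using tendsto_power[OF \<epsilon>0, of 2] by simp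
    show "(\<lambda>k. (\<epsilon> k)\<^sup>2 / \<epsilon> k) \<longlonglongrightarrow> 0" unfolding q by (rule \<epsilon>0)
    show "((\<epsilon> k)\<^sup>2 / \<epsilon> k)\<^sup>2 \<le> (\<epsilon> k)\<^sup>2" "(\<epsilon> k)\<^sup>2 / \<epsilon> k \<le> 1" for k unfolding q using \<epsilon> by auto
    show "0 < (\<epsilon> k)\<^sup>2" for k using \<epsilon>(1)[of k] by simp
    show "t0 + \<epsilon> k * \<tau> \<le> t0" if "\<tau> \<in> {-1..0}" for k \<tau>
      using that \<epsilon>(1)[of k] by (simp add: mult_nonneg_nonpos)
    show "(time_bump \<tau> = 0 \<and> deriv time_bump \<tau> = 0 \<and> deriv (deriv time_bump) \<tau> = 0) \<or>
        (\<forall>k. t0 + \<epsilon> k * \<tau> \<le> 0)" if "\<tau> \<notin> {-1..0}" for \<tau>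
    proof -
      have "time_bump y = 0" if "y \<in> - {-1..0}" for y
        using that by (intro time_bump_eq_0) auto
      then show ?thesis
        using deriv_zero_open[of "- {-1..0}" \<tau> time_bump] that by (simp add: open_Compl)
    qed
    show "(\<lambda>k. w i (t0 + \<epsilon> k * \<tau> - (\<epsilon> k)\<^sup>2 * unit_rdist y, z + (\<epsilon> k)\<^sup>2 *\<^sub>R y)) \<longlonglongrightarrow> w i (t0, z)" for \<tau> y
    proof (rule isCont_tendsto_compose[OF w_isCont[OF p]])
      have "(\<lambda>k. (t0 + \<epsilon> k * \<tau> - (\<epsilon> k)\<^sup>2 * unit_rdist y, z + (\<epsilon> k)\<^sup>2 *\<^sub>R y))
          \<longlonglongrightarrow> (t0 + 0 * \<tau> - 0\<^sup>2 * unit_rdist y, z + 0\<^sup>2 *\<^sub>R y)"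
        by (intro tendsto_intros \<epsilon>0)
      then show "(\<lambda>k. (t0 + \<epsilon> k * \<tau> - (\<epsilon> k)\<^sup>2 * unit_rdist y, z + (\<epsilon> k)\<^sup>2 *\<^sub>R y)) \<longlonglongrightarrow> (t0, z)" by simp
    qed
  qed (use \<epsilon> M w_eq_0 t0 smooth_time_bump in \<open>auto\<close>)
  then show ?thesis unfolding bump_mass_def by (simp only: integral_mult_right_zero)
qed

lemma tendsto_axis:
  \<comment> \<open>Here \<open>\<epsilon>\<close> is the spatial regularisation and the time scale
    is 1: a fixed profile lets the limit see the whole time axis. It is an integral of
    \<open>w i (\<tau>, 0)\<close> against the weight, where the first factor vanishes up to time T
    by the data and the second one afterwards.\<close>
  fixes n :: nat
  defines "\<epsilon> \<equiv> \<lambda>k::nat. 1 / real (Suc k)"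
  shows "(\<lambda>k. LINT p|lborel. w i p * box_kernel (exp_weight T n) (\<epsilon> k)
            (rdist (\<epsilon> k) 0 (snd p)) (fst p + rdist (\<epsilon> k) 0 (snd p))) \<longlonglongrightarrow> 0"
proof -
  obtain M where M: "M \<ge> 0" "\<And>p. fst p \<le> T \<Longrightarrow> \<bar>w i p\<bar> \<le> M" using w_bounded by blast
  have \<epsilon>: "\<epsilon> k > 0" "\<epsilon> k \<le> 1" for k by (auto simp: \<epsilon>_def)
  have \<epsilon>0: "\<epsilon> \<longlonglongrightarrow> 0" unfolding \<epsilon>_def by (rule LIMSEQ_Suc[OF lim_1_over_n])
  have m: "(\<lambda>\<tau>. w i (\<tau>, 0)) \<in> borel_measurable borel"
    by (rule measurable_compose[OF _ w_measurable])
      (auto intro!: borel_measurable_continuous_onI continuous_intros)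
  have "(\<lambda>k. LINT p|lborel. w i p * box_kernel (\<lambda>u. exp_weight T n ((u - 0) / 1) / 1) (\<epsilon> k)
            (rdist (\<epsilon> k) 0 (snd p)) (fst p + rdist (\<epsilon> k) 0 (snd p)))
     \<longlonglongrightarrow> (LINT q|lborel. w i (fst q, 0) * (3 * exp_weight T n (fst (q::spacetime)) / unit_rdist (snd q) ^ 5))"
  proof (rule box_kernel_limit[where M=M and Tm=T and lo=0 and hi=T and W="\<lambda>\<tau>. w i (\<tau>, 0)"])
    show "(\<epsilon> k / 1)\<^sup>2 \<le> \<epsilon> k" for k
      using \<epsilon>[of k] by (simp add: power2_eq_square mult_left_le)
    \<comment> \<open>Beyond T the weight vanishes with its derivatives; before time 0 it does not,
      but there \<open>w\<close> does.\<close>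
    show "(exp_weight T n \<tau> = 0 \<and> deriv (exp_weight T n) \<tau> = 0 \<and> deriv (deriv (exp_weight T n)) \<tau> = 0) \<or>
        (\<forall>k::nat. 0 + 1 * \<tau> \<le> 0)" if "\<tau> \<notin> {0..T}" for \<tau>
      using deriv_zero_open[of "{T<..}" \<tau> "exp_weight T n"] that exp_weight_eq_0[of T _ n] by auto
    show "(\<lambda>k. w i (0 + 1 * \<tau> - \<epsilon> k * unit_rdist y, 0 + \<epsilon> k *\<^sub>R y)) \<longlonglongrightarrow> w i (\<tau>, 0)" for \<tau> y
    proof (cases "\<tau> > 0")
      case True
      then have p: "(\<tau>, 0) \<in> light_cone_interior" by (simp add: light_cone_interior_def)
      show ?thesis
      proof (rule isCont_tendsto_compose[OF w_isCont[OF p]])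
        have "(\<lambda>k. (\<tau> - \<epsilon> k * unit_rdist y, \<epsilon> k *\<^sub>R y)) \<longlonglongrightarrow> (\<tau> - 0 * unit_rdist y, 0 *\<^sub>R y)"
          by (intro tendsto_intros \<epsilon>0)
        then show "(\<lambda>k. (0 + 1 * \<tau> - \<epsilon> k * unit_rdist y, 0 + \<epsilon> k *\<^sub>R y)) \<longlonglongrightarrow> (\<tau>, 0)" by simp
      qed
    next
      case False
      have "\<epsilon> k * unit_rdist y \<ge> 0" for k
        using \<epsilon>(1)[of k] unit_rdist_ge_1[of y] by simp
      then have "w i (0 + 1 * \<tau> - \<epsilon> k * unit_rdist y, 0 + \<epsilon> k *\<^sub>R y) = 0" for k
        using False order_trans[of \<tau> 0 "\<epsilon> k * unit_rdist y"] by (intro w_eq_0) simp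
      then show ?thesis using False by (simp add: w_eq_0)
    qed
  qed (use \<epsilon> M w_eq_0 T smooth_exp_weight \<epsilon>0 m in auto)
  moreover have z: "w i (fst q, 0) * (3 * exp_weight T n (fst q) / unit_rdist (snd q) ^ 5) = 0" for q :: spacetime
    by (cases "fst q \<le> T") (auto simp: w_axis exp_weight_eq_0)
  ultimately show ?thesis unfolding z by simp
qed

end

text \<open>A function that is not integrable has Bochner integral 0, so estimates can move into
  \<open>ennreal\<close> before integrability is settled.\<close>

lemma abs_integral_le_nn_integral:
  fixes g :: "'a \<Rightarrow> real"
  shows "ennreal \<bar>integral\<^sup>L M g\<bar> \<le> (\<integral>\<^sup>+x. ennreal \<bar>g x\<bar> \<partial>M)"
proof (cases "integrable M g")
  case True
  from integral_norm_bound_ennreal[OF this] show ?thesis by simp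
qed (simp add: not_integrable_integral_eq)

text \<open>The regularisation \<open>\<delta> = \<epsilon>\<^sup>2\<close> is much finer than the time scale \<open>\<epsilon>\<close>, so that the terms of
  \<open>box_kernel\<close> with derivatives of the profile vanish in the limit.\<close>

definition probe :: "nat \<Rightarrow> spacetime \<Rightarrow> spacetime \<Rightarrow> real" where
  "probe k p q = time_bump ((fst q + rdist ((1 / real (Suc k))\<^sup>2) (snd p) (snd q) - fst p) / (1 / real (Suc k)))
      / (1 / real (Suc k)) / rdist ((1 / real (Suc k))\<^sup>2) (snd p) (snd q)"

lemma probe_nonneg: "probe k p q \<ge> 0"
  using rdist_pos[of "(1 / real (Suc k))\<^sup>2" "snd p" "snd q"]
  unfolding probe_def by (intro divide_nonneg_nonneg time_bump_nonneg) auto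

lemma continuous_probe:
  assumes "continuous_on S g" "continuous_on S h"
  shows "continuous_on S (\<lambda>r. probe k (g r) (h r))"
proof -
  have tb: "continuous_on UNIV time_bump" by (intro smooth_fun_continuous smooth_time_bump)
  have r: "rdist ((1 / real (Suc k))\<^sup>2) z x \<noteq> 0" for z x
    using rdist_pos[of "(1 / real (Suc k))\<^sup>2" z x] by simp
  have rc: "continuous_on S (\<lambda>r. rdist ((1 / real (Suc k))\<^sup>2) (snd (g r)) (snd (h r)))"
    by (intro continuous_on_rdist continuous_on_const continuous_on_snd assms)
  have "continuous_on S (\<lambda>r. (fst (h r) + rdist ((1 / real (Suc k))\<^sup>2) (snd (g r)) (snd (h r)) - fst (g r)) / (1 / real (Suc k)))"
    by (intro continuous_on_divide continuous_on_add continuous_on_diff continuous_on_const rc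
        continuous_on_fst assms) auto
  from continuous_on_compose2[OF tb this] show ?thesis
    unfolding probe_def using r by (intro continuous_on_divide continuous_on_const rc) auto
qed

lemma probe_measurable [measurable]:
  "(\<lambda>r. probe k (fst r) (snd r)) \<in> borel_measurable (borel \<Otimes>\<^sub>M borel)"
  unfolding borel_prod
  by (intro borel_measurable_continuous_onI continuous_probe continuous_intros)

lemma probe_measurable_sphere [measurable]:
  "(\<lambda>r. probe k (fst r) (norm (snd r), snd r)) \<in> borel_measurable (borel \<Otimes>\<^sub>M borel)"
  unfolding borel_prod
  by (intro borel_measurable_continuous_onI continuous_probe continuous_intros)

section \<open>The estimate off the axis, averaged over all centres\<close>

context wave_pair
begin

lemma pot_nonneg: "pot n p \<ge> 0"
  by (simp add: pot_def exp_weight_nonneg)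

lemma pot_measurable [measurable]: "pot n \<in> borel_measurable borel"
  unfolding pot_def[abs_def] by (subst borel_prod[symmetric]) measurable

lemma cone_weight_measurable:
  "(\<lambda>q::spacetime. exp_weight T n (fst q + norm (snd q))) \<in> borel_measurable borel"
  by (intro borel_measurable_continuous_onI
      continuous_on_compose2[OF smooth_fun_continuous[OF smooth_exp_weight, of UNIV]] continuous_intros)
    simp

text \<open>The bump is supported in \<open>[-1, 0]\<close>, so it only looks forward in time, where the weight is
  smaller; hence no error term arises.\<close>

lemma nn_integral_probe_pot:
  assumes q: "fst q \<ge> 0"
  shows "(\<integral>\<^sup>+p. ennreal (probe k p q * pot n p) \<partial>lborel)
    \<le> ennreal (exp_weight T n (fst q + norm (snd q))) * (2 * ray_integral T (real n / T\<^sup>2))"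
proof -
  obtain t x where tx: "q = (t, x)" by (cases q)
  define \<epsilon> where "\<epsilon> = 1 / real (Suc k)"
  have \<epsilon>: "\<epsilon> > 0" by (simp add: \<epsilon>_def)
  have m: "(\<lambda>p. probe k p q) \<in> borel_measurable borel"
    by (intro borel_measurable_continuous_onI continuous_probe continuous_intros)
  have "(\<integral>\<^sup>+p. ennreal (probe k p q * pot n p) \<partial>lborel)
      = (\<integral>\<^sup>+z. \<integral>\<^sup>+t0. ennreal (probe k (t0, z) q * pot n (t0, z)) \<partial>lborel \<partial>lborel)"
    by (intro nn_integral_spacetime measurable_compose[OF _ measurable_ennreal] borel_measurable_times
        m pot_measurable)
  also have "\<dots> \<le> (\<integral>\<^sup>+z. ennreal (exp_weight T n (t + norm (x - z) + norm z) / (norm z * norm (x - z))) \<partial>lborel)"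
  proof (rule nn_integral_mono_AE)
    show "AE z in lborel. (\<integral>\<^sup>+t0. ennreal (probe k (t0, z) q * pot n (t0, z)) \<partial>lborel)
        \<le> ennreal (exp_weight T n (t + norm (x - z) + norm z) / (norm z * norm (x - z)))"
      \<comment> \<open>At z = x the right side is 0 by the convention for division by zero, so this
        centre has to be excluded.\<close>
      using AE_lborel_singleton[of x]
    proof eventually_elim
      case (elim z)
      define s where "s = rdist (\<epsilon>\<^sup>2) z x"
      define c where "c = exp_weight T n (t + norm (x - z) + norm z) / (norm z * norm (x - z))"
      have c: "c \<ge> 0" by (simp add: c_def exp_weight_nonneg)
      have s: "0 < norm (x - z)" "norm (x - z) \<le> s" using elim rdist_ge by (auto simp: s_def)
      have "probe k (t0, z) q * pot n (t0, z) \<le> time_bump ((t + s - t0) / \<epsilon>) / \<epsilon> * c" for t0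
      proof (cases "time_bump ((t + s - t0) / \<epsilon>) = 0")
        case True
        then show ?thesis by (simp add: probe_def tx \<epsilon>_def s_def)
      next
        case False
        then have "(t + s - t0) / \<epsilon> < 0" using time_bump_eq_0 by fastforce
        then have "t0 \<ge> t + s" using \<epsilon> by (simp add: divide_less_0_iff)
        then have "exp_weight T n (t0 + norm z) \<le> exp_weight T n (t + norm (x - z) + norm z)"
          using s by (intro exp_weight_antimono) simp
        then have "exp_weight T n (t0 + norm z) / norm z / s
            \<le> exp_weight T n (t + norm (x - z) + norm z) / norm z / norm (x - z)"
          using s by (intro frac_le divide_right_mono divide_nonneg_nonneg exp_weight_nonneg) auto
        then have "time_bump ((t + s - t0) / \<epsilon>) / \<epsilon> * (exp_weight T n (t0 + norm z) / norm z / s)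
          \<le> time_bump ((t + s - t0) / \<epsilon>) / \<epsilon> * c"
          using \<epsilon> time_bump_nonneg by (intro mult_left_mono) (auto simp: c_def)
        then show ?thesis by (simp add: probe_def pot_def tx \<epsilon>_def s_def mult_ac)
      qed
      then have "(\<integral>\<^sup>+t0. ennreal (probe k (t0, z) q * pot n (t0, z)) \<partial>lborel)
          \<le> (\<integral>\<^sup>+t0. ennreal (time_bump ((t + s - t0) / \<epsilon>) / \<epsilon> * c) \<partial>lborel)"
        by (intro nn_integral_mono ennreal_leI)
      also have "\<dots> = (\<integral>\<^sup>+t0. ennreal (time_bump ((t + s - t0) / \<epsilon>) / \<epsilon>) * ennreal c \<partial>lborel)"
        using c \<epsilon> by (intro nn_integral_cong) (simp add: ennreal_mult time_bump_nonneg del: times_divide_eq_left)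
      also have "\<dots> = (\<integral>\<^sup>+t0. ennreal (time_bump ((t + s - t0) / \<epsilon>) / \<epsilon>) \<partial>lborel) * ennreal c"
        by (rule nn_integral_multc) measurable
      also have "\<dots> \<le> 1 * ennreal c"
        by (intro mult_right_mono nn_integral_time_bump_rescaled \<epsilon>) simp
      finally show ?case by (simp add: c_def)
    qed
  qed
  also have "\<dots> \<le> ennreal (exp_weight T n (t + norm x)) * (2 * ray_integral T (real n / T\<^sup>2))"
    using q by (intro two_centre_estimate T) (simp add: tx)
  finally show ?thesis by (simp add: tx)
qed

text \<open>The right side of \<open>identity\<close> for a probe centred at \<open>p\<close>, with
  the absolute value taken under the integral. The surface term is unchanged by this, since Q and
  the probe are nonnegative.\<close>

definition probe_mass :: "2 \<Rightarrow> nat \<Rightarrow> spacetime \<Rightarrow> ennreal" where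
  "probe_mass i k p = (\<integral>\<^sup>+q. ennreal (\<bar>f i q\<bar> * probe k p q) \<partial>lborel)
     + (\<integral>\<^sup>+x. ennreal (Q i x / (4 * pi * norm x) * probe k p (norm x, x)) \<partial>lborel)"

text \<open>The left side of \<open>identity\<close> converges, the right side is merely estimated
  from above; hence a lower limit, in the form that Fatou's lemma takes.\<close>

lemma w_le_liminf_probe_mass:
  assumes c: "c \<ge> 0"
  shows "ennreal (\<bar>w i p\<bar> * bump_mass * c) \<le> liminf (\<lambda>k. probe_mass i k p * ennreal c)"
proof (cases "p \<in> light_cone_interior")
  case False
  then show ?thesis by (simp add: w_def)
next
  case True
  obtain t0 z where p: "p = (t0, z)" by (cases p)
  define \<epsilon> where "\<epsilon> k = 1 / real (Suc k)" for k
  define L where "L k = (LINT p|lborel. w i p * box_kernel (\<lambda>u. time_bump ((u - t0) / \<epsilon> k) / \<epsilon> k) ((\<epsilon> k)\<^sup>2)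
            (rdist ((\<epsilon> k)\<^sup>2) z (snd p)) (fst p + rdist ((\<epsilon> k)\<^sup>2) z (snd p)))" for k
  have \<epsilon>: "\<epsilon> k > 0" for k by (simp add: \<epsilon>_def)
  have lim: "L \<longlonglongrightarrow> w i p * bump_mass"
    using tendsto_bump_mass[of t0 z i] True by (simp add: p L_def[abs_def] \<epsilon>_def)
  have bound: "ennreal \<bar>L k\<bar> \<le> probe_mass i k p" for k
  proof -
    let ?a = "\<lambda>u. time_bump ((u - t0) / \<epsilon> k) / \<epsilon> k"
    have sm: "smooth_fun ?a"
      using smooth_fun_mult[OF smooth_fun_compose[OF smooth_time_bump smooth_fun_affine[of "1/\<epsilon> k" "- t0/\<epsilon> k"]]
          smooth_fun_const[of "1/\<epsilon> k"]] by (simp add: diff_divide_distrib)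
    have z0: "?a u = 0" if "u \<ge> t0" for u
    proof -
      have "(u - t0) / \<epsilon> k \<ge> 0" using that \<epsilon>[of k] by simp
      then have "(u - t0) / \<epsilon> k \<notin> {-1<..<0}" by simp
      then show ?thesis by (simp add: time_bump_eq_0)
    qed
    have "L k = (LINT q|lborel. f i q * probe k p q) + (LINT x|lborel. Q i x * probe k p (norm x, x) / (4 * pi * norm x))"
      unfolding L_def using identity[OF _ sm z0, where \<delta>="(\<epsilon> k)\<^sup>2" and i=i and z=z] \<epsilon>[of k]
      by (simp add: probe_def p \<epsilon>_def)
    then have "ennreal \<bar>L k\<bar> \<le> ennreal (\<bar>LINT q|lborel. f i q * probe k p q\<bar>
        + \<bar>LINT x|lborel. Q i x * probe k p (norm x, x) / (4 * pi * norm x)\<bar>)"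
      by (intro ennreal_leI) linarith
    also have "\<dots> = ennreal \<bar>LINT q|lborel. f i q * probe k p q\<bar>
        + ennreal \<bar>LINT x|lborel. Q i x * probe k p (norm x, x) / (4 * pi * norm x)\<bar>"
      by simp
    also have "\<dots> \<le> (\<integral>\<^sup>+q. ennreal \<bar>f i q * probe k p q\<bar> \<partial>lborel)
        + (\<integral>\<^sup>+x. ennreal \<bar>Q i x * probe k p (norm x, x) / (4 * pi * norm x)\<bar> \<partial>lborel)"
      by (intro add_mono abs_integral_le_nn_integral)
    also have "\<dots> = probe_mass i k p"
      by (simp add: probe_mass_def abs_mult probe_nonneg Q_nonneg)
    finally show ?thesis .
  qed
  have "(\<lambda>k. ennreal (\<bar>L k\<bar> * c)) \<longlonglongrightarrow> ennreal (\<bar>w i p * bump_mass\<bar> * c)"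
    by (intro tendsto_ennrealI tendsto_intros lim)
  then have "ennreal (\<bar>w i p * bump_mass\<bar> * c) = liminf (\<lambda>k. ennreal (\<bar>L k\<bar> * c))"
    by (intro lim_imp_Liminf[symmetric]) auto
  also have "\<dots> \<le> liminf (\<lambda>k. probe_mass i k p * ennreal c)"
    using bound c by (intro Liminf_mono always_eventually allI) (simp add: ennreal_mult mult_right_mono)
  finally show ?thesis using bump_mass_pos by (simp add: abs_mult)
qed

lemma probe_mass_measurable [measurable]: "probe_mass i k \<in> borel_measurable borel"
proof -
  have 1: "(\<lambda>(p, q). ennreal (\<bar>f i q\<bar> * probe k p q)) \<in> borel_measurable (borel \<Otimes>\<^sub>M lborel)"
    unfolding split_beta' by measurable
  have 2: "(\<lambda>(p, x). ennreal (Q i x / (4 * pi * norm x) * probe k p (norm x, x))) \<in> borel_measurable (borel \<Otimes>\<^sub>M lborel)"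
    unfolding split_beta' by measurable
  show ?thesis
    unfolding probe_mass_def[abs_def]
    using lborel.borel_measurable_nn_integral[OF 1] lborel.borel_measurable_nn_integral[OF 2]
    by measurable
qed

text \<open>Tonelli: integrating over the centre \<open>p\<close> first turns the probe into the
  two-centre integral, whose bound \<open>\<eta> n\<close> is independent of \<open>k\<close>. At a
  point of the surface the time is |x|, so the weight is evaluated at 2|x|.\<close>

lemma nn_integral_probe_mass:
  defines "\<eta> \<equiv> \<lambda>n. 2 * ray_integral T (real n / T\<^sup>2)"
  shows "(\<integral>\<^sup>+p. probe_mass i k p * ennreal (pot n p) \<partial>lborel)
    \<le> (\<integral>\<^sup>+q. ennreal (\<bar>f i q\<bar> * exp_weight T n (fst q + norm (snd q))) \<partial>lborel) * \<eta> n
      + (\<integral>\<^sup>+x. ennreal (Q i x / (4 * pi * norm x) * exp_weight T n (2 * norm x)) \<partial>lborel) * \<eta> n"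
proof -
  have m1: "(\<lambda>(p, q). ennreal (\<bar>f i q\<bar>) * ennreal (probe k p q * pot n p)) \<in> borel_measurable (lborel \<Otimes>\<^sub>M lborel)"
    unfolding split_beta' by measurable
  have m2: "(\<lambda>(p, x). ennreal (Q i x / (4 * pi * norm x)) * ennreal (probe k p (norm x, x) * pot n p))
      \<in> borel_measurable (lborel \<Otimes>\<^sub>M lborel)"
    unfolding split_beta' by measurable
  have a1: "(\<integral>\<^sup>+q. ennreal (\<bar>f i q\<bar> * probe k p q) \<partial>lborel) * ennreal (pot n p)
     = (\<integral>\<^sup>+q. ennreal \<bar>f i q\<bar> * ennreal (probe k p q * pot n p) \<partial>lborel)" for p
  proof -
    have "(\<lambda>q. ennreal (\<bar>f i q\<bar> * probe k p q)) \<in> borel_measurable lborel"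
    proof -
      have "(\<lambda>q. probe k p q) \<in> borel_measurable borel"
        by (intro borel_measurable_continuous_onI continuous_probe continuous_intros)
      then show ?thesis by simp
    qed
    then show ?thesis
      by (subst nn_integral_multc[symmetric])
        (auto intro!: nn_integral_cong simp: ennreal_mult probe_nonneg pot_nonneg mult.assoc)
  qed
  have a2: "(\<integral>\<^sup>+x. ennreal (Q i x / (4 * pi * norm x) * probe k p (norm x, x)) \<partial>lborel) * ennreal (pot n p)
     = (\<integral>\<^sup>+x. ennreal (Q i x / (4 * pi * norm x)) * ennreal (probe k p (norm x, x) * pot n p) \<partial>lborel)" for p
  proof -
    have "(\<lambda>x. ennreal (Q i x / (4 * pi * norm x) * probe k p (norm x, x))) \<in> borel_measurable lborel"
    proof -
      have "(\<lambda>x. probe k p (norm x, x)) \<in> borel_measurable borel"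
        by (intro borel_measurable_continuous_onI continuous_probe continuous_intros)
      then show ?thesis by simp
    qed
    then show ?thesis
      by (subst nn_integral_multc[symmetric])
        (auto intro!: nn_integral_cong simp: ennreal_mult probe_nonneg pot_nonneg Q_nonneg mult.assoc
          simp del: times_divide_eq_left)
  qed
  have n1: "(\<lambda>p. \<integral>\<^sup>+q. ennreal \<bar>f i q\<bar> * ennreal (probe k p q * pot n p) \<partial>lborel) \<in> borel_measurable lborel"
    using lborel.borel_measurable_nn_integral[OF m1] by simp
  have n2: "(\<lambda>p. \<integral>\<^sup>+x. ennreal (Q i x / (4 * pi * norm x)) * ennreal (probe k p (norm x, x) * pot n p) \<partial>lborel)
      \<in> borel_measurable lborel"
    using lborel.borel_measurable_nn_integral[OF m2] by simp
  have "(\<integral>\<^sup>+p. probe_mass i k p * ennreal (pot n p) \<partial>lborel)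
     = (\<integral>\<^sup>+p. (\<integral>\<^sup>+q. ennreal \<bar>f i q\<bar> * ennreal (probe k p q * pot n p) \<partial>lborel)
        + (\<integral>\<^sup>+x. ennreal (Q i x / (4 * pi * norm x)) * ennreal (probe k p (norm x, x) * pot n p) \<partial>lborel) \<partial>lborel)"
    unfolding probe_mass_def distrib_right a1 a2 ..
  also have "\<dots> = (\<integral>\<^sup>+p. \<integral>\<^sup>+q. ennreal \<bar>f i q\<bar> * ennreal (probe k p q * pot n p) \<partial>lborel \<partial>lborel)
     + (\<integral>\<^sup>+p. \<integral>\<^sup>+x. ennreal (Q i x / (4 * pi * norm x)) * ennreal (probe k p (norm x, x) * pot n p) \<partial>lborel \<partial>lborel)"
    by (rule nn_integral_add[OF n1 n2])
  also have "(\<integral>\<^sup>+p. \<integral>\<^sup>+q. ennreal \<bar>f i q\<bar> * ennreal (probe k p q * pot n p) \<partial>lborel \<partial>lborel)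
     = (\<integral>\<^sup>+q. \<integral>\<^sup>+p. ennreal \<bar>f i q\<bar> * ennreal (probe k p q * pot n p) \<partial>lborel \<partial>lborel)"
    using lborel_pair.Fubini'[OF m1] by simp
  also have "(\<integral>\<^sup>+p. \<integral>\<^sup>+x. ennreal (Q i x / (4 * pi * norm x)) * ennreal (probe k p (norm x, x) * pot n p) \<partial>lborel \<partial>lborel)
     = (\<integral>\<^sup>+x. \<integral>\<^sup>+p. ennreal (Q i x / (4 * pi * norm x)) * ennreal (probe k p (norm x, x) * pot n p) \<partial>lborel \<partial>lborel)"
    using lborel_pair.Fubini'[OF m2] by simp
  also have "(\<integral>\<^sup>+q. \<integral>\<^sup>+p. ennreal \<bar>f i q\<bar> * ennreal (probe k p q * pot n p) \<partial>lborel \<partial>lborel)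
     \<le> (\<integral>\<^sup>+q. ennreal (\<bar>f i q\<bar> * exp_weight T n (fst q + norm (snd q))) * \<eta> n \<partial>lborel)"
  proof (rule nn_integral_mono)
    fix q :: spacetime
    show "(\<integral>\<^sup>+p. ennreal \<bar>f i q\<bar> * ennreal (probe k p q * pot n p) \<partial>lborel)
      \<le> ennreal (\<bar>f i q\<bar> * exp_weight T n (fst q + norm (snd q))) * \<eta> n"
    proof (cases "fst q \<ge> 0")
      case True
      have "(\<lambda>p. probe k p q * pot n p) \<in> borel_measurable borel"
        by (intro borel_measurable_times pot_measurable borel_measurable_continuous_onI
            continuous_probe continuous_intros)
      then have m: "(\<lambda>p. ennreal (probe k p q * pot n p)) \<in> borel_measurable lborel"
        by simp
      have "(\<integral>\<^sup>+p. ennreal \<bar>f i q\<bar> * ennreal (probe k p q * pot n p) \<partial>lborel)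
         = ennreal \<bar>f i q\<bar> * (\<integral>\<^sup>+p. ennreal (probe k p q * pot n p) \<partial>lborel)"
        by (rule nn_integral_cmult[OF m])
      also have "\<dots> \<le> ennreal \<bar>f i q\<bar> * (ennreal (exp_weight T n (fst q + norm (snd q))) * \<eta> n)"
        unfolding \<eta>_def by (intro mult_left_mono nn_integral_probe_pot True) simp
      finally show ?thesis by (simp add: ennreal_mult exp_weight_nonneg mult.assoc)
    next
      case False
      then have "f i q = 0"
        using norm_ge_zero[of "snd q"] by (auto simp: f_def light_cone_interior_eq indicator_def simp del: norm_ge_zero)
      then show ?thesis by simp
    qed
  qed
  also have "(\<integral>\<^sup>+x. \<integral>\<^sup>+p. ennreal (Q i x / (4 * pi * norm x)) * ennreal (probe k p (norm x, x) * pot n p) \<partial>lborel \<partial>lborel)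
     \<le> (\<integral>\<^sup>+x. ennreal (Q i x / (4 * pi * norm x) * exp_weight T n (2 * norm x)) * \<eta> n \<partial>lborel)"
  proof (rule nn_integral_mono)
    fix x :: "real^3"
    have "(\<lambda>p. probe k p (norm x, x) * pot n p) \<in> borel_measurable borel"
      by (intro borel_measurable_times pot_measurable borel_measurable_continuous_onI
          continuous_probe continuous_intros)
    then have m: "(\<lambda>p. ennreal (probe k p (norm x, x) * pot n p)) \<in> borel_measurable lborel"
      by simp
    have "(\<integral>\<^sup>+p. ennreal (Q i x / (4 * pi * norm x)) * ennreal (probe k p (norm x, x) * pot n p) \<partial>lborel)
       = ennreal (Q i x / (4 * pi * norm x)) * (\<integral>\<^sup>+p. ennreal (probe k p (norm x, x) * pot n p) \<partial>lborel)"
      by (rule nn_integral_cmult[OF m])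
    also have "\<dots> \<le> ennreal (Q i x / (4 * pi * norm x)) * (ennreal (exp_weight T n (2 * norm x)) * \<eta> n)"
    proof (rule mult_left_mono)
      have e: "norm x + norm x = 2 * norm x" by simp
      show "(\<integral>\<^sup>+p. ennreal (probe k p (norm x, x) * pot n p) \<partial>lborel)
          \<le> ennreal (exp_weight T n (2 * norm x)) * \<eta> n"
        using nn_integral_probe_pot[of "(norm x, x)" k n, unfolded fst_conv snd_conv e, OF norm_ge_zero]
        unfolding \<eta>_def .
    qed simp
    finally show "(\<integral>\<^sup>+p. ennreal (Q i x / (4 * pi * norm x)) * ennreal (probe k p (norm x, x) * pot n p) \<partial>lborel)
       \<le> ennreal (Q i x / (4 * pi * norm x) * exp_weight T n (2 * norm x)) * \<eta> n"
      using Q_nonneg[of i x] by (simp add: ennreal_mult exp_weight_nonneg mult.assoc del: times_divide_eq_left)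
  qed
  also have "(\<integral>\<^sup>+q. ennreal (\<bar>f i q\<bar> * exp_weight T n (fst q + norm (snd q))) * \<eta> n \<partial>lborel)
     = (\<integral>\<^sup>+q. ennreal (\<bar>f i q\<bar> * exp_weight T n (fst q + norm (snd q))) \<partial>lborel) * \<eta> n"
  proof (rule nn_integral_multc)
    have "(\<lambda>q. \<bar>f i q\<bar> * exp_weight T n (fst q + norm (snd q))) \<in> borel_measurable borel"
      by (intro borel_measurable_times borel_measurable_abs f_measurable cone_weight_measurable)
    then show "(\<lambda>q. ennreal (\<bar>f i q\<bar> * exp_weight T n (fst q + norm (snd q)))) \<in> borel_measurable lborel"
      by simp
  qed
  also have "(\<integral>\<^sup>+x. ennreal (Q i x / (4 * pi * norm x) * exp_weight T n (2 * norm x)) * \<eta> n \<partial>lborel)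
     = (\<integral>\<^sup>+x. ennreal (Q i x / (4 * pi * norm x) * exp_weight T n (2 * norm x)) \<partial>lborel) * \<eta> n"
    by (intro nn_integral_multc) measurable
  finally show ?thesis by (simp add: add_mono)
qed

text \<open>The bound on the averaged probe masses is uniform in \<open>k\<close>, so Fatou's lemma
  passes it on to \<open>w\<close>.\<close>

lemma weighted_w_bound:
  defines "\<eta> \<equiv> \<lambda>n. 2 * ray_integral T (real n / T\<^sup>2)"
  shows "(\<integral>\<^sup>+p. ennreal (\<bar>w i p\<bar> * bump_mass * pot n p) \<partial>lborel)
    \<le> (\<integral>\<^sup>+q. ennreal (\<bar>f i q\<bar> * exp_weight T n (fst q + norm (snd q))) \<partial>lborel) * \<eta> n
      + (\<integral>\<^sup>+x. ennreal (Q i x / (4 * pi * norm x) * exp_weight T n (2 * norm x)) \<partial>lborel) * \<eta> n"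
proof -
  have "(\<integral>\<^sup>+p. ennreal (\<bar>w i p\<bar> * bump_mass * pot n p) \<partial>lborel)
     \<le> (\<integral>\<^sup>+p. liminf (\<lambda>k. probe_mass i k p * ennreal (pot n p)) \<partial>lborel)"
    by (intro nn_integral_mono w_le_liminf_probe_mass pot_nonneg)
  also have "\<dots> \<le> liminf (\<lambda>k. \<integral>\<^sup>+p. probe_mass i k p * ennreal (pot n p) \<partial>lborel)"
    by (intro nn_integral_liminf) measurable
  also have "\<dots> \<le> (\<integral>\<^sup>+q. ennreal (\<bar>f i q\<bar> * exp_weight T n (fst q + norm (snd q))) \<partial>lborel) * \<eta> n
      + (\<integral>\<^sup>+x. ennreal (Q i x / (4 * pi * norm x) * exp_weight T n (2 * norm x)) \<partial>lborel) * \<eta> n"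
    (is "_ \<le> ?B")
  proof -
    have "liminf (\<lambda>k. \<integral>\<^sup>+p. probe_mass i k p * ennreal (pot n p) \<partial>lborel) \<le> liminf (\<lambda>k::nat. ?B)"
      unfolding \<eta>_def by (intro Liminf_mono always_eventually allI nn_integral_probe_mass)
    then show ?thesis by (simp add: Liminf_const)
  qed
  finally show ?thesis .
qed

end

text \<open>The arithmetic of the loop. Here m, f, n stand for the integrals over the cone of w, of
  the source and of Q against \<open>pot\<close>, and x, y for those of Q on the surface against
  1/|x| and 1/|x|^2. The condition \<open>e1\<close> absorbs the share of m in its own bound;
  \<open>e2\<close> makes one passage through the whole chain end in y \<le> y / 2.\<close>

lemma absorption:
  fixes c C T e m n x y f :: real
  assumes nonneg: "m \<ge> 0" "n \<ge> 0" "x \<ge> 0" "y \<ge> 0" "C \<ge> 0" "T > 0" "c > 0" "0 < e" "e \<le> 1"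
    and mb: "c * m \<le> e * (T * f + x)" and fb: "f \<le> 2 * C * (m + n)" and nb: "n \<le> e * x"
    and yb: "y \<le> 4 * pi * f" and xb: "x \<le> T * y"
    and e1: "e * (2 * C * T) \<le> c / 2"
    and e2: "e * (8 * pi * C * ((2 / c) * (2 * C * T + 1) + 1) * T) \<le> 1 / 2"
  shows "y = 0"
proof -
  have "e * (T * f) \<le> e * (T * (2 * C * (m + n)))"
    using nonneg fb by (intro mult_left_mono) auto
  also have "\<dots> = e * (2 * C * T) * m + e * (2 * C * T) * n" by (simp add: algebra_simps)
  also have "\<dots> \<le> c / 2 * m + e * (2 * C * T) * (1 * x)"
  proof (intro add_mono mult_mono)
    show "n \<le> 1 * x" using nb mult_right_mono[of e 1 x] nonneg by linarith
  qed (use e1 nonneg in auto)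
  finally have "c * m \<le> c / 2 * m + e * (2 * C * T + 1) * x"
    using mb by (simp add: algebra_simps)
  then have "c / 2 * m \<le> e * (2 * C * T + 1) * x" by simp
  then have m: "m \<le> e * ((2 / c) * (2 * C * T + 1)) * x"
    using nonneg by (simp add: field_simps)
  have "y \<le> 4 * pi * (2 * C * (m + n))"
    using yb fb by (meson mult_left_mono order_trans pi_ge_zero mult_nonneg_nonneg zero_le_numeral)
  also have "\<dots> \<le> 4 * pi * (2 * C * (e * ((2 / c) * (2 * C * T + 1)) * x + e * x))"
    using m nb nonneg by (intro mult_left_mono add_mono) auto
  also have "\<dots> = e * (8 * pi * C * ((2 / c) * (2 * C * T + 1) + 1)) * x" by (simp add: algebra_simps)
  also have "\<dots> \<le> e * (8 * pi * C * ((2 / c) * (2 * C * T + 1) + 1)) * (T * y)"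
    using xb nonneg by (intro mult_left_mono) (auto intro!: mult_nonneg_nonneg add_nonneg_nonneg)
  also have "\<dots> = e * (8 * pi * C * ((2 / c) * (2 * C * T + 1) + 1) * T) * y" by (simp add: algebra_simps)
  also have "\<dots> \<le> 1 / 2 * y" using e2 nonneg by (intro mult_right_mono) auto
  finally show ?thesis using nonneg by simp
qed

section \<open>The weighted integrals and the inequalities between them\<close>

context wave_pair
begin

definition M_int :: "nat \<Rightarrow> 2 \<Rightarrow> ennreal" where
  "M_int n i = (\<integral>\<^sup>+p. ennreal (\<bar>w i p\<bar> * pot n p) \<partial>lborel)"

definition F_int :: "nat \<Rightarrow> 2 \<Rightarrow> ennreal" where
  "F_int n i = (\<integral>\<^sup>+p. ennreal (\<bar>f i p\<bar> * pot n p) \<partial>lborel)"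

definition N_int :: "nat \<Rightarrow> 2 \<Rightarrow> ennreal" where
  "N_int n i = (\<integral>\<^sup>+p. ennreal (indicator light_cone_interior p * Q i (snd p) * pot n p) \<partial>lborel)"

definition X_int :: "nat \<Rightarrow> 2 \<Rightarrow> ennreal" where
  "X_int n i = (\<integral>\<^sup>+x. ennreal (Q i x * exp_weight T n (2 * norm x) / norm x) \<partial>lborel)"

definition Y_int :: "nat \<Rightarrow> 2 \<Rightarrow> ennreal" where
  "Y_int n i = (\<integral>\<^sup>+x. ennreal (Q i x * exp_weight T n (2 * norm x) / (norm x)\<^sup>2) \<partial>lborel)"

text \<open>For test functions centred on the axis the left side of \<open>identity\<close> tends to
  0, so the surface integral differs from minus the volume integral by a vanishing error. Since s
  \<ge> |x|, the decreasing weight keeps the regularised kernel below \<open>pot\<close>, and Q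
  \<ge> 0 permits Fatou's lemma on the surface. The factor 4 pi undoes the normalisation of the
  spherical wave.\<close>

lemma Y_le_F: "Y_int n i \<le> ennreal (4 * pi) * F_int n i"
proof -
  define \<epsilon> where "\<epsilon> k = 1 / real (Suc k)" for k
  have \<epsilon>: "\<epsilon> k > 0" for k by (simp add: \<epsilon>_def)
  have \<epsilon>0: "\<epsilon> \<longlonglongrightarrow> 0" unfolding \<epsilon>_def[abs_def] by (rule LIMSEQ_Suc[OF lim_1_over_n])
  define s where "s k = rdist (\<epsilon> k) 0" for k
  have s: "s k x > 0" "norm x \<le> s k x" for k x
    using rdist_pos[OF \<epsilon>, of k 0 x] rdist_ge[of x 0 "\<epsilon> k"] by (auto simp: s_def)
  define L where "L k = (LINT p|lborel. w i p * box_kernel (exp_weight T n) (\<epsilon> k)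
            (s k (snd p)) (fst p + s k (snd p)))" for k
  define G where "G k x = Q i x * (exp_weight T n (norm x + s k x) / s k x) / (4 * pi * norm x)" for k x
  have L0: "L \<longlonglongrightarrow> 0"
    using tendsto_axis[of i n] by (simp add: L_def[abs_def] s_def \<epsilon>_def)
  have G_nonneg: "G k x \<ge> 0" for k x
    unfolding G_def using s[where k=k and x=x] by (intro divide_nonneg_nonneg mult_nonneg_nonneg Q_nonneg exp_weight_nonneg) auto
  \<comment> \<open>Q times the test function is again a test function, paired here with the
    spherical wave. Integrability is what identifies the Bochner integral with the nonnegative one
    below.\<close>
  have G_int: "integrable lborel (G k)" for k
  proof -
    have "smooth_fun (Q i)"
    proof -
      have "smooth_fun (\<lambda>x. P1 x $ i $ j - P2 x $ i $ j)" for j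
        using smooth_fun_add[OF P1 smooth_fun_mult[OF smooth_fun_const[of "-1"] P2]] by simp
      then show ?thesis unfolding Q_def[abs_def] sum_2 by (intro smooth_fun_add)
    qed
    then have "test_function (\<lambda>p. Q i (snd p) * cone_test (exp_weight T n) (\<epsilon> k) 0 p)"
      by (intro test_function_mult smooth_fun_snd test_function_cone_test[where A=T] \<epsilon> smooth_exp_weight exp_weight_eq_0)
    from integrable_spherical_wave[OF this] show ?thesis
      by (simp add: G_def[abs_def] s_def cone_test_def spherical_profile_def smooth_step_eq_1)
  qed
  have bound: "(\<integral>\<^sup>+x. ennreal (G k x) \<partial>lborel) \<le> ennreal \<bar>L k\<bar> + F_int n i" for k
  proof -
    define I where "I = (LINT p|lborel. f i p * (exp_weight T n (fst p + s k (snd p)) / s k (snd p)))"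
    have "L k = I + (LINT x|lborel. G k x)"
      unfolding L_def I_def G_def s_def
      by (rule identity[OF \<epsilon> smooth_exp_weight exp_weight_eq_0])
    then have "(\<integral>\<^sup>+x. ennreal (G k x) \<partial>lborel) = ennreal (L k - I)"
      using nn_integral_eq_integral[OF G_int, of k] G_nonneg by simp
    also have "\<dots> \<le> ennreal (\<bar>L k\<bar> + \<bar>I\<bar>)" by (intro ennreal_leI) linarith
    also have "\<dots> = ennreal \<bar>L k\<bar> + ennreal \<bar>I\<bar>" by simp
    also have "ennreal \<bar>I\<bar> \<le> (\<integral>\<^sup>+p. ennreal \<bar>f i p * (exp_weight T n (fst p + s k (snd p)) / s k (snd p))\<bar> \<partial>lborel)"
      unfolding I_def by (rule abs_integral_le_nn_integral)
    also have "\<dots> \<le> F_int n i"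
      unfolding F_int_def
    proof (rule nn_integral_mono_AE)
      show "AE p in lborel. ennreal \<bar>f i p * (exp_weight T n (fst p + s k (snd p)) / s k (snd p))\<bar>
          \<le> ennreal (\<bar>f i p\<bar> * pot n p)"
        using AE_snd_nonzero
      proof eventually_elim
        case (elim p)
        have "exp_weight T n (fst p + s k (snd p)) / s k (snd p) \<le> pot n p"
          unfolding pot_def using elim s(2)[of "snd p" k]
          by (intro frac_le exp_weight_antimono exp_weight_nonneg) auto
        moreover have "exp_weight T n (fst p + s k (snd p)) / s k (snd p) \<ge> 0"
          using s(1)[of k "snd p"] exp_weight_nonneg by (simp add: less_imp_le)
        ultimately show ?case
          by (intro ennreal_leI) (simp only: abs_mult abs_of_nonneg, intro mult_left_mono, auto)
      qed
    qed
    finally show ?thesis by (simp add: add_left_mono)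
  qed
  have "Y_int n i = (\<integral>\<^sup>+x. ennreal (4 * pi) * ennreal (Q i x * exp_weight T n (2 * norm x) / (4 * pi * (norm x)\<^sup>2)) \<partial>lborel)"
    unfolding Y_int_def
    by (intro nn_integral_cong) (simp add: ennreal_mult'[symmetric])
  also have "\<dots> = ennreal (4 * pi) * (\<integral>\<^sup>+x. ennreal (Q i x * exp_weight T n (2 * norm x) / (4 * pi * (norm x)\<^sup>2)) \<partial>lborel)"
    by (rule nn_integral_cmult) measurable
  also have "(\<integral>\<^sup>+x. ennreal (Q i x * exp_weight T n (2 * norm x) / (4 * pi * (norm x)\<^sup>2)) \<partial>lborel)
      \<le> (\<integral>\<^sup>+x. liminf (\<lambda>k. ennreal (G k x)) \<partial>lborel)"
  proof (rule nn_integral_mono)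
    fix x :: "real^3"
    show "ennreal (Q i x * exp_weight T n (2 * norm x) / (4 * pi * (norm x)\<^sup>2)) \<le> liminf (\<lambda>k. ennreal (G k x))"
    proof (cases "x = 0")
      case False
      have "(\<lambda>k. s k x) \<longlonglongrightarrow> sqrt (0\<^sup>2 + (norm (x - 0))\<^sup>2)"
        unfolding s_def rdist_def by (intro tendsto_intros \<epsilon>0)
      then have sl: "(\<lambda>k. s k x) \<longlonglongrightarrow> norm x" by simp
      have "isCont (exp_weight T n) u" for u
        using smooth_fun_continuous[OF smooth_exp_weight, of UNIV] by (simp add: continuous_on_eq_continuous_at)
      from isCont_tendsto_compose[OF this tendsto_add[OF tendsto_const sl]]
      have "(\<lambda>k. exp_weight T n (norm x + s k x)) \<longlonglongrightarrow> exp_weight T n (norm x + norm x)" .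
      then have "(\<lambda>k. G k x) \<longlonglongrightarrow> Q i x * (exp_weight T n (norm x + norm x) / norm x) / (4 * pi * norm x)"
        unfolding G_def using False by (intro tendsto_intros sl) auto
      also have "Q i x * (exp_weight T n (norm x + norm x) / norm x) / (4 * pi * norm x)
          = Q i x * exp_weight T n (2 * norm x) / (4 * pi * (norm x)\<^sup>2)"
        by (simp add: power2_eq_square)
      finally have "(\<lambda>k. ennreal (G k x)) \<longlonglongrightarrow> ennreal (Q i x * exp_weight T n (2 * norm x) / (4 * pi * (norm x)\<^sup>2))"
        by (rule tendsto_ennrealI)
      then show ?thesis using lim_imp_Liminf[of sequentially] by fastforce
    qed simp
  qed
  also have "\<dots> \<le> liminf (\<lambda>k. \<integral>\<^sup>+x. ennreal (G k x) \<partial>lborel)"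
    using G_int by (intro nn_integral_liminf) auto
  also have "\<dots> \<le> liminf (\<lambda>k. ennreal \<bar>L k\<bar> + F_int n i)"
    by (intro Liminf_mono always_eventually allI bound)
  also have "\<dots> = F_int n i"
  proof -
    have "(\<lambda>k. ennreal \<bar>L k\<bar> + F_int n i) \<longlonglongrightarrow> ennreal \<bar>0\<bar> + F_int n i"
      by (intro tendsto_add tendsto_ennrealI tendsto_rabs L0 tendsto_const)
    then show ?thesis using lim_imp_Liminf[of sequentially] by fastforce
  qed
  finally show ?thesis by (simp add: mult_left_mono)
qed

text \<open>The source splits as P1 w + (P1 - P2) R2. The entries of P1 - P2 are nonnegative, so the
  sum of their absolute values along a row is Q itself, and P1 and R2 are bounded on the part of the
  cone with t + |x| \<le> T.\<close>

lemma f_bound: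
  obtains C where "C \<ge> 0" "\<And>i p. fst p + norm (snd p) \<le> T \<Longrightarrow>
     \<bar>f i p\<bar> \<le> C * (\<bar>w 1 p\<bar> + \<bar>w 2 p\<bar>
       + indicator light_cone_interior p * Q 1 (snd p) + indicator light_cone_interior p * Q 2 (snd p))"
proof -
  have "\<exists>A. \<forall>x. norm x \<le> T \<longrightarrow> \<bar>P1 x $ i $ j\<bar> \<le> A" for i j
  proof -
    have "compact ((\<lambda>x. P1 x $ i $ j) ` cball 0 T)"
      by (intro compact_continuous_image continuous_P) simp
    then obtain A where "\<forall>v\<in>(\<lambda>x. P1 x $ i $ j) ` cball 0 T. norm v \<le> A"
      using compact_imp_bounded bounded_iff by blast
    then show ?thesis by (auto intro!: exI[of _ A])
  qed
  then obtain A where A: "\<And>i j x. norm x \<le> T \<Longrightarrow> \<bar>P1 x $ i $ j\<bar> \<le> A i j" by metis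
  have "\<exists>B. \<forall>p\<in>closed_light_cone. fst p \<le> T \<longrightarrow> \<bar>R2 p $ j\<bar> \<le> B" for j
    using cone_bounded[OF continuous_R(2), of T j] by metis
  then obtain B where B: "\<And>j p. p \<in> closed_light_cone \<Longrightarrow> fst p \<le> T \<Longrightarrow> \<bar>R2 p $ j\<bar> \<le> B j" by metis
  define C where "C = (\<Sum>i\<in>UNIV. \<Sum>j\<in>UNIV. \<bar>A i j\<bar>) + (\<Sum>j\<in>UNIV. \<bar>B j\<bar>)"
  have AC: "A i j \<le> C" for i j
  proof -
    have "\<bar>A i j\<bar> \<le> (\<Sum>j\<in>UNIV. \<bar>A i j\<bar>)" by (intro member_le_sum) auto
    also have "\<dots> \<le> (\<Sum>i\<in>UNIV. \<Sum>j\<in>UNIV. \<bar>A i j\<bar>)" by (intro member_le_sum sum_nonneg) auto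
    also have "\<dots> \<le> C" by (simp add: C_def sum_nonneg)
    finally show ?thesis by linarith
  qed
  have BC: "B j \<le> C" for j
  proof -
    have "\<bar>B j\<bar> \<le> (\<Sum>j\<in>UNIV. \<bar>B j\<bar>)" by (intro member_le_sum) auto
    also have "\<dots> \<le> C" by (simp add: C_def sum_nonneg)
    finally show ?thesis by linarith
  qed
  have C0: "C \<ge> 0" by (simp add: C_def sum_nonneg)
  show thesis
  proof (rule that[OF C0])
    fix i and p :: spacetime assume p: "fst p + norm (snd p) \<le> T"
    show "\<bar>f i p\<bar> \<le> C * (\<bar>w 1 p\<bar> + \<bar>w 2 p\<bar>
       + indicator light_cone_interior p * Q 1 (snd p) + indicator light_cone_interior p * Q 2 (snd p))"
    proof (cases "p \<in> light_cone_interior")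
      case True
      define x where "x = snd p"
      define W where "W j = R1 p $ j - R2 p $ j" for j
      define D where "D j = P1 x $ i $ j - P2 x $ i $ j" for j
      have "norm x < fst p" using True by (simp add: light_cone_interior_eq x_def)
      then have nx: "norm x \<le> T" "fst p \<le> T" using p norm_ge_zero[of x] unfolding x_def by linarith+
      have D: "D j \<ge> 0" for j by (simp add: D_def P_le)
      have "p \<in> closed_light_cone" using True light_cone_interior_subset by blast
      then have r2: "\<bar>R2 p $ j\<bar> \<le> C" for j using B[of p j] BC[of j] nx by linarith
      have p1: "\<bar>P1 x $ i $ j\<bar> \<le> C" for j using A[of x i j] AC[of i j] nx by linarith
      have "f i p = (\<Sum>j\<in>UNIV. P1 x $ i $ j * W j + D j * R2 p $ j)"
        using True by (simp add: f_def W_def D_def x_def algebra_simps)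
      also have "\<bar>\<dots>\<bar> \<le> (\<Sum>j\<in>UNIV. \<bar>P1 x $ i $ j * W j + D j * R2 p $ j\<bar>)" by (rule sum_abs)
      also have "\<dots> \<le> (\<Sum>j\<in>UNIV. C * \<bar>W j\<bar> + C * D j)"
      proof (rule sum_mono)
        fix j :: 2
        have "\<bar>P1 x $ i $ j * W j\<bar> \<le> C * \<bar>W j\<bar>" unfolding abs_mult by (intro mult_right_mono p1) simp
        moreover have "\<bar>D j * R2 p $ j\<bar> \<le> C * D j"
          using mult_right_mono[OF r2[of j] D[of j]] D[of j] by (simp add: abs_mult mult.commute)
        ultimately show "\<bar>P1 x $ i $ j * W j + D j * R2 p $ j\<bar> \<le> C * \<bar>W j\<bar> + C * D j" by linarith
      qed
      also have "\<dots> = C * (\<bar>W 1\<bar> + \<bar>W 2\<bar> + Q i x)"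
        by (simp add: sum_2 Q_def D_def algebra_simps)
      also have "\<dots> \<le> C * (\<bar>W 1\<bar> + \<bar>W 2\<bar> + Q 1 x + Q 2 x)"
      proof (intro mult_left_mono C0)
        have "i = 1 \<or> i = 2" by (rule exhaust_2)
        then show "\<bar>W 1\<bar> + \<bar>W 2\<bar> + Q i x \<le> \<bar>W 1\<bar> + \<bar>W 2\<bar> + Q 1 x + Q 2 x"
          using Q_nonneg[of 1 x] Q_nonneg[of 2 x] by auto
      qed
      finally show ?thesis using True by (simp add: w_def W_def x_def)
    qed (simp add: f_def w_def)
  qed
qed

text \<open>For fixed x the weight beyond the cone is at most its value on the cone times exp(-\<mu>
  (t - |x|)) with \<mu> = n / T^2, and integration in t gives 1 / \<mu>.\<close>

lemma N_le_X:
  assumes n: "n > 0"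
  shows "N_int n i \<le> ennreal (T\<^sup>2 / real n) * X_int n i"
proof -
  define \<mu> where "\<mu> = real n / T\<^sup>2"
  have \<mu>: "\<mu> > 0" using n T by (simp add: \<mu>_def)
  have tail: "(\<integral>\<^sup>+t. ennreal (exp (- (\<mu> * (t - a)))) * indicator {a..} t \<partial>lborel) = ennreal (T\<^sup>2 / real n)" for a
  proof -
    have "((\<lambda>t. - exp (- (\<mu> * (t - a))) / \<mu>) \<longlongrightarrow> 0) at_top"
      using \<mu> by real_asymp
    moreover have "((\<lambda>t. - exp (- (\<mu> * (t - a))) / \<mu>) has_real_derivative exp (- (\<mu> * (t - a)))) (at t)" for t
      using \<mu> by (auto intro!: derivative_eq_intros)
    ultimately have "(\<integral>\<^sup>+t. ennreal (exp (- (\<mu> * (t - a)))) * indicator {a..} t \<partial>lborel)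
        = ennreal (0 - - exp (- (\<mu> * (a - a))) / \<mu>)"
      by (intro nn_integral_FTC_atLeast) auto
    then show ?thesis by (simp add: \<mu>_def)
  qed
  have m: "(\<lambda>p. indicator light_cone_interior p * Q i (snd p) * pot n p) \<in> borel_measurable borel"
    using open_light_cone_interior
    by (intro borel_measurable_times pot_measurable borel_measurable_indicator borel_open
        borel_measurable_continuous_onI[OF continuous_on_compose2[OF continuous_Q[of UNIV]]] continuous_intros) auto
  have "N_int n i = (\<integral>\<^sup>+x. \<integral>\<^sup>+t. ennreal (indicator light_cone_interior (t, x) * Q i x * pot n (t, x)) \<partial>lborel \<partial>lborel)"
    unfolding N_int_def using m by (subst nn_integral_spacetime) auto
  also have "\<dots> \<le> (\<integral>\<^sup>+x. ennreal (T\<^sup>2 / real n) * ennreal (Q i x * exp_weight T n (2 * norm x) / norm x) \<partial>lborel)"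
  proof (rule nn_integral_mono)
    fix x :: "real^3"
    define c where "c = Q i x * exp_weight T n (2 * norm x) / norm x"
    have c: "c \<ge> 0" by (simp add: c_def Q_nonneg exp_weight_nonneg)
    have "indicator light_cone_interior (t, x) * Q i x * pot n (t, x)
        \<le> c * (exp (- (\<mu> * (t - norm x))) * indicator {norm x..} t)" for t
    proof (cases "norm x < t")
      case True
      then have "exp_weight T n (2 * norm x + (t - norm x)) \<le> exp_weight T n (2 * norm x) * exp (- (\<mu> * (t - norm x)))"
        unfolding \<mu>_def by (intro exp_weight_shift T) auto
      then have "Q i x * (exp_weight T n (t + norm x) / norm x)
          \<le> Q i x * (exp_weight T n (2 * norm x) * exp (- (\<mu> * (t - norm x))) / norm x)"
        by (intro mult_left_mono divide_right_mono Q_nonneg) (auto simp: algebra_simps)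
      then show ?thesis using True by (simp add: light_cone_interior_def pot_def c_def)
    qed (simp add: light_cone_interior_def c)
    then have "(\<integral>\<^sup>+t. ennreal (indicator light_cone_interior (t, x) * Q i x * pot n (t, x)) \<partial>lborel)
        \<le> (\<integral>\<^sup>+t. ennreal (c * (exp (- (\<mu> * (t - norm x))) * indicator {norm x..} t)) \<partial>lborel)"
      by (intro nn_integral_mono ennreal_leI)
    also have "\<dots> = (\<integral>\<^sup>+t. ennreal c * (ennreal (exp (- (\<mu> * (t - norm x)))) * indicator {norm x..} t) \<partial>lborel)"
      using c by (intro nn_integral_cong) (simp add: ennreal_mult ennreal_indicator)
    also have "\<dots> = ennreal c * (\<integral>\<^sup>+t. ennreal (exp (- (\<mu> * (t - norm x)))) * indicator {norm x..} t \<partial>lborel)"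
      by (rule nn_integral_cmult) measurable
    also have "\<dots> = ennreal (T\<^sup>2 / real n) * ennreal c" unfolding tail by (rule mult.commute)
    finally show "(\<integral>\<^sup>+t. ennreal (indicator light_cone_interior (t, x) * Q i x * pot n (t, x)) \<partial>lborel)
        \<le> ennreal (T\<^sup>2 / real n) * ennreal (Q i x * exp_weight T n (2 * norm x) / norm x)"
      by (simp only: c_def)
  qed
  also have "\<dots> = ennreal (T\<^sup>2 / real n) * X_int n i"
    unfolding X_int_def by (rule nn_integral_cmult) measurable
  finally show ?thesis .
qed

text \<open>Only |x| < T contributes, where 1/|x| \<le> T / |x|^2.\<close>

lemma X_le_Y: "X_int n i \<le> ennreal T * Y_int n i"
proof -
  have "X_int n i \<le> (\<integral>\<^sup>+x. ennreal T * ennreal (Q i x * exp_weight T n (2 * norm x) / (norm x)\<^sup>2) \<partial>lborel)"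
    unfolding X_int_def
  proof (rule nn_integral_mono)
    fix x :: "real^3"
    have "Q i x * exp_weight T n (2 * norm x) / norm x \<le> T * (Q i x * exp_weight T n (2 * norm x) / (norm x)\<^sup>2)"
    proof (cases "x = 0 \<or> norm x \<ge> T")
      case False
      define c where "c = Q i x * exp_weight T n (2 * norm x)"
      have "c \<ge> 0" by (simp add: c_def Q_nonneg exp_weight_nonneg)
      then have "norm x * (c / (norm x)\<^sup>2) \<le> T * (c / (norm x)\<^sup>2)"
        using False by (intro mult_right_mono) auto
      then show ?thesis using False by (simp add: c_def power2_eq_square)
    qed (use T norm_ge_zero[of x] in \<open>auto simp: exp_weight_eq_0 simp del: norm_ge_zero\<close>)
    then show "ennreal (Q i x * exp_weight T n (2 * norm x) / norm x)
        \<le> ennreal T * ennreal (Q i x * exp_weight T n (2 * norm x) / (norm x)\<^sup>2)"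
      using T by (subst ennreal_mult'[symmetric]) (auto intro: ennreal_leI)
  qed
  also have "\<dots> = ennreal T * Y_int n i"
    unfolding Y_int_def by (rule nn_integral_cmult) measurable
  finally show ?thesis .
qed

end

section \<open>Finiteness, absorption and the conclusion\<close>

context wave_pair
begin

text \<open>Absorption cancels a multiple of this quantity from both sides, which requires it to be
  finite. The weight confines the cone to t + |x| < T, where w is bounded and 1/|x| is
  integrable.\<close>

lemma M_int_finite: "M_int n i < \<infinity>"
proof -
  obtain B where B: "B \<ge> 0" "\<And>p. fst p \<le> T \<Longrightarrow> \<bar>w i p\<bar> \<le> B" using w_bounded by blast
  have m: "(\<lambda>p. \<bar>w i p\<bar> * pot n p) \<in> borel_measurable borel"
    by (intro borel_measurable_times borel_measurable_abs w_measurable pot_measurable)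
  have bound: "\<bar>w i (t, x)\<bar> * pot n (t, x) \<le> (B * (indicator (cball 0 T) x / norm x)) * indicator {0..T} t" for t x
  proof (cases "(t, x) \<in> light_cone_interior \<and> t + norm x < T")
    case True
    then have t: "norm x < t" "t + norm x < T" by (auto simp: light_cone_interior_def)
    have "norm x \<ge> 0" by simp
    with t have t': "0 \<le> t" "t \<le> T" "norm x \<le> T" by linarith+
    have "\<bar>w i (t, x)\<bar> * pot n (t, x) \<le> B * (1 / norm x)"
      unfolding pot_def using B t' exp_weight_le_1 exp_weight_nonneg
      by (intro mult_mono) (auto intro!: divide_right_mono)
    then show ?thesis using t' by simp
  next
    case False
    then have "w i (t, x) = 0 \<or> pot n (t, x) = 0"
      by (auto simp: w_def pot_def exp_weight_eq_0)
    then have "\<bar>w i (t, x)\<bar> * pot n (t, x) = 0" by auto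
    moreover have "(B * (indicator (cball 0 T) x / norm x)) * indicator {0..T} t \<ge> 0" using B by simp
    ultimately show ?thesis by linarith
  qed
  have "M_int n i = (\<integral>\<^sup>+x. \<integral>\<^sup>+t. ennreal (\<bar>w i (t, x)\<bar> * pot n (t, x)) \<partial>lborel \<partial>lborel)"
    unfolding M_int_def using m by (subst nn_integral_spacetime) auto
  also have "\<dots> \<le> (\<integral>\<^sup>+x. \<integral>\<^sup>+t. ennreal (B * (indicator (cball 0 T) (x::real^3) / norm x)) * indicator {0..T} t \<partial>lborel \<partial>lborel)"
  proof (intro nn_integral_mono)
    fix x :: "real^3" and t :: real
    have "ennreal (\<bar>w i (t, x)\<bar> * pot n (t, x)) \<le> ennreal ((B * (indicator (cball 0 T) x / norm x)) * indicator {0..T} t)"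
      by (intro ennreal_leI bound)
    also have "\<dots> = ennreal (B * (indicator (cball 0 T) x / norm x)) * indicator {0..T} t"
      using B by (subst ennreal_mult) (auto simp: ennreal_indicator)
    finally show "ennreal (\<bar>w i (t, x)\<bar> * pot n (t, x))
        \<le> ennreal (B * (indicator (cball 0 T) x / norm x)) * indicator {0..T} t" .
  qed
  also have "\<dots> = (\<integral>\<^sup>+x. ennreal (B * (indicator (cball 0 T) (x::real^3) / norm x)) * ennreal T \<partial>lborel)"
    using T by (intro nn_integral_cong) (simp add: nn_integral_cmult_indicator emeasure_lborel_Icc)
  also have "\<dots> = (\<integral>\<^sup>+x. ennreal (B * (indicator (cball 0 T) (x::real^3) / norm x)) \<partial>lborel) * ennreal T"
    by (rule nn_integral_multc) measurable
  also have "\<dots> < \<infinity>"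
  proof -
    have "integrable lborel (\<lambda>x::real^3. B * (indicator (cball 0 T) x / norm x))"
      by (intro integrable_mult_right integrable_inverse_norm_ball T)
    then have "(\<integral>\<^sup>+x. ennreal (norm (B * (indicator (cball 0 T) (x::real^3) / norm x))) \<partial>lborel) < \<infinity>"
      by (simp only: integrable_iff_bounded)
    moreover have "norm (B * (indicator (cball 0 T) (x::real^3) / norm x)) = B * (indicator (cball 0 T) x / norm x)" for x
      using B by simp
    ultimately have "(\<integral>\<^sup>+x. ennreal (B * (indicator (cball 0 T) (x::real^3) / norm x)) \<partial>lborel) < \<infinity>"
      by (simp only:)
    then show ?thesis unfolding infinity_ennreal_def by (intro ennreal_mult_less_top[THEN iffD2]) auto
  qed
  finally show ?thesis .
qed

text \<open>The other quantity to be absorbed. Its finiteness rests on the local integrability of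
  1/|x|^2 in dimension 3.\<close>

lemma Y_int_finite: "Y_int n i < \<infinity>"
proof -
  have "compact (Q i ` cball 0 T)" by (intro compact_continuous_image continuous_Q) simp
  then obtain K where K: "\<forall>v\<in>Q i ` cball 0 T. norm v \<le> K"
    using compact_imp_bounded bounded_iff by blast
  have Kx: "Q i x \<le> \<bar>K\<bar>" if "norm x \<le> T" for x
  proof -
    have "norm (Q i x) \<le> K" using K that by (simp add: image_iff)
    then show ?thesis by simp
  qed
  have "Y_int n i \<le> (\<integral>\<^sup>+x. ennreal \<bar>K\<bar> * ennreal (indicator (cball 0 T) (x::real^3) / (norm x)\<^sup>2) \<partial>lborel)"
    unfolding Y_int_def
  proof (rule nn_integral_mono)
    fix x :: "real^3"
    have "Q i x * exp_weight T n (2 * norm x) / (norm x)\<^sup>2 \<le> \<bar>K\<bar> * (indicator (cball 0 T) x / (norm x)\<^sup>2)"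
    proof (cases "norm x \<le> T")
      case True
      have "Q i x * exp_weight T n (2 * norm x) \<le> \<bar>K\<bar> * 1"
        using Kx[OF True] by (intro mult_mono exp_weight_le_1 exp_weight_nonneg) auto
      then have "Q i x * exp_weight T n (2 * norm x) / (norm x)\<^sup>2 \<le> \<bar>K\<bar> * 1 / (norm x)\<^sup>2"
        by (intro divide_right_mono) auto
      then show ?thesis using True by simp
    next
      case False
      then have "exp_weight T n (2 * norm x) = 0" using norm_ge_zero[of x] T by (intro exp_weight_eq_0) linarith
      then show ?thesis by simp
    qed
    then show "ennreal (Q i x * exp_weight T n (2 * norm x) / (norm x)\<^sup>2)
        \<le> ennreal \<bar>K\<bar> * ennreal (indicator (cball 0 T) x / (norm x)\<^sup>2)"
      by (subst ennreal_mult'[symmetric]) (auto intro: ennreal_leI)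
  qed
  also have "\<dots> = ennreal \<bar>K\<bar> * (\<integral>\<^sup>+x. ennreal (indicator (cball 0 T) (x::real^3) / (norm x)\<^sup>2) \<partial>lborel)"
    by (rule nn_integral_cmult) measurable
  also have "\<dots> < \<infinity>"
    using nn_integral_inverse_square_ball[OF T] by (simp add: ennreal_mult_less_top)
  finally show ?thesis .
qed

lemma M_bound:
  "ennreal bump_mass * M_int n i
    \<le> (ennreal T * F_int n i + X_int n i) * (2 * ray_integral T (real n / T\<^sup>2))"
proof -
  have mw: "(\<lambda>p. ennreal (\<bar>w i p\<bar> * pot n p)) \<in> borel_measurable lborel"
    using borel_measurable_times[OF borel_measurable_abs[OF w_measurable] pot_measurable] by simp
  have mf: "(\<lambda>p. ennreal (\<bar>f i p\<bar> * pot n p)) \<in> borel_measurable lborel"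
    using borel_measurable_times[OF borel_measurable_abs[OF f_measurable] pot_measurable] by simp
  have "ennreal bump_mass * M_int n i = (\<integral>\<^sup>+p. ennreal bump_mass * ennreal (\<bar>w i p\<bar> * pot n p) \<partial>lborel)"
    unfolding M_int_def by (rule nn_integral_cmult[OF mw, symmetric])
  also have "\<dots> = (\<integral>\<^sup>+p. ennreal (\<bar>w i p\<bar> * bump_mass * pot n p) \<partial>lborel)"
    using bump_mass_pos by (intro nn_integral_cong) (simp add: ennreal_mult'[symmetric] mult_ac)
  also have "\<dots> \<le> (\<integral>\<^sup>+q. ennreal (\<bar>f i q\<bar> * exp_weight T n (fst q + norm (snd q))) \<partial>lborel) * (2 * ray_integral T (real n / T\<^sup>2))
      + (\<integral>\<^sup>+x. ennreal (Q i x / (4 * pi * norm x) * exp_weight T n (2 * norm x)) \<partial>lborel) * (2 * ray_integral T (real n / T\<^sup>2))"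
    by (rule weighted_w_bound)
  also have "(\<integral>\<^sup>+q. ennreal (\<bar>f i q\<bar> * exp_weight T n (fst q + norm (snd q))) \<partial>lborel)
      \<le> (\<integral>\<^sup>+q. ennreal T * ennreal (\<bar>f i q\<bar> * pot n q) \<partial>lborel)"
  proof (rule nn_integral_mono_AE)
    show "AE q in lborel. ennreal (\<bar>f i q\<bar> * exp_weight T n (fst q + norm (snd q)))
        \<le> ennreal T * ennreal (\<bar>f i q\<bar> * pot n q)"
      using AE_snd_nonzero
    proof eventually_elim
      case (elim q)
      have "\<bar>f i q\<bar> * exp_weight T n (fst q + norm (snd q)) \<le> T * (\<bar>f i q\<bar> * pot n q)"
      proof (cases "q \<in> light_cone_interior \<and> fst q + norm (snd q) < T")
        case True
        then have "norm (snd q) \<le> T" using norm_ge_zero[of "snd q"] unfolding light_cone_interior_eq mem_Collect_eq by linarith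
        \<comment> \<open>The factor |x| \<le> T removes the singularity of \<open>pot\<close> and
          restores the bare weight.\<close>
        then have "norm (snd q) * (\<bar>f i q\<bar> * pot n q) \<le> T * (\<bar>f i q\<bar> * pot n q)"
          by (intro mult_right_mono mult_nonneg_nonneg pot_nonneg) auto
        moreover have "norm (snd q) * (\<bar>f i q\<bar> * pot n q) = \<bar>f i q\<bar> * exp_weight T n (fst q + norm (snd q))"
          using elim by (simp add: pot_def)
        ultimately show ?thesis by simp
      qed (auto simp: f_def pot_def exp_weight_eq_0)
      then show ?case using T by (subst ennreal_mult'[symmetric]) (auto intro: ennreal_leI)
    qed
  qed
  also have "(\<integral>\<^sup>+q. ennreal T * ennreal (\<bar>f i q\<bar> * pot n q) \<partial>lborel) = ennreal T * F_int n i"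
    unfolding F_int_def by (rule nn_integral_cmult[OF mf])
  also have "(\<integral>\<^sup>+x. ennreal (Q i x / (4 * pi * norm x) * exp_weight T n (2 * norm x)) \<partial>lborel) \<le> X_int n i"
    unfolding X_int_def
  proof (intro nn_integral_mono ennreal_leI)
    fix x :: "real^3"
    define c where "c = Q i x * exp_weight T n (2 * norm x) / norm x"
    have "c \<ge> 0" by (simp add: c_def Q_nonneg exp_weight_nonneg)
    moreover have "1 \<le> 4 * pi" using pi_gt3 by linarith
    ultimately have "c / (4 * pi) \<le> c / 1" by (intro divide_left_mono) auto
    then show "Q i x / (4 * pi * norm x) * exp_weight T n (2 * norm x) \<le> Q i x * exp_weight T n (2 * norm x) / norm x"
      by (simp add: c_def mult_ac)
  qed
  finally show ?thesis by (simp add: distrib_right add_mono mult_right_mono)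
qed

lemma F_le_M_N:
  obtains C where "C \<ge> 0" "\<And>n i. F_int n i \<le> ennreal C * (M_int n 1 + M_int n 2 + N_int n 1 + N_int n 2)"
proof -
  obtain C where C: "C \<ge> 0" "\<And>i p. fst p + norm (snd p) \<le> T \<Longrightarrow>
     \<bar>f i p\<bar> \<le> C * (\<bar>w 1 p\<bar> + \<bar>w 2 p\<bar>
       + indicator light_cone_interior p * Q 1 (snd p) + indicator light_cone_interior p * Q 2 (snd p))"
    using f_bound by blast
  have mw: "(\<lambda>p. ennreal (\<bar>w i p\<bar> * pot n p)) \<in> borel_measurable lborel" for i n
    using borel_measurable_times[OF borel_measurable_abs[OF w_measurable] pot_measurable] by simp
  have "(\<lambda>p. indicator light_cone_interior p * Q i (snd p) * pot n p) \<in> borel_measurable borel" for i n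
    using open_light_cone_interior
    by (intro borel_measurable_times pot_measurable borel_measurable_indicator borel_open
        borel_measurable_continuous_onI[OF continuous_on_compose2[OF continuous_Q[of UNIV]]] continuous_intros) auto
  then have mq: "(\<lambda>p. ennreal (indicator light_cone_interior p * Q i (snd p) * pot n p)) \<in> borel_measurable lborel" for i n
    by simp
  show thesis
  proof (rule that[OF C(1)])
    fix n i
    let ?W = "\<lambda>j p. \<bar>w j p\<bar> * pot n p"
    let ?N = "\<lambda>j p. indicator light_cone_interior p * Q j (snd p) * pot n p"
    have "F_int n i \<le> (\<integral>\<^sup>+p. ennreal C * (ennreal (?W 1 p) + ennreal (?W 2 p) + ennreal (?N 1 p) + ennreal (?N 2 p)) \<partial>lborel)"
      unfolding F_int_def
    proof (rule nn_integral_mono)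
      fix p
      have "\<bar>f i p\<bar> * pot n p \<le> C * (?W 1 p + ?W 2 p + ?N 1 p + ?N 2 p)"
      proof (cases "fst p + norm (snd p) \<le> T")
        case True
        show ?thesis using mult_right_mono[OF C(2)[OF True, of i] pot_nonneg[of n p]] by (simp add: algebra_simps)
      qed (simp add: pot_def exp_weight_eq_0)
      moreover have "?W j p \<ge> 0" "?N j p \<ge> 0" for j by (simp_all add: pot_nonneg Q_nonneg)
      ultimately show "ennreal (\<bar>f i p\<bar> * pot n p)
          \<le> ennreal C * (ennreal (?W 1 p) + ennreal (?W 2 p) + ennreal (?N 1 p) + ennreal (?N 2 p))"
        using C(1) by (simp add: ennreal_mult'[symmetric] ennreal_plus[symmetric] ennreal_leI add_nonneg_nonneg del: ennreal_plus)
    qed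
    also have "\<dots> = ennreal C * (\<integral>\<^sup>+p. ennreal (?W 1 p) + ennreal (?W 2 p) + ennreal (?N 1 p) + ennreal (?N 2 p) \<partial>lborel)"
      by (intro nn_integral_cmult borel_measurable_add mw mq)
    also have "(\<integral>\<^sup>+p. ennreal (?W 1 p) + ennreal (?W 2 p) + ennreal (?N 1 p) + ennreal (?N 2 p) \<partial>lborel)
       = M_int n 1 + M_int n 2 + N_int n 1 + N_int n 2"
      unfolding M_int_def N_int_def
      by (subst nn_integral_add, (intro borel_measurable_add mw mq)+)+ (rule refl)
    finally show "F_int n i \<le> ennreal C * (M_int n 1 + M_int n 2 + N_int n 1 + N_int n 2)" .
  qed
qed

lemma Y_int_eq_0: "\<exists>n>0. \<forall>i. Y_int n i = 0"
proof -
  obtain C where C: "C \<ge> 0" "\<And>n i. F_int n i \<le> ennreal C * (M_int n 1 + M_int n 2 + N_int n 1 + N_int n 2)"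
    using F_le_M_N by blast
  \<comment> \<open>The coefficient of e in the last condition of \<open>absorption\<close>. The
    summands 1 in the denominators of \<open>e\<close> keep them positive even when C = 0.\<close>
  define A where "A = 8 * pi * C * ((2 / bump_mass) * (2 * C * T + 1) + 1) * T"
  define e where "e = Min {1, bump_mass / (2 * (2 * C * T + 1)), 1 / (2 * (A + 1))}"
  have A: "A \<ge> 0" unfolding A_def using C T bump_mass_pos
    by (intro mult_nonneg_nonneg add_nonneg_nonneg divide_nonneg_nonneg) auto
  have CT: "2 * C * T \<ge> 0" using C T by simp
  have e0: "e > 0" unfolding e_def using A CT bump_mass_pos by auto
  have e1: "e \<le> 1" and e2: "e \<le> bump_mass / (2 * (2 * C * T + 1))" and e3: "e \<le> 1 / (2 * (A + 1))"
    unfolding e_def by (intro Min_le; simp)+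
  have e2': "e * (2 * C * T) \<le> bump_mass / 2"
  proof -
    have "e * (2 * C * T) \<le> e * (2 * C * T + 1)" using e0 by simp
    also have "\<dots> \<le> bump_mass / 2" using e2 CT by (simp add: field_simps)
    finally show ?thesis .
  qed
  have e3': "e * A \<le> 1 / 2"
  proof -
    have "e * A \<le> e * (A + 1)" using e0 by simp
    also have "\<dots> \<le> 1 / 2" using e3 A by (simp add: field_simps)
    finally show ?thesis .
  qed
  have lim1: "(\<lambda>n. 2 * ray_integral T (real n / T\<^sup>2)) \<longlonglongrightarrow> 0"
  proof -
    have "filterlim (\<lambda>n. real n / T\<^sup>2) at_top sequentially"
      using filterlim_at_top_mult_tendsto_pos[OF tendsto_const _ filterlim_real_sequentially, of "1 / T\<^sup>2"] T
      by simp
    then have "(\<lambda>n. ray_integral T (real n / T\<^sup>2)) \<longlonglongrightarrow> 0" by (intro ray_integral_tendsto_0 T) auto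
    from tendsto_add[OF this this] show ?thesis by (simp add: mult_2)
  qed
  have ev1: "eventually (\<lambda>n. 2 * ray_integral T (real n / T\<^sup>2) < ennreal e) sequentially"
    using order_tendstoD(2)[OF lim1, of "ennreal e"] e0 by simp
  have "(\<lambda>n. T\<^sup>2 / real n) \<longlonglongrightarrow> 0" by (rule lim_const_over_n)
  then have ev2: "eventually (\<lambda>n. T\<^sup>2 / real n < e) sequentially" using e0 by (rule order_tendstoD(2))
  \<comment> \<open>A single n makes both small factors, the ray integral and the tail in time,
    smaller than e.\<close>
  from eventually_conj[OF eventually_conj[OF ev1 ev2] eventually_gt_at_top[of 0]]
  obtain n :: nat where n: "2 * ray_integral T (real n / T\<^sup>2) < ennreal e" "T\<^sup>2 / real n < e" "n > 0"
    by (auto dest: eventually_happens)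
  \<comment> \<open>The components are summed because the source of either one involves
    both.\<close>
  define Ms Ns Xs Ys Fs where "Ms = M_int n 1 + M_int n 2" and "Ns = N_int n 1 + N_int n 2"
    and "Xs = X_int n 1 + X_int n 2" and "Ys = Y_int n 1 + Y_int n 2" and "Fs = F_int n 1 + F_int n 2"
  have X_le: "Xs \<le> ennreal T * Ys"
    unfolding Xs_def Ys_def distrib_left by (intro add_mono X_le_Y)
  have N_le: "Ns \<le> ennreal e * Xs"
  proof -
    have "N_int n i \<le> ennreal e * X_int n i" for i
      using order_trans[OF N_le_X[OF n(3)] mult_right_mono[OF ennreal_leI[OF less_imp_le[OF n(2)]]]] by simp
    then show ?thesis unfolding Ns_def Xs_def distrib_left by (intro add_mono)
  qed
  have F_le: "Fs \<le> ennreal (2 * C) * (Ms + Ns)"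
  proof -
    have "Fs \<le> ennreal C * (Ms + Ns) + ennreal C * (Ms + Ns)"
      unfolding Fs_def Ms_def Ns_def using C(2)[of n] by (intro add_mono) (simp_all add: add.assoc)
    also have "\<dots> = ennreal (2 * C) * (Ms + Ns)"
    proof -
      have "2 * C = C + C" by simp
      then show ?thesis using C(1) by (simp only: ennreal_plus distrib_right)
    qed
    finally show ?thesis .
  qed
  have Y_le: "Ys \<le> ennreal (4 * pi) * Fs"
    unfolding Fs_def Ys_def distrib_left by (intro add_mono Y_le_F)
  have M_le: "ennreal bump_mass * Ms \<le> ennreal e * (ennreal T * Fs + Xs)"
  proof -
    have "ennreal bump_mass * M_int n i \<le> ennreal e * (ennreal T * F_int n i + X_int n i)" for i
      using order_trans[OF M_bound mult_left_mono[OF less_imp_le[OF n(1)]]] by (simp add: mult.commute)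
    then have "ennreal bump_mass * Ms \<le> ennreal e * (ennreal T * F_int n 1 + X_int n 1) + ennreal e * (ennreal T * F_int n 2 + X_int n 2)"
      unfolding Ms_def distrib_left[of "ennreal bump_mass"] by (intro add_mono)
    also have "\<dots> = ennreal e * (ennreal T * Fs + Xs)"
      unfolding Fs_def Xs_def by (simp add: distrib_left add_ac)
    finally show ?thesis .
  qed
  have fin: "Ms < \<infinity>" "Ys < \<infinity>" using M_int_finite Y_int_finite by (auto simp: Ms_def Ys_def)
  \<comment> \<open>Finiteness spreads along the inequalities: from Y to X, from X to N, and from M
    and N to F.\<close>
  have "Xs < \<infinity>" using X_le fin(2) by (auto simp: ennreal_mult_less_top intro: le_less_trans)
  moreover from this have "Ns < \<infinity>" using N_le by (auto simp: ennreal_mult_less_top intro: le_less_trans)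
  moreover from this have "Fs < \<infinity>" using F_le fin(1) by (auto simp: ennreal_mult_less_top intro: le_less_trans)
  ultimately obtain m nn x y ff where r: "Ms = ennreal m" "Ns = ennreal nn" "Xs = ennreal x" "Ys = ennreal y" "Fs = ennreal ff"
      "m \<ge> 0" "nn \<ge> 0" "x \<ge> 0" "y \<ge> 0" "ff \<ge> 0"
    using fin by (metis ennreal_cases infinity_ennreal_def less_irrefl)
  have "y = 0"
  proof (rule absorption[of m nn x y C T bump_mass e ff])
    show "bump_mass * m \<le> e * (T * ff + x)"
      using M_le r T e0 bump_mass_pos
      by (simp add: ennreal_mult'[symmetric] ennreal_plus[symmetric] del: ennreal_plus)
    show "ff \<le> 2 * C * (m + nn)"
      using F_le r C by (simp add: ennreal_mult'[symmetric] ennreal_plus[symmetric] del: ennreal_plus)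
    show "nn \<le> e * x" using N_le r e0 by (simp add: ennreal_mult'[symmetric])
    show "y \<le> 4 * pi * ff" using Y_le r by (simp add: ennreal_mult'[symmetric])
    show "x \<le> T * y" using X_le r T by (simp add: ennreal_mult'[symmetric])
    show "e * (8 * pi * C * ((2 / bump_mass) * (2 * C * T + 1) + 1) * T) \<le> 1 / 2"
      using e3' by (simp add: A_def)
  qed (use r C T bump_mass_pos e0 e1 e2' in auto)
  then have "Y_int n 1 = 0" "Y_int n 2 = 0" using r(4) by (auto simp: Ys_def)
  then have "\<forall>i. Y_int n i = 0" by (metis exhaust_2)
  then show ?thesis using n(3) by blast
qed

text \<open>The weight at 2|x| is positive only for |x| < T/2, so the vanishing integral gives Q = 0
  almost everywhere on the open ball. Continuity of Q removes the exceptional set and adds the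
  boundary.\<close>

lemma Q_eq_0:
  assumes "norm x \<le> T / 2"
  shows "Q i x = 0"
proof (rule ccontr)
  assume "Q i x \<noteq> 0"
  then have pos: "Q i x > 0" using Q_nonneg[of i x] by linarith
  obtain n where n: "n > 0" "Y_int n i = 0" using Y_int_eq_0 by blast
  let ?O = "{y. Q i y > 0}"
  have O: "open ?O" by (intro open_Collect_less continuous_Q continuous_on_const)
  \<comment> \<open>Passing to the closure treats the sphere |x| = T/2 too: the open set where Q is
    positive would have to meet the open ball.\<close>
  have "x \<in> closure (ball 0 (T / 2))" using assms T by simp
  then have "ball 0 (T / 2) \<inter> ?O \<noteq> {}"
    using open_Int_closure_eq_empty[OF O, of "ball 0 (T / 2)"] pos by blast
  moreover have "open (ball 0 (T / 2) \<inter> ?O)" using O by auto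
  moreover have "negligible (ball 0 (T / 2) \<inter> ?O)"
  proof -
    have "AE y in lborel. ennreal (Q i y * exp_weight T n (2 * norm y) / (norm y)\<^sup>2) = 0"
      using n(2) unfolding Y_int_def by (subst (asm) nn_integral_0_iff_AE) auto
    then have "AE y in lborel. y \<notin> ball 0 (T / 2) \<inter> ?O"
      using AE_lborel_singleton[of 0]
    proof eventually_elim
      case (elim y)
      show ?case
      proof
        assume "y \<in> ball 0 (T / 2) \<inter> ?O"
        then have "Q i y > 0" "exp_weight T n (2 * norm y) > 0"
          using n(1) by (auto intro!: exp_weight_pos)
        then have "Q i y * exp_weight T n (2 * norm y) / (norm y)\<^sup>2 > 0" using elim(2) by simp
        then show False using elim(1) by (simp add: ennreal_eq_0_iff)
      qed
    qed
    then have "ball 0 (T / 2) \<inter> ?O \<in> null_sets lborel"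
      using O by (subst (asm) AE_iff_null_sets[symmetric]) auto
    then show ?thesis by (simp add: negligible_iff_null_sets null_sets_completionI)
  qed
  ultimately show False using open_not_negligible by blast
qed

text \<open>The ordering of the potentials recovers the matrix from its row sums: nonnegative
  entries with sum 0 are all 0.\<close>

lemma P_eq:
  assumes "norm x \<le> T / 2"
  shows "P1 x = P2 x"
proof -
  have "P1 x $ i $ j - P2 x $ i $ j = 0" for i j
    using Q_eq_0[OF assms, of i] unfolding Q_def
    by (subst (asm) sum_nonneg_eq_0_iff) (auto simp: P_le)
  then show ?thesis by (simp add: vec_eq_iff)
qed

end

theorem theorem1p1:
  fixes T :: real
    and P1 P2 :: "real^3 \<Rightarrow> real^2^2"
    and U1 U2 :: "(spacetime functional)^2"
    and R1 R2 :: "spacetime \<Rightarrow> real^2"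
  assumes "T > 0"
    and "\<And>i j. smooth_fun (\<lambda>x. P1 x $ i $ j)"
    and "\<And>i j. smooth_fun (\<lambda>x. P2 x $ i $ j)"
    and "solves_point_source_ivp P1 U1"
    and "solves_point_source_ivp P2 U2"
    and "is_regular_part P1 U1 R1"
    and "is_regular_part P2 U2 R2"
    and "\<And>x i j. P1 x $ i $ j \<ge> P2 x $ i $ j"
    and "\<And>t. 0 < t \<Longrightarrow> t \<le> T \<Longrightarrow> R1 (t, 0) = R2 (t, 0)"
  shows "\<forall>x. norm x \<le> T / 2 \<longrightarrow> P1 x = P2 x"
proof -
  interpret wave_pair T P1 P2 U1 U2 R1 R2
    by (rule wave_pair.intro) (fact assms)+
  show ?thesis using P_eq by blast
qed

end
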